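(* Let $(u_h,\hat u_h)\in\mathcal{X}_h^k$, and let $\Gamma=\bigcup_{i=1}^N e_i$ be a union of distinct boundary faces $e_1,\dots,e_N\in\partial\mathcal{T}_h^b$ having positive $(d-1)$-dimensional measure. Then the following trace inequalities hold: $$\|u_h\|_{L^2(\partial\mathcal{T}_h^b)}^2\lesssim h|u_h|_{H^1(\mathcal{T}_h)}^2+\|u_h-\hat u_h\|^2_{L^2(\partial\mathcal{T}_h^b)}+(1+h)\left|\mathcal{L}^{\mathcal{CR}}_h(\bar{\hat u}_h)\right|_{H^1(\mathcal{T}_h)}^2+\left(\int_\Gamma\hat u_h\,ds\right)^2$$ and $$\|\hat u_h\|_{L^2(\partial\mathcal{T}_h^b)}^2\lesssim h|u_h|_{H^1(\mathcal{T}_h)}^2+\|u_h-\hat u_h\|^2_{L^2(\partial\mathcal{T}_h^b)}+(1+h)\left|\mathcal{L}^{\mathcal{CR}}_h(\bar{\hat u}_h)\right|_{H^1(\mathcal{T}_h)}^2+\left(\int_\Gamma\hat u_h\,ds\right)^2.$$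
   Context: $\Omega\subset\mathbb{R}^d$, $d\in\{2,3\}$, is a connected, bounded, open polyhedral domain; $k\ge 0$ is an integer. $\mathcal{T}_h$ is a triangulation of $\Omega$ into simplices $K$ (triangles if $d=2$, tetrahedra if $d=3$), with no hanging nodes, which is shape regular, $\min_{K\in\mathcal{T}_h}|K|/\mathrm{diam}(K)^d\ge\kappa_{\mathcal{T}}>0$, and quasi-uniform, $\mathrm{diam}(K)/\mathrm{diam}(K')\le A_{\mathrm{qu}}$ for all $K,K'\in\mathcal{T}_h$, with constants $\kappa_{\mathcal{T}},A_{\mathrm{qu}}$ not depending on the mesh. $h_K=\mathrm{diam}(K)$ and $h=\max_K h_K$. $\partial\mathcal{T}_h=\partial\mathcal{T}_h^i\cup\partial\mathcal{T}_h^b$ is the set of all faces (the skeleton), split into interior and boundary faces; $|e|$ is the $(d-1)$-dimensional measure of a face $e$. Spaces: $\mathcal{P}^k$ denotes polynomials of degree at most $k$; $\mathcal{U}_h^k=\{f\in L^2(\mathcal{T}_h): f|_K\in\mathcal{P}^k(K)\ \forall K\in\mathcal{T}_h\}$; $\mathcal{F}_h^k=\{\hat f\in L^2(\partial\mathcal{T}_h):\hat f|_e\in\mathcal{P}^k(e)\ \forall e\in\partial\mathcal{T}_h\}$ (one value on each face); $\mathcal{X}_h^k=\mathcal{U}_h^k\times\mathcal{F}_h^k$. Norms: $|u|_{H^1(\mathcal{T}_h)}^2=\sum_K\|\nabla u\|_{L^2(K)}^2$; $\|w\|_{L^2(\partial\mathcal{T}_h^b)}^2=\sum_{e\in\partial\mathcal{T}_h^b}\|w\|_{L^2(e)}^2$,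 i.e. the $L^2(\partial\Omega)$ norm, with $u_h$ understood through its elementwise trace. Face averages: $\bar{\hat u}_h$ is the piecewise constant function on the skeleton with $\bar{\hat u}_h|_e=\frac1{|e|}\int_e\hat u_h\,ds$ for each face $e$. Crouzeix–Raviart lifting: $\mathcal{CR}(\mathcal{T}_h)=\{f\in L^2(\mathcal{T}_h): f|_K\in\mathcal{P}^1(K)\ \forall K,\ \int_e[[f]]_e\,ds=0\ \forall e\in\partial\mathcal{T}_h^i\}$, where $[[f]]_e=f^+\mathbf{n}^++f^-\mathbf{n}^-$ is the jump across $e$ ($f^\pm$ and $\mathbf{n}^\pm$ being the traces and outward unit normals from the two sides). $\mathcal{P}^0(\partial\mathcal{T}_h)$ is the space of piecewise constant functions on the skeleton, and $\mathcal{L}^{\mathcal{CR}}_h:\mathcal{P}^0(\partial\mathcal{T}_h)\to\mathcal{CR}(\mathcal{T}_h)$ is defined by $\mathcal{L}^{\mathcal{CR}}_h(\hat\mu)(c_e)=\hat\mu|_e$ for every face $e$, where $c_e$ is the center (barycenter) of $e$. Convention: $A\lesssim B$ means $A\le CB$ with a constant $C>0$ independent of the functions involved and of the mesh (hence of $h$); it may depend on $\Omega$, $d$, $k$, $\kappa_{\mathcal{T}}$, $A_{\mathrm{qu}}$ and the set $\Gamma\subset\partial\Omega$. *)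

theory Defs
  imports "HOL-Analysis.Analysis"
begin

subsection \<open>Domains and meshes\<close>

text \<open>
  A polyhedral domain is a bounded, connected, open set that is the interior of a finite union of
  polytopes. In particular it is the interior of its closure (no slits), so that it lies locally on
  one side of almost every boundary point. No Lipschitz condition is imposed.
\<close>

definition polyhedral_domain :: "(real^'n) set \<Rightarrow> bool" where
  "polyhedral_domain \<Omega> \<longleftrightarrow> \<Omega> \<noteq> {} \<and> open \<Omega> \<and> connected \<Omega> \<and> bounded \<Omega> \<and>
     (\<exists>P. finite P \<and> (\<forall>p\<in>P. polytope p) \<and> \<Omega> = interior (\<Union>P))"

text \<open>
  The library's \<^const>\<open>triangulation\<close> demands that any two elements intersect in a common face
  (possibly empty), i.e. that there are no hanging nodes.
\<close>

definition mesh_of :: "(real^'n) set \<Rightarrow> (real^'n) set set \<Rightarrow> bool" where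
  "mesh_of \<Omega> T \<longleftrightarrow> triangulation T \<and> (\<forall>K\<in>T. int CARD('n) simplex K) \<and> \<Union>T = closure \<Omega>"

definition shape_regular :: "real \<Rightarrow> (real^'n) set set \<Rightarrow> bool" where
  "shape_regular \<kappa> T \<longleftrightarrow> (\<forall>K\<in>T. measure lborel K / diameter K ^ CARD('n) \<ge> \<kappa>)"

definition quasi_uniform :: "real \<Rightarrow> (real^'n) set set \<Rightarrow> bool" where
  "quasi_uniform A T \<longleftrightarrow> (\<forall>K\<in>T. \<forall>K'\<in>T. diameter K / diameter K' \<le> A)"

definition mesh_size :: "(real^'n) set set \<Rightarrow> real" where
  "mesh_size T = Max (diameter ` T)"

definition faces :: "(real^'n) set set \<Rightarrow> (real^'n) set set" where
  "faces T = {e. \<exists>K\<in>T. e facet_of K}"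

definition boundary_faces :: "(real^'n) set \<Rightarrow> (real^'n) set set \<Rightarrow> (real^'n) set set" where
  "boundary_faces \<Omega> T = {e \<in> faces T. e \<subseteq> frontier \<Omega>}"

definition interior_faces :: "(real^'n) set \<Rightarrow> (real^'n) set set \<Rightarrow> (real^'n) set set" where
  "interior_faces \<Omega> T = faces T - boundary_faces \<Omega> T"


subsection \<open>Surface measure on a face\<close>

definition unit_normal :: "(real^'n) set \<Rightarrow> real^'n" where
  "unit_normal e = (SOME n. norm n = 1 \<and> (\<forall>x\<in>e. \<forall>y\<in>e. n \<bullet> (x - y) = 0))"

text \<open>
  The \<open>(d-1)\<close>-dimensional Lebesgue measure on a flat face \<open>e\<close>: a set \<open>A \<subseteq> e\<close> is assigned the volume
  of the right prism of height \<open>1\<close> over \<open>A\<close>. As a measure on \<open>e\<close> this is the image of Lebesgue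
  measure on the prism over \<open>e\<close> under orthogonal projection onto the hyperplane of \<open>e\<close>; it does not
  depend on which of the two unit normals is chosen.
\<close>

definition prism :: "(real^'n) set \<Rightarrow> (real^'n) set" where
  "prism e = {x + t *\<^sub>R unit_normal e | x t. x \<in> e \<and> 0 \<le> t \<and> t \<le> 1}"

definition face_measure :: "(real^'n) set \<Rightarrow> (real^'n) measure" where
  "face_measure e =
     distr (restrict_space lborel (prism e)) (restrict_space borel e) (closest_point (affine hull e))"

definition face_area :: "(real^'n) set \<Rightarrow> real" where
  "face_area e = measure (face_measure e) e"


subsection \<open>Discrete spaces\<close>

definition polys :: "nat \<Rightarrow> (real^'n \<Rightarrow> real) set" where
  "polys k = {p. \<exists>c :: ('n \<Rightarrow> nat) \<Rightarrow> real.
     p = (\<lambda>x. \<Sum>\<alpha> | (\<Sum>i\<in>UNIV. \<alpha> i) \<le> k. c \<alpha> * (\<Prod>i\<in>UNIV. (x $ i) ^ \<alpha> i))}"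

text \<open>
  A function on the mesh is represented by the family of its restrictions, \<open>u K\<close> being the function
  on the element \<open>K\<close>; hence it is double-valued on interior faces and \<open>u K\<close> at a point of a face of
  \<open>K\<close> is the elementwise trace. A function on the skeleton is likewise a family
  indexed by faces. The values of \<open>u K\<close> outside \<open>K\<close> and of \<open>w e\<close> outside \<open>e\<close> are irrelevant.
\<close>

definition U_space :: "nat \<Rightarrow> (real^'n) set set \<Rightarrow> ((real^'n) set \<Rightarrow> real^'n \<Rightarrow> real) set" where
  "U_space k T = {u. \<forall>K\<in>T. \<exists>p\<in>polys k. \<forall>x\<in>K. u K x = p x}"

definition F_space :: "nat \<Rightarrow> (real^'n) set set \<Rightarrow> ((real^'n) set \<Rightarrow> real^'n \<Rightarrow> real) set" where
  "F_space k T = {w. \<forall>e\<in>faces T. \<exists>p\<in>polys k. \<forall>x\<in>e. w e x = p x}"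

definition X_space ::
  "nat \<Rightarrow> (real^'n) set set \<Rightarrow>
     (((real^'n) set \<Rightarrow> real^'n \<Rightarrow> real) \<times> ((real^'n) set \<Rightarrow> real^'n \<Rightarrow> real)) set" where
  "X_space k T = U_space k T \<times> F_space k T"


subsection \<open>Norms\<close>

definition grad :: "(real^'n \<Rightarrow> real) \<Rightarrow> real^'n \<Rightarrow> real^'n" where
  "grad f x = (THE D. GDERIV f x :> D)"

definition H1_seminorm :: "(real^'n) set set \<Rightarrow> ((real^'n) set \<Rightarrow> real^'n \<Rightarrow> real) \<Rightarrow> real" where
  "H1_seminorm T u = sqrt (\<Sum>K\<in>T. LINT x:interior K|lborel. (norm (grad (u K) x))\<^sup>2)"

text \<open>A boundary face belongs to exactly one element.\<close>

definition bdry_trace ::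
  "(real^'n) set set \<Rightarrow> ((real^'n) set \<Rightarrow> real^'n \<Rightarrow> real) \<Rightarrow> (real^'n) set \<Rightarrow> real^'n \<Rightarrow> real" where
  "bdry_trace T u e = u (THE K. K \<in> T \<and> e facet_of K)"

definition bdry_norm ::
  "(real^'n) set \<Rightarrow> (real^'n) set set \<Rightarrow> ((real^'n) set \<Rightarrow> real^'n \<Rightarrow> real) \<Rightarrow> real" where
  "bdry_norm \<Omega> T w = sqrt (\<Sum>e\<in>boundary_faces \<Omega> T. LINT x|face_measure e. (w e x)\<^sup>2)"


subsection \<open>Face averages and the Crouzeix--Raviart lifting\<close>

text \<open>A piecewise constant function on the skeleton is represented by its value on each face.\<close>

definition face_avg :: "((real^'n) set \<Rightarrow> real^'n \<Rightarrow> real) \<Rightarrow> (real^'n) set \<Rightarrow> real" where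
  "face_avg w e = (1 / face_area e) * (LINT x|face_measure e. w e x)"

definition outward_normal :: "(real^'n) set \<Rightarrow> (real^'n) set \<Rightarrow> real^'n" where
  "outward_normal K e = (THE n. norm n = 1 \<and> (\<forall>x\<in>K. \<forall>y\<in>e. n \<bullet> (x - y) \<le> 0))"

text \<open>An interior face belongs to exactly two elements, so the sum has the two terms of the jump.\<close>

definition jump ::
  "(real^'n) set set \<Rightarrow> ((real^'n) set \<Rightarrow> real^'n \<Rightarrow> real) \<Rightarrow> (real^'n) set \<Rightarrow> real^'n \<Rightarrow> real^'n" where
  "jump T f e x = (\<Sum>K | K \<in> T \<and> e facet_of K. f K x *\<^sub>R outward_normal K e)"

definition CR_space ::
  "(real^'n) set \<Rightarrow> (real^'n) set set \<Rightarrow> ((real^'n) set \<Rightarrow> real^'n \<Rightarrow> real) set" where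
  "CR_space \<Omega> T = {f \<in> U_space 1 T. \<forall>e\<in>interior_faces \<Omega> T. (LINT x|face_measure e. jump T f e x) = 0}"

definition barycenter :: "(real^'n) set \<Rightarrow> real^'n" where
  "barycenter e = (1 / real (card {v. v extreme_point_of e})) *\<^sub>R (\<Sum>v | v extreme_point_of e. v)"

text \<open>
  The defining conditions determine \<open>f K\<close> on \<open>K\<close> for every element \<open>K\<close>; only irrelevant values
  are left to the choice.
\<close>

definition CR_lift ::
  "(real^'n) set \<Rightarrow> (real^'n) set set \<Rightarrow> ((real^'n) set \<Rightarrow> real) \<Rightarrow> (real^'n) set \<Rightarrow> real^'n \<Rightarrow> real" where
  "CR_lift \<Omega> T \<mu> = (SOME f. f \<in> CR_space \<Omega> T \<and>
     (\<forall>e\<in>faces T. \<forall>K\<in>T. e facet_of K \<longrightarrow> f K (barycenter e) = \<mu> e))"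

end

theory Submission
  imports Defs
begin

text \<open>
  Let \<open>w\<close> be the Crouzeix--Raviart lifting of the face averages. It is sampled once per element, and the
  samples of two elements with a common facet differ by at most \<open>h\<close> times the sum of the two gradient norms.
  Along a segment that avoids the faces of codimension two, consecutive elements share a facet, so the
  difference of the samples at its ends is bounded by the sum over the elements it meets; there are at
  most of the order of \<open>1/h\<close> of these. Averaging over parallel segments, each element is met by a set of
  segments of measure of the order of \<open>h\<close> to the power \<open>d-1\<close>. This compares \<open>w\<close> with its translates without
  any reference to jumps or to conforming functions.

  Since the domain is a finite union of polytopes, finitely many translation vectors lead from
  every boundary point into the interior, transversally to all the hyperplanes that carry the boundary.
  Transversality implies that an element is met by a bounded number of the segments that start at
  the boundary faces, and connectedness of the domain compares the different interior points. Hence the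
  face averages on the boundary are controlled, up to a constant, by the broken gradient of \<open>w\<close>, and the integral over
  \<open>\<Gamma>\<close> fixes the constant. The deviation of \<open>u\<close> from a constant on a boundary face is controlled
  by an inverse inequality on its element.
\<close>

subsection \<open>Segments through a mesh\<close>

text \<open>Neighbouring affine pieces of \<open>w\<close> agree only at the barycenter of a common
  facet, so samples are compared across facets only; all depends on the powers of \<open>h\<close>.
  Cauchy-Schwarz along a segment costs the number of elements hit, of order 1/h, so \<open>h\<close>
  times a squared difference is bounded by the sum of \<open>(b K)^2\<close> over the hits, where
  \<open>b K\<close> is \<open>h\<close> times the gradient norm. For segments from the boundary the
  overlap is bounded, so \<open>h\<close> times the sum over faces is bounded by the energy, which
  is of order h^(2-d) times the squared seminorm. Face areas of order h^(d-1) restore exactly the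
  squared seminorm. Between interior points the bound for one segment would be paid once for each of
  order h^(1-d) boundary faces; averaging over translations gains h^(d-1) and compensates. Every
  constant has to be fixed before the mesh, hence the bounds in terms of \<open>\<theta>\<close> and
  of an upper bound \<open>D\<close> for \<open>h\<close>. The set \<open>\<Gamma>\<close> is fixed
  but its decomposition into faces varies, so its area is bounded below through one face of one
  admissible decomposition.\<close>

definition codim2_skeleton :: "'a::euclidean_space set set \<Rightarrow> 'a set" where
  "codim2_skeleton T = \<Union>{F. \<exists>K\<in>T. F face_of K \<and> aff_dim F + 2 \<le> int DIM('a)}"

definition facet_adjacent :: "'a::euclidean_space set \<Rightarrow> 'a set \<Rightarrow> bool" where
  "facet_adjacent K L \<longleftrightarrow> (\<exists>e. e facet_of K \<and> e facet_of L)"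

text \<open>Shape regularity and quasi-uniformity enter only through the last two assumptions: one
  length \<open>h\<close> bounds every diameter from above and, as \<open>\<theta> * h ^ d\<close>,
  every volume from below. This is the form in which elements can be counted by volume.\<close>

locale uniform_mesh =
  fixes T :: "'a::euclidean_space set set" and h \<theta> :: real
  assumes triangulation: "triangulation T"
    and full_dim: "K \<in> T \<Longrightarrow> int DIM('a) simplex K"
    and h_pos: "h > 0"
    and \<theta>_pos: "\<theta> > 0"
    and dist_le: "\<lbrakk>K \<in> T; x \<in> K; y \<in> K\<rbrakk> \<Longrightarrow> dist x y \<le> h"
    and volume_ge: "K \<in> T \<Longrightarrow> \<theta> * h ^ DIM('a) \<le> measure lborel K"
begin

lemma finite_mesh: "finite T"
  using triangulation by (simp add: triangulation_def)

lemma Int_face_of: "K \<in> T \<Longrightarrow> L \<in> T \<Longrightarrow> K \<inter> L face_of K"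
  using triangulation by (simp add: triangulation_def)

lemma compact_element: "K \<in> T \<Longrightarrow> compact K"
  using full_dim compact_simplex by blast

lemma closed_element: "K \<in> T \<Longrightarrow> closed K"
  by (simp add: compact_element compact_imp_closed)

lemma convex_element: "K \<in> T \<Longrightarrow> convex K"
  using full_dim convex_simplex by blast

lemma polytope_element: "K \<in> T \<Longrightarrow> polytope K"
  using full_dim simplex_imp_polytope by blast

lemma aff_dim_element: "K \<in> T \<Longrightarrow> aff_dim K = int DIM('a)"
  using full_dim aff_dim_simplex by blast

lemma interior_element_nonempty: "K \<in> T \<Longrightarrow> interior K \<noteq> {}"
  using aff_dim_element[of K] convex_element[of K]
  by (auto simp: interior_rel_interior_gen rel_interior_eq_empty)

text \<open>A proper face of a convex set has strictly smaller dimension, so a full-dimensional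
  intersection, being a face of both elements, is all of both.\<close>

lemma element_eqI:
  assumes "K \<in> T" "L \<in> T" and "interior (K \<inter> L) \<noteq> {}"
  shows "K = L"
proof -
  have "aff_dim (K \<inter> L) = int DIM('a)"
    using assms(3) aff_dim_nonempty_interior by blast
  then show ?thesis
    using Int_face_of[of K L] Int_face_of[of L K] face_of_aff_dim_lt aff_dim_element convex_element assms
    by (metis Int_commute less_irrefl)
qed

lemma disjoint_interiors:
  assumes "K \<in> T" "L \<in> T" "K \<noteq> L"
  shows "interior K \<inter> interior L = {}"
  using element_eqI[OF assms(1,2)] assms(3) by auto

lemma measure_interior_element:
  assumes "K \<in> T"
  shows "measure lborel (interior K) = measure lborel K"
proof -
  have "measure lebesgue (interior K) = measure lebesgue K"
    using assms by (intro measure_interior) (auto intro: compact_imp_bounded compact_element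
        negligible_convex_frontier convex_element)
  then show ?thesis
    using closed_element[OF assms] by (simp add: measure_completion)
qed

text \<open>Packing: open elements are disjoint and each has volume at least
  \<open>\<theta> * h ^ d\<close>, so the volume of the balls limits their number. It is applied to
  tubes around segments, to balls of radius of order \<open>h\<close>, and to a ball around the
  whole domain.\<close>

lemma card_elements_in_balls:
  assumes "S \<subseteq> T" "finite I" "r \<ge> 0" and cover: "\<And>K. K \<in> S \<Longrightarrow> K \<subseteq> (\<Union>i\<in>I. cball (a i) r)"
  shows "card S * (\<theta> * h ^ DIM('a)) \<le> card I * (unit_ball_vol (real DIM('a)) * r ^ DIM('a))"
proof -
  have fin: "finite S"
    using assms(1) finite_mesh finite_subset by blast
  have bd: "interior K \<in> fmeasurable lborel" if "K \<in> S" for K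
    using that assms(1) compact_element
    by (intro fmeasurableI2[OF fmeasurable_compact[of K]]) (auto simp: interior_subset)
  have "card S * (\<theta> * h ^ DIM('a)) \<le> (\<Sum>K\<in>S. measure lborel (interior K))"
    using assms(1) measure_interior_element volume_ge by (intro sum_bounded_below) auto
  also have "\<dots> = measure lborel (\<Union>K\<in>S. interior K)"
  proof (rule measure_finite_Union[OF fin, symmetric])
    show "(\<lambda>K. interior K) ` S \<subseteq> sets lborel" by auto
    show "disjoint_family_on interior S"
      using assms(1) disjoint_interiors by (fastforce simp: disjoint_family_on_def)
    show "emeasure lborel (interior K) \<noteq> \<infinity>" if "K \<in> S" for K
      using bd[OF that] by (simp add: fmeasurable_def less_top)
  qed
  also have "\<dots> \<le> measure lborel (\<Union>i\<in>I. cball (a i) r)"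
  proof (rule measure_mono_fmeasurable)
    show "(\<Union>K\<in>S. interior K) \<subseteq> (\<Union>i\<in>I. cball (a i) r)"
      using cover interior_subset by blast
    show "(\<Union>i\<in>I. cball (a i) r) \<in> fmeasurable lborel"
      using \<open>finite I\<close> by (intro fmeasurable.finite_UN) (auto intro: fmeasurable_compact)
    show "(\<Union>K\<in>S. interior K) \<in> sets lborel"
      unfolding sets_lborel by (intro borel_open open_UN) auto
  qed
  also have "\<dots> \<le> (\<Sum>i\<in>I. measure lborel (cball (a i) r))"
    using \<open>finite I\<close> by (intro measure_UNION_le) auto
  also have "\<dots> = card I * (unit_ball_vol (real DIM('a)) * r ^ DIM('a))"
    using \<open>r \<ge> 0\<close> by (simp add: content_cball)
  finally show ?thesis .
qed

end

text \<open>Balls of radius \<open>2 * h\<close> around points of the segment with spacing at most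
  \<open>h\<close>. The count is stated for \<open>h * card I\<close>, so that a degenerate segment
  and a large \<open>h\<close> need no separate case.\<close>

lemma segment_nbhd_cover:
  fixes x v :: "'a::real_normed_vector" and h :: real
  assumes "h > 0"
  obtains I :: "nat set" and a where "finite I" "h * card I \<le> norm v + 3 * h"
    "\<And>y s. \<lbrakk>0 \<le> s; s \<le> 1; dist y (x + s *\<^sub>R v) \<le> h\<rbrakk> \<Longrightarrow> y \<in> (\<Union>i\<in>I. cball (a i) (2 * h))"
proof -
  \<comment> \<open>\<open>N \<ge> norm v / h\<close> makes the spacing at most \<open>h\<close>;
    the summand 1 keeps \<open>N\<close> positive when \<open>v = 0\<close>. The
    \<open>N + 1\<close> points number at most \<open>norm v / h + 3\<close>, which gives the term
    \<open>3 * h\<close>.\<close>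
  define N where "N = nat \<lceil>norm v / h\<rceil> + 1"
  have N: "norm v / h \<le> N" "N \<le> norm v / h + 2" "N > 0"
    using assms unfolding N_def by (auto simp: of_nat_nat ceiling_le_iff) linarith+
  define a where "a i = x + (real i / real N) *\<^sub>R v" for i
  have "y \<in> (\<Union>i\<in>{..N}. cball (a i) (2 * h))"
    if s: "0 \<le> s" "s \<le> 1" "dist y (x + s *\<^sub>R v) \<le> h" for y s
  proof -
    define i where "i = nat \<lfloor>s * N\<rfloor>"
    have i: "real i \<le> s * N" "s * N \<le> real i + 1"
    proof -
      have "0 \<le> s * N" using s by simp
      then show "real i \<le> s * N" "s * N \<le> real i + 1" unfolding i_def by linarith+
    qed
    have "s * N \<le> 1 * real N" using s by (intro mult_right_mono) auto
    then have "i \<le> N" using i(1) by linarith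
    have "\<bar>s - i / N\<bar> \<le> 1 / N"
    proof -
      have "s - i / N = (s * N - i) / N"
        using \<open>N > 0\<close> by (simp add: field_simps)
      then have "\<bar>s - i / N\<bar> = \<bar>s * N - i\<bar> / N" by simp
      also have "\<dots> \<le> 1 / N"
        using i by (intro divide_right_mono) auto
      finally show ?thesis .
    qed
    then have "\<bar>s - i / N\<bar> * norm v \<le> 1 / N * norm v"
      by (intro mult_right_mono) auto
    also have "\<dots> \<le> h"
      using N assms by (simp add: field_simps)
    finally have "dist (x + s *\<^sub>R v) (a i) \<le> h"
      by (simp add: a_def dist_norm flip: scaleR_diff_left)
    then have "dist (a i) y \<le> 2 * h"
      using s(3) dist_triangle[of "a i" y "x + s *\<^sub>R v"] by (simp add: dist_commute)
    then show ?thesis using \<open>i \<le> N\<close> by auto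
  qed
  moreover have "h * card {..N} \<le> norm v + 3 * h"
    using N(2) assms by (simp add: field_simps)
  ultimately show ?thesis
    using that[of "{..N}" a] by blast
qed

text \<open>Sweeping along a line raises the dimension by at most one, so the swept set lies in a
  translate of a proper subspace. It handles segments of fixed direction whose start moves, and the
  prism over a low-dimensional part of a face.\<close>

lemma negligible_line_sweep:
  fixes F :: "'a::euclidean_space set"
  assumes "aff_dim F + 2 \<le> int DIM('a)"
  shows "negligible {x + t *\<^sub>R u | x t. x \<in> F}"
proof (cases "F = {}")
  case False
  then obtain a where a: "a \<in> F" by blast
  let ?G = "insert u ((+) (- a) ` F)"
  have "aff_dim F = int (dim ((+) (- a) ` F))"
    using a by (intro aff_dim_eq_dim hull_inc)
  then have "dim ?G < DIM('a)"
    using assms by (auto simp: dim_insert)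
  then have "negligible (span ?G)"
    by (intro negligible_lowdim) simp
  then have "negligible ((+) a ` span ?G)"
    by (rule negligible_translation)
  moreover have "{x + t *\<^sub>R u | x t. x \<in> F} \<subseteq> (+) a ` span ?G"
  proof clarify
    fix x t assume "x \<in> F"
    then have "(- a + x) + t *\<^sub>R u \<in> span ?G"
      by (intro span_add span_scale span_base) auto
    then have "a + ((- a + x) + t *\<^sub>R u) \<in> (+) a ` span ?G"
      by (rule imageI)
    then show "x + t *\<^sub>R u \<in> (+) a ` span ?G" by (simp add: algebra_simps)
  qed
  ultimately show ?thesis
    by (rule negligible_subset)
qed simp

text \<open>With its apex moved to the origin, the cone spans a subspace whose dimension exceeds
  that of \<open>F\<close> by at most one. It handles segments with a fixed start whose direction
  moves.\<close>

lemma negligible_cone: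
  fixes F :: "'a::euclidean_space set"
  assumes "aff_dim F + 2 \<le> int DIM('a)"
  shows "negligible {t *\<^sub>R (x - a) | x t. x \<in> F}"
proof -
  let ?G = "(+) (- a) ` insert a F"
  have "aff_dim (insert a F) = int (dim ?G)"
    by (intro aff_dim_eq_dim hull_inc) simp
  moreover have "aff_dim (insert a F) \<le> aff_dim F + 1"
    by (auto simp: aff_dim_insert)
  ultimately have "dim (span ?G) < DIM('a)"
    using assms unfolding dim_span by linarith
  then have "negligible (span ?G)"
    by (rule negligible_lowdim)
  moreover have "{t *\<^sub>R (x - a) | x t. x \<in> F} \<subseteq> span ?G"
    by clarify (intro span_scale span_base, simp)
  ultimately show ?thesis
    by (rule negligible_subset)
qed

section \<open>Oscillation along a connected set, and the elements hit by a segment\<close>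

context uniform_mesh
begin

text \<open>The common face cannot be all of both elements, so its dimension is below
  \<open>d\<close>; containing a point off the skeleton, it has dimension above
  \<open>d - 2\<close>.\<close>

lemma facet_adjacentI:
  assumes "K \<in> T" "L \<in> T" "K \<noteq> L" "z \<in> K" "z \<in> L" "z \<notin> codim2_skeleton T"
  shows "facet_adjacent K L"
proof -
  have face: "K \<inter> L face_of K" "K \<inter> L face_of L"
    using Int_face_of[of K L] Int_face_of[of L K] assms by (auto simp: Int_commute)
  then have "\<not> aff_dim (K \<inter> L) + 2 \<le> int DIM('a)"
    using assms unfolding codim2_skeleton_def by blast
  moreover have "K \<inter> L \<noteq> K \<or> K \<inter> L \<noteq> L"
    using assms(3) by auto
  then have "aff_dim (K \<inter> L) < int DIM('a)"
    using face face_of_aff_dim_lt convex_element aff_dim_element assms(1,2) by metis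
  ultimately have "aff_dim (K \<inter> L) = int DIM('a) - 1" by linarith
  then show ?thesis
    unfolding facet_adjacent_def facet_of_def using face assms aff_dim_element by (metis Int_iff empty_iff)
qed

lemma closed_meets: "K \<in> T \<Longrightarrow> closed S \<Longrightarrow> closed (K \<inter> S)"
  by (simp add: closed_element closed_Int)

text \<open>The intervals \<open>[f K - b K, f K + b K]\<close> of the elements that meet the connected set \<open>S\<close> cover
  everything between two values of \<open>f\<close>: a gap would split \<open>S\<close> into two closed pieces.\<close>

lemma connected_oscillation:
  fixes f b :: "'a set \<Rightarrow> real"
  assumes adj: "\<And>K L. \<lbrakk>K \<in> T; L \<in> T; facet_adjacent K L\<rbrakk> \<Longrightarrow> \<bar>f K - f L\<bar> \<le> b K + b L"
    and b: "\<And>K. K \<in> T \<Longrightarrow> b K \<ge> 0"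
    and S: "connected S" "closed S" "S \<subseteq> \<Union>T" "S \<inter> codim2_skeleton T = {}"
    and KL: "K \<in> T" "K \<inter> S \<noteq> {}" "L \<in> T" "L \<inter> S \<noteq> {}"
  shows "\<bar>f K - f L\<bar> \<le> 2 * (\<Sum>M | M \<in> T \<and> M \<inter> S \<noteq> {}. b M)"
proof -
  let ?H = "{M \<in> T. M \<inter> S \<noteq> {}}"
  have finH: "finite ?H" using finite_mesh by simp
  have ge: "0 \<le> (\<Sum>M\<in>?H. b M)" using b by (intro sum_nonneg) auto
  have main: "f L - f K \<le> 2 * (\<Sum>M\<in>?H. b M)"
    if KL: "K \<in> T" "K \<inter> S \<noteq> {}" "L \<in> T" "L \<inter> S \<noteq> {}" and less: "f K < f L" for K L
  proof -
    have "{f K..f L} \<subseteq> (\<Union>M\<in>?H. {f M - b M..f M + b M})"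
    proof (rule ccontr)
      assume "\<not> ?thesis"
      then obtain t where "t \<in> {f K..f L}" "\<forall>M\<in>?H. t \<notin> {f M - b M..f M + b M}"
        by blast
      then have t: "f K \<le> t" "t \<le> f L" "\<And>M. M \<in> ?H \<Longrightarrow> t < f M - b M \<or> f M + b M < t"
        by (auto simp: not_le)
      define A where "A = (\<Union>M\<in>{M\<in>?H. f M + b M < t}. M \<inter> S)"
      define B where "B = (\<Union>M\<in>{M\<in>?H. t < f M - b M}. M \<inter> S)"
      have "closed A" "closed B"
        unfolding A_def B_def using finite_mesh S(2)
        by (intro closed_UN; simp add: closed_meets)+
      moreover have "S \<subseteq> A \<union> B"
      proof
        fix x assume "x \<in> S"
        then obtain M where "M \<in> T" "x \<in> M" using S(3) by blast
        then have "M \<in> ?H" using \<open>x \<in> S\<close> by blast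
        then show "x \<in> A \<union> B"
          using t(3)[of M] \<open>x \<in> M\<close> \<open>x \<in> S\<close> unfolding A_def B_def by blast
      qed
      moreover have "A \<inter> S \<noteq> {}"
      proof -
        have "f K + b K < t" using KL t(1) t(3)[of K] b[of K] by auto
        then have "K \<inter> S \<subseteq> A" unfolding A_def using KL by blast
        then show ?thesis using KL by blast
      qed
      moreover have "B \<inter> S \<noteq> {}"
      proof -
        have "t < f L - b L" using KL t(2) t(3)[of L] b[of L] by auto
        then have "L \<inter> S \<subseteq> B" unfolding B_def using KL by blast
        then show ?thesis using KL by blast
      qed
      \<comment> \<open>By connectedness the two closed pieces share a point of \<open>S\<close>. It
        lies in two elements whose intervals are on different sides of the gap; these are distinct,
        hence share a facet, against \<open>adj\<close>.\<close>
      ultimately have "A \<inter> B \<inter> S \<noteq> {}"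
        using S(1) unfolding connected_closed by blast
      then obtain M1 M2 z where M: "M1 \<in> ?H" "f M1 + b M1 < t" "M2 \<in> ?H" "t < f M2 - b M2"
        "z \<in> M1" "z \<in> M2" "z \<in> S"
        unfolding A_def B_def by blast
      then have "M1 \<noteq> M2" using b[of M1] by auto
      then have "facet_adjacent M1 M2"
        using M S(4) by (intro facet_adjacentI[of M1 M2 z]) auto
      then show False using adj[of M1 M2] M by auto
    qed
    \<comment> \<open>Comparing lengths: each interval of the cover has length
      \<open>2 * b M\<close>.\<close>
    then have "measure lborel {f K..f L} \<le> measure lborel (\<Union>M\<in>?H. {f M - b M..f M + b M})"
      using finH by (intro measure_mono_fmeasurable) (auto intro!: fmeasurable.finite_UN fmeasurable_compact)
    also have "\<dots> \<le> (\<Sum>M\<in>?H. measure lborel {f M - b M..f M + b M})"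
      using finH by (intro measure_UNION_le) auto
    also have "\<dots> = (\<Sum>M\<in>?H. 2 * b M)"
      using b by (intro sum.cong) auto
    finally show ?thesis using less by (simp add: sum_distrib_left)
  qed
  show ?thesis
    using main[OF KL] main[OF KL(3,4,1,2)] ge by linarith
qed

definition hits :: "'a \<Rightarrow> 'a \<Rightarrow> 'a set set" where
  "hits x v = {K \<in> T. K \<inter> closed_segment x (x + v) \<noteq> {}}"

lemma finite_hits: "finite (hits x v)"
  using finite_mesh by (simp add: hits_def)

lemma hits_iff: "K \<in> hits x v \<longleftrightarrow> K \<in> T \<and> (\<exists>s. 0 \<le> s \<and> s \<le> 1 \<and> x + s *\<^sub>R v \<in> K)"
proof -
  have "(\<exists>y. y \<in> K \<and> y \<in> closed_segment x (x + v)) \<longleftrightarrow> (\<exists>s. 0 \<le> s \<and> s \<le> 1 \<and> x + s *\<^sub>R v \<in> K)"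
    unfolding in_segment by (auto simp: algebra_simps)
  then show ?thesis unfolding hits_def by blast
qed

text \<open>A bound for the total volume of the covering balls of radius \<open>2 * h\<close> of a
  segment of length \<open>l\<close>, divided by h to the power d - 1.\<close>

definition cover_const :: "real \<Rightarrow> real" where
  "cover_const l = (l + 3 * h) * unit_ball_vol (real DIM('a)) * 2 ^ DIM('a)"

lemma cover_const_pos: "l \<ge> 0 \<Longrightarrow> cover_const l > 0"
  unfolding cover_const_def using h_pos by (intro mult_pos_pos) auto

text \<open>The elements hit stay within distance \<open>h\<close> of the segment, hence in a tube
  of volume of order h to the power d - 1; packing leaves room for order 1/h of them.\<close>

lemma card_hits:
  assumes "norm v \<le> l"
  shows "h * card (hits x v) * \<theta> \<le> cover_const l"
proof -
  obtain I a where I: "finite (I::nat set)" "h * card I \<le> norm v + 3 * h"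
    and cov: "\<And>y s. \<lbrakk>0 \<le> s; s \<le> 1; dist y (x + s *\<^sub>R v) \<le> h\<rbrakk> \<Longrightarrow> y \<in> (\<Union>i\<in>I. cball (a i) (2 * h))"
    using segment_nbhd_cover[OF h_pos, of v x] by metis
  have "card (hits x v) * (\<theta> * h ^ DIM('a)) \<le> card I * (unit_ball_vol (real DIM('a)) * (2 * h) ^ DIM('a))"
  proof (rule card_elements_in_balls)
    show "K \<subseteq> (\<Union>i\<in>I. cball (a i) (2 * h))" if "K \<in> hits x v" for K
      using that cov dist_le unfolding hits_iff by blast
  qed (use I h_pos in \<open>auto simp: hits_def\<close>)
  then have "(card (hits x v) * \<theta>) * h ^ DIM('a) \<le> (card I * (unit_ball_vol (real DIM('a)) * 2 ^ DIM('a))) * h ^ DIM('a)"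
    by (simp add: power_mult_distrib mult_ac)
  then have "card (hits x v) * \<theta> \<le> card I * (unit_ball_vol (real DIM('a)) * 2 ^ DIM('a))"
    using h_pos by simp
  then have "h * (card (hits x v) * \<theta>) \<le> h * (card I * (unit_ball_vol (real DIM('a)) * 2 ^ DIM('a)))"
    using h_pos by simp
  also have "\<dots> = (h * card I) * (unit_ball_vol (real DIM('a)) * 2 ^ DIM('a))"
    by simp
  also have "\<dots> \<le> (l + 3 * h) * (unit_ball_vol (real DIM('a)) * 2 ^ DIM('a))"
    using I(2) assms by (intro mult_right_mono) auto
  finally show ?thesis by (simp add: cover_const_def mult_ac)
qed

lemma compact_hit_set:
  assumes "K \<in> T"
  shows "compact {z. K \<in> hits z v}"
proof -
  have "{z. K \<in> hits z v} = (\<lambda>(k, s). k - s *\<^sub>R v) ` (K \<times> {0..1})"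
    using assms by (force simp: hits_iff image_iff algebra_simps)
  moreover have "compact ((\<lambda>(k, s). k - s *\<^sub>R v) ` (K \<times> {0..1}))"
    unfolding case_prod_beta
    by (intro compact_continuous_image continuous_intros compact_Times compact_element assms) simp
  ultimately show ?thesis by simp
qed

text \<open>The starting points whose segment meets \<open>K\<close> form \<open>K\<close> swept
  backwards along \<open>v\<close>, which lies again in a tube of width \<open>h\<close> around a
  segment.\<close>

lemma measure_hit_set:
  assumes "K \<in> T" "norm v \<le> l"
  shows "h * measure lborel {z. K \<in> hits z v} \<le> cover_const l * h ^ DIM('a)"
proof -
  obtain k where k: "k \<in> K"
    using interior_element_nonempty[OF assms(1)] interior_subset by blast
  obtain I a where I: "finite (I::nat set)" "h * card I \<le> norm (-v) + 3 * h"
    and cov: "\<And>y s. \<lbrakk>0 \<le> s; s \<le> 1; dist y (k + s *\<^sub>R (-v)) \<le> h\<rbrakk> \<Longrightarrow> y \<in> (\<Union>i\<in>I. cball (a i) (2 * h))"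
    using segment_nbhd_cover[OF h_pos, of "-v" k] by metis
  have "{z. K \<in> hits z v} \<subseteq> (\<Union>i\<in>I. cball (a i) (2 * h))"
  proof
    fix z assume "z \<in> {z. K \<in> hits z v}"
    then obtain s where s: "0 \<le> s" "s \<le> 1" "z + s *\<^sub>R v \<in> K" unfolding hits_iff by blast
    then have "dist (z + s *\<^sub>R v) k \<le> h" using dist_le[OF assms(1)] k by blast
    then have "dist z (k + s *\<^sub>R (-v)) \<le> h" by (simp add: dist_norm algebra_simps)
    then show "z \<in> (\<Union>i\<in>I. cball (a i) (2 * h))" using cov s by blast
  qed
  then have "measure lborel {z. K \<in> hits z v} \<le> measure lborel (\<Union>i\<in>I. cball (a i) (2 * h))"
    using compact_hit_set[OF assms(1)] I(1)
    by (intro measure_mono_fmeasurable) (auto intro!: fmeasurable.finite_UN intro: fmeasurable_compact borel_compact)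
  also have "\<dots> \<le> (\<Sum>i\<in>I. measure lborel (cball (a i) (2 * h)))"
    using I(1) by (intro measure_UNION_le) auto
  also have "\<dots> = card I * (unit_ball_vol (real DIM('a)) * (2 * h) ^ DIM('a))"
    using h_pos by (simp add: content_cball)
  finally have "h * measure lborel {z. K \<in> hits z v} \<le> (h * card I) * (unit_ball_vol (real DIM('a)) * (2 * h) ^ DIM('a))"
    using h_pos by (simp add: mult_ac)
  also have "\<dots> \<le> (l + 3 * h) * (unit_ball_vol (real DIM('a)) * (2 * h) ^ DIM('a))"
    using I(2) assms h_pos by (intro mult_right_mono) auto
  finally show ?thesis
    by (simp add: cover_const_def power_mult_distrib mult_ac)
qed

end

subsection \<open>Translation estimates\<close>

lemma AE_lborel_not_in:
  fixes N :: "'a::euclidean_space set"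
  assumes "negligible N"
  shows "AE x in lborel. x \<notin> N"
proof -
  have "AE x in lebesgue. x \<notin> N"
    using assms by (intro AE_not_in) (simp add: negligible_iff_null_sets)
  then show ?thesis by (simp add: AE_completion_iff)
qed

lemma negligible_UN_finite:
  assumes "finite I" "\<And>i. i \<in> I \<Longrightarrow> negligible (A i)"
  shows "negligible (\<Union>i\<in>I. A i)"
  using assms by (auto intro: negligible_Union)

lemma sum_power2_le_card:
  fixes g :: "'b \<Rightarrow> real"
  shows "(\<Sum>i\<in>I. g i)\<^sup>2 \<le> card I * (\<Sum>i\<in>I. (g i)\<^sup>2)"
  using sum_squared_le_sum_of_squares[of g I] by (cases "finite I") (auto simp: mult.commute)

section \<open>Exceptional translations and directions\<close>

context uniform_mesh
begin

lemma finite_low_faces: "finite {F. \<exists>K\<in>T. F face_of K \<and> aff_dim F + 2 \<le> int DIM('a)}"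
proof -
  have "finite (\<Union>K\<in>T. {F. F face_of K})"
    using finite_mesh polytope_element finite_polytope_faces by (intro finite_UN_I) auto
  then show ?thesis by (rule rev_finite_subset) auto
qed

lemma negligible_parallel_bad:
  "negligible {r. closed_segment (y + r) (y + r + v) \<inter> codim2_skeleton T \<noteq> {}}"
proof -
  let ?F = "{F. \<exists>K\<in>T. F face_of K \<and> aff_dim F + 2 \<le> int DIM('a)}"
  have "negligible (\<Union>F\<in>?F. (+) (-y) ` {x + t *\<^sub>R v | x t. x \<in> F})"
    by (intro negligible_UN_finite finite_low_faces negligible_translation negligible_line_sweep) blast
  moreover have "{r. closed_segment (y + r) (y + r + v) \<inter> codim2_skeleton T \<noteq> {}} \<subseteq>
      (\<Union>F\<in>?F. (+) (-y) ` {x + t *\<^sub>R v | x t. x \<in> F})"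
  proof
    fix r assume "r \<in> {r. closed_segment (y + r) (y + r + v) \<inter> codim2_skeleton T \<noteq> {}}"
    then obtain z where "z \<in> closed_segment (y + r) (y + r + v)" "z \<in> codim2_skeleton T" by blast
    then obtain s F where s: "z = (1 - s) *\<^sub>R (y + r) + s *\<^sub>R (y + r + v)" and F: "F \<in> ?F" "z \<in> F"
      unfolding in_segment codim2_skeleton_def by blast
    have "r = - y + (z + (- s) *\<^sub>R v)"
      by (simp add: s algebra_simps)
    then have "r \<in> (+) (-y) ` {x + t *\<^sub>R v | x t. x \<in> F}"
      using F(2) by blast
    with F show "r \<in> (\<Union>F\<in>?F. (+) (-y) ` {x + t *\<^sub>R v | x t. x \<in> F})"
      by blast
  qed
  ultimately show ?thesis by (rule negligible_subset)
qed

text \<open>The start is fixed and the end moves: for a bad \<open>r\<close> the vector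
  \<open>v + r\<close> lies on the cone from \<open>x\<close> over a low-dimensional face.\<close>

lemma negligible_cone_bad:
  assumes "x \<notin> codim2_skeleton T"
  shows "negligible {r. closed_segment x (x + (v + r)) \<inter> codim2_skeleton T \<noteq> {}}"
proof -
  let ?F = "{F. \<exists>K\<in>T. F face_of K \<and> aff_dim F + 2 \<le> int DIM('a)}"
  have "negligible (\<Union>F\<in>?F. (+) (-v) ` {t *\<^sub>R (z - x) | z t. z \<in> F})"
    by (intro negligible_UN_finite finite_low_faces negligible_translation negligible_cone) blast
  moreover have "{r. closed_segment x (x + (v + r)) \<inter> codim2_skeleton T \<noteq> {}} \<subseteq>
      (\<Union>F\<in>?F. (+) (-v) ` {t *\<^sub>R (z - x) | z t. z \<in> F})"
  proof
    fix r assume "r \<in> {r. closed_segment x (x + (v + r)) \<inter> codim2_skeleton T \<noteq> {}}"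
    then obtain z where z: "z \<in> closed_segment x (x + (v + r))" "z \<in> codim2_skeleton T" by blast
    then obtain s F where s: "z = (1 - s) *\<^sub>R x + s *\<^sub>R (x + (v + r))" and F: "F \<in> ?F" "z \<in> F"
      unfolding in_segment codim2_skeleton_def by blast
    have eq: "z - x = s *\<^sub>R (v + r)" by (simp add: s algebra_simps)
    \<comment> \<open>At \<open>s = 0\<close> the point would be \<open>x\<close> itself, which is
      off the skeleton.\<close>
    have "s \<noteq> 0" using eq z(2) assms by auto
    then have "r = - v + (1 / s) *\<^sub>R (z - x)"
      by (simp add: eq)
    then have "r \<in> (+) (-v) ` {t *\<^sub>R (z - x) | z t. z \<in> F}"
      using F(2) by blast
    with F show "r \<in> (\<Union>F\<in>?F. (+) (-v) ` {t *\<^sub>R (z - x) | z t. z \<in> F})"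
      by blast
  qed
  ultimately show ?thesis by (rule negligible_subset)
qed

lemma negligible_frontier_bad: "negligible {r. y + r \<in> (\<Union>K\<in>T. frontier K)}"
proof -
  have "negligible ((+) (-y) ` (\<Union>K\<in>T. frontier K))"
    using finite_mesh convex_element
    by (intro negligible_translation negligible_UN_finite negligible_convex_frontier) auto
  then show ?thesis
  proof (rule negligible_subset, intro subsetI)
    fix r assume "r \<in> {r. y + r \<in> (\<Union>K\<in>T. frontier K)}"
    then have "-y + (y + r) \<in> (+) (-y) ` (\<Union>K\<in>T. frontier K)" by (intro imageI) simp
    then show "r \<in> (+) (-y) ` (\<Union>K\<in>T. frontier K)" by simp
  qed
qed

lemma in_interior_element:
  assumes "z \<in> \<Union>T" "z \<notin> (\<Union>K\<in>T. frontier K)"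
  obtains K where "K \<in> T" "z \<in> interior K" "z \<in> K"
  using assms closed_element by (auto simp: frontier_def)

end

text \<open>Summing over open elements gives a Borel function without choosing an owner for shared
  points; points in no open element get the value 0.\<close>

definition pw_const :: "'a::euclidean_space set set \<Rightarrow> ('a set \<Rightarrow> real) \<Rightarrow> 'a \<Rightarrow> real" where
  "pw_const T f z = (\<Sum>K\<in>T. f K * indicator (interior K) z)"

text \<open>An abstract discrete function: \<open>f K\<close> is a value attained on the element \<open>K\<close>, and \<open>b K\<close> bounds the
  oscillation on \<open>K\<close>; the two are compared across common facets only.\<close>

locale mesh_function = uniform_mesh T h \<theta> for T :: "'a::euclidean_space set set" and h \<theta> +
  fixes f b :: "'a set \<Rightarrow> real"
  assumes adjacent: "\<lbrakk>K \<in> T; L \<in> T; facet_adjacent K L\<rbrakk> \<Longrightarrow> \<bar>f K - f L\<bar> \<le> b K + b L"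
    and b_nonneg: "K \<in> T \<Longrightarrow> b K \<ge> 0"
begin

lemma pw_const_interior:
  assumes "K \<in> T" "z \<in> interior K"
  shows "pw_const T f z = f K"
proof -
  have "f L * indicator (interior L) z = (if L = K then f K else 0)" if "L \<in> T" for L
    using disjoint_interiors[OF that assms(1)] assms(2) by (auto simp: indicator_def)
  then have "pw_const T f z = (\<Sum>L\<in>T. if L = K then f K else 0)"
    unfolding pw_const_def by (intro sum.cong) auto
  then show ?thesis
    using finite_mesh assms(1) by simp
qed

lemma pw_const_measurable [measurable]: "pw_const T f \<in> borel_measurable borel"
  unfolding pw_const_def by measurable

lemma pw_const_bounded: "\<bar>pw_const T f z\<bar> \<le> (\<Sum>K\<in>T. \<bar>f K\<bar>)"
  unfolding pw_const_def by (rule order_trans[OF sum_abs]) (auto intro!: sum_mono simp: indicator_def)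

text \<open>In the application \<open>b K\<close> is \<open>h\<close> times the gradient norm on
  \<open>K\<close>, so that this is at most h to the power 2 - d, divided by
  \<open>\<theta>\<close>, times the squared broken seminorm.\<close>

definition energy :: real where
  "energy = (\<Sum>K\<in>T. (b K)\<^sup>2)"

lemma energy_nonneg: "energy \<ge> 0"
  unfolding energy_def by (intro sum_nonneg) auto

text \<open>Cauchy-Schwarz on the sum over the elements hit costs their number, of order 1/h; the
  factor \<open>h\<close> on the left absorbs it.\<close>

lemma segment_difference:
  assumes "closed_segment x (x + v) \<subseteq> \<Union>T" "closed_segment x (x + v) \<inter> codim2_skeleton T = {}"
    and K: "K \<in> T" "x \<in> K" "L \<in> T" "x + v \<in> L"
    and v: "norm v \<le> l"
  shows "h * \<theta> * (f K - f L)\<^sup>2 \<le> 4 * cover_const l * (\<Sum>M\<in>hits x v. (b M)\<^sup>2)"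
proof -
  have "\<bar>f K - f L\<bar> \<le> 2 * (\<Sum>M | M \<in> T \<and> M \<inter> closed_segment x (x + v) \<noteq> {}. b M)"
    using assms by (intro connected_oscillation adjacent b_nonneg) auto
  then have "\<bar>f K - f L\<bar> \<le> 2 * (\<Sum>M\<in>hits x v. b M)"
    unfolding hits_def by simp
  then have "(f K - f L)\<^sup>2 \<le> (2 * (\<Sum>M\<in>hits x v. b M))\<^sup>2"
    by (metis abs_ge_zero power2_abs power_mono)
  also have "\<dots> \<le> 4 * (card (hits x v) * (\<Sum>M\<in>hits x v. (b M)\<^sup>2))"
    using sum_power2_le_card[of b "hits x v"] by (simp add: power_mult_distrib)
  finally have "(h * \<theta>) * (f K - f L)\<^sup>2 \<le> (h * \<theta>) * (4 * (card (hits x v) * (\<Sum>M\<in>hits x v. (b M)\<^sup>2)))"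
    using h_pos \<theta>_pos by (intro mult_left_mono) auto
  also have "\<dots> = (h * card (hits x v) * \<theta>) * (4 * (\<Sum>M\<in>hits x v. (b M)\<^sup>2))"
    by simp
  also have "\<dots> \<le> cover_const l * (4 * (\<Sum>M\<in>hits x v. (b M)\<^sup>2))"
    using card_hits[OF v] by (intro mult_right_mono) (auto intro!: sum_nonneg)
  finally show ?thesis by simp
qed

lemma integrable_pw_const_diff:
  "set_integrable lborel (ball 0 \<rho>) (\<lambda>r. (pw_const T f (y + r) - pw_const T f (y' + r))\<^sup>2)"
  unfolding set_integrable_def
proof (rule integrableI_bounded_set_indicator)
  let ?M = "\<Sum>K\<in>T. \<bar>f K\<bar>"
  show "ball 0 \<rho> \<in> sets lborel" "emeasure lborel (ball (0::'a) \<rho>) < \<infinity>"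
    using emeasure_lborel_ball_finite[of "0::'a" \<rho>] by (auto simp: infinity_ennreal_def)
  show "AE r in lborel. r \<in> ball 0 \<rho> \<longrightarrow> norm ((pw_const T f (y + r) - pw_const T f (y' + r))\<^sup>2) \<le> (2 * ?M)\<^sup>2"
  proof (intro AE_I2 impI)
    fix r
    have "\<bar>pw_const T f (y + r) - pw_const T f (y' + r)\<bar> \<le> 2 * ?M"
      using pw_const_bounded[of "y + r"] pw_const_bounded[of "y' + r"] by linarith
    then show "norm ((pw_const T f (y + r) - pw_const T f (y' + r))\<^sup>2) \<le> (2 * ?M)\<^sup>2"
      by (metis abs_ge_zero norm_power power_mono real_norm_def)
  qed
qed measurable

text \<open>A squared pseudo-distance between \<open>y\<close> and \<open>y'\<close>. Averaging over
  \<open>r\<close> lets almost every segment avoid the skeleton, and it gains the factor h to the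
  power d - 1 in \<open>shift_diff_le\<close>.\<close>

definition shift_diff :: "real \<Rightarrow> 'a \<Rightarrow> 'a \<Rightarrow> real" where
  "shift_diff \<rho> y y' = (LINT r:ball 0 \<rho>|lborel. (pw_const T f (y + r) - pw_const T f (y' + r))\<^sup>2)"

lemma shift_diff_mono:
  assumes "\<rho> \<le> \<rho>'"
  shows "shift_diff \<rho> y y' \<le> shift_diff \<rho>' y y'"
  unfolding shift_diff_def set_lebesgue_integral_def
  using assms integrable_pw_const_diff[unfolded set_integrable_def]
  by (intro integral_mono) (auto simp: indicator_def)

lemma shift_diff_sym: "shift_diff \<rho> y y' = shift_diff \<rho> y' y"
  unfolding shift_diff_def by (simp add: power2_commute)

lemma shift_diff_triangle: "shift_diff \<rho> y y'' \<le> 2 * shift_diff \<rho> y y' + 2 * shift_diff \<rho> y' y''"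
proof -
  let ?m = "pw_const T f"
  have "shift_diff \<rho> y y'' \<le> (LINT r:ball 0 \<rho>|lborel. 2 * (?m (y + r) - ?m (y' + r))\<^sup>2 + 2 * (?m (y' + r) - ?m (y'' + r))\<^sup>2)"
    unfolding shift_diff_def
  proof (rule set_integral_mono)
    show "set_integrable lborel (ball 0 \<rho>) (\<lambda>r. 2 * (?m (y + r) - ?m (y' + r))\<^sup>2 + 2 * (?m (y' + r) - ?m (y'' + r))\<^sup>2)"
      using integrable_pw_const_diff by (intro set_integral_add set_integrable_mult_right) auto
    show "(?m (y + r) - ?m (y'' + r))\<^sup>2 \<le> 2 * (?m (y + r) - ?m (y' + r))\<^sup>2 + 2 * (?m (y' + r) - ?m (y'' + r))\<^sup>2" for r
      using zero_le_power2[of "(?m (y + r) - ?m (y' + r)) - (?m (y' + r) - ?m (y'' + r))"]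
      by (simp add: power2_eq_square algebra_simps)
  qed (rule integrable_pw_const_diff)
  also have "\<dots> = 2 * shift_diff \<rho> y y' + 2 * shift_diff \<rho> y' y''"
    unfolding shift_diff_def using integrable_pw_const_diff
    by (subst set_integral_add(2)) auto
  finally show ?thesis .
qed

text \<open>For almost every \<open>r\<close> the difference is bounded by the energy on the
  elements hit from \<open>y + r\<close>. Integration in \<open>r\<close> weights each element with
  the measure of its hit set, of order h to the power d - 1; the second factor \<open>h\<close> on
  the left turns this into \<open>h ^ d\<close>.\<close>

lemma shift_diff_le:
  assumes seg: "\<And>r. r \<in> ball 0 \<rho> \<Longrightarrow> closed_segment (y + r) (y' + r) \<subseteq> \<Union>T"
    and l: "dist y y' \<le> l"
  shows "h\<^sup>2 * \<theta> * shift_diff \<rho> y y' \<le> 4 * (cover_const l)\<^sup>2 * h ^ DIM('a) * energy"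
proof -
  let ?m = "pw_const T f"
  let ?v = "y' - y"
  let ?H = "\<lambda>K. {z. K \<in> hits z ?v}"
  define c where "c = 4 * cover_const l"
  have l0: "l \<ge> 0" using l zero_le_dist order_trans by blast
  have c0: "c \<ge> 0" using cover_const_pos[OF l0] by (simp add: c_def)
  have lv: "norm ?v \<le> l" using l by (simp add: dist_norm norm_minus_commute)
  have compactH: "compact ((+) (-y) ` ?H K)" if "K \<in> T" for K
    using that by (intro compact_translation compact_hit_set)
  have fmH: "(+) (-y) ` ?H K \<in> fmeasurable lborel" if "K \<in> T" for K
    using compactH[OF that] by (rule fmeasurable_compact)
  have AE: "AE r in lborel. r \<in> ball 0 \<rho> \<longrightarrow>
      h * \<theta> * (?m (y + r) - ?m (y' + r))\<^sup>2 \<le> c * (\<Sum>K\<in>T. (b K)\<^sup>2 * indicator ((+) (-y) ` ?H K) r)"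
  proof -
    \<comment> \<open>Excluded are segments through the skeleton, and end points on the frontier of
      an element, where \<open>pw_const\<close> need not be a sample.\<close>
    let ?bad = "{r. closed_segment (y + r) (y + r + ?v) \<inter> codim2_skeleton T \<noteq> {}}
      \<union> {r. y + r \<in> (\<Union>K\<in>T. frontier K)} \<union> {r. y' + r \<in> (\<Union>K\<in>T. frontier K)}"
    have "negligible ?bad"
      by (intro negligible_Un negligible_parallel_bad negligible_frontier_bad)
    then have "AE r in lborel. r \<notin> ?bad"
      by (rule AE_lborel_not_in)
    then show ?thesis
    proof (rule AE_mp, intro AE_I2 impI)
      fix r assume r: "r \<notin> ?bad" "r \<in> ball 0 \<rho>"
      have sub: "closed_segment (y + r) (y + r + ?v) \<subseteq> \<Union>T"
        using seg[OF r(2)] by (simp add: algebra_simps)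
      have "y + r \<in> \<Union>T" "y' + r \<in> \<Union>T"
        using seg[OF r(2)] ends_in_segment by blast+
      then obtain K L where K: "K \<in> T" "y + r \<in> interior K" "y + r \<in> K"
        and L: "L \<in> T" "y' + r \<in> interior L" "y' + r \<in> L"
        using in_interior_element r(1) by (metis (no_types, lifting) UnCI mem_Collect_eq)
      have "h * \<theta> * (f K - f L)\<^sup>2 \<le> 4 * cover_const l * (\<Sum>M\<in>hits (y + r) ?v. (b M)\<^sup>2)"
        using sub r(1) K L lv by (intro segment_difference) (auto simp: algebra_simps)
      \<comment> \<open>The dependence on \<open>r\<close> moves from the index set into indicators
        of compact sets, so that the sum can be integrated term by term.\<close>
      also have "(\<Sum>M\<in>hits (y + r) ?v. (b M)\<^sup>2) = (\<Sum>K\<in>T. (b K)\<^sup>2 * indicator ((+) (-y) ` ?H K) r)"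
      proof (rule sum.mono_neutral_cong_left)
        show "finite T" by (rule finite_mesh)
        show "hits (y + r) ?v \<subseteq> T" by (auto simp: hits_def)
        have iff: "r \<in> (+) (-y) ` ?H M \<longleftrightarrow> M \<in> hits (y + r) ?v" for M
          by (force simp: image_iff intro: exI[of _ "y + r"])
        show "\<forall>i\<in>T - hits (y + r) ?v. (b i)\<^sup>2 * indicator ((+) (-y) ` ?H i) r = 0"
          using iff by (auto simp: indicator_def)
        show "(b x)\<^sup>2 = (b x)\<^sup>2 * indicator ((+) (-y) ` ?H x) r" if "x \<in> hits (y + r) ?v" for x
          using iff that by (auto simp: indicator_def)
      qed
      finally show "h * \<theta> * (?m (y + r) - ?m (y' + r))\<^sup>2 \<le> c * (\<Sum>K\<in>T. (b K)\<^sup>2 * indicator ((+) (-y) ` ?H K) r)"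
        using pw_const_interior K L by (simp add: c_def)
    qed
  qed
  have int: "integrable lborel (\<lambda>r. c * (\<Sum>K\<in>T. (b K)\<^sup>2 * indicator ((+) (-y) ` ?H K) r))"
    using fmH by (intro integrable_mult_right integrable_sum) (auto simp: fmeasurable_def)
  have "h * \<theta> * shift_diff \<rho> y y' = (LINT r:ball 0 \<rho>|lborel. h * \<theta> * (?m (y + r) - ?m (y' + r))\<^sup>2)"
    unfolding shift_diff_def by simp
  also have "\<dots> \<le> (LINT r|lborel. c * (\<Sum>K\<in>T. (b K)\<^sup>2 * indicator ((+) (-y) ` ?H K) r))"
    unfolding set_lebesgue_integral_def
  proof (rule integral_mono_AE[OF _ int])
    show "integrable lborel (\<lambda>r. indicat_real (ball 0 \<rho>) r *\<^sub>R (h * \<theta> * (?m (y + r) - ?m (y' + r))\<^sup>2))"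
      using integrable_pw_const_diff[of \<rho> y y'] unfolding set_integrable_def[symmetric] by auto
    show "AE r in lborel. indicat_real (ball 0 \<rho>) r *\<^sub>R (h * \<theta> * (?m (y + r) - ?m (y' + r))\<^sup>2) \<le>
        c * (\<Sum>K\<in>T. (b K)\<^sup>2 * indicator ((+) (-y) ` ?H K) r)"
      using AE
    proof (rule AE_mp, intro AE_I2 impI)
      fix r assume "r \<in> ball 0 \<rho> \<longrightarrow> h * \<theta> * (?m (y + r) - ?m (y' + r))\<^sup>2 \<le> c * (\<Sum>K\<in>T. (b K)\<^sup>2 * indicator ((+) (-y) ` ?H K) r)"
      moreover have "0 \<le> c * (\<Sum>K\<in>T. (b K)\<^sup>2 * indicator ((+) (-y) ` ?H K) r)"
        using c0 by (intro mult_nonneg_nonneg sum_nonneg) auto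
      ultimately show "indicat_real (ball 0 \<rho>) r *\<^sub>R (h * \<theta> * (?m (y + r) - ?m (y' + r))\<^sup>2) \<le>
          c * (\<Sum>K\<in>T. (b K)\<^sup>2 * indicator ((+) (-y) ` ?H K) r)"
        by (cases "r \<in> ball 0 \<rho>") auto
    qed
  qed
  also have "\<dots> = c * (\<Sum>K\<in>T. (b K)\<^sup>2 * measure lborel ((+) (-y) ` ?H K))"
    using fmH by (subst integral_mult_right_zero, subst Bochner_Integration.integral_sum)
      (auto simp: fmeasurable_def)
  also have "\<dots> = c * (\<Sum>K\<in>T. (b K)\<^sup>2 * measure lborel (?H K))"
  proof -
    have "measure lborel ((+) (-y) ` ?H K) = measure lborel (?H K)" if "K \<in> T" for K
    proof -
      have "measure lebesgue ((+) (-y) ` ?H K) = measure lebesgue (?H K)"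
        by (rule measure_translation)
      then show ?thesis
        using compactH[OF that] compact_hit_set[OF that]
        by (simp add: measure_completion borel_compact)
    qed
    then show ?thesis by simp
  qed
  finally have "h * (h * \<theta> * shift_diff \<rho> y y') \<le> h * (c * (\<Sum>K\<in>T. (b K)\<^sup>2 * measure lborel (?H K)))"
    using h_pos by simp
  also have "\<dots> = c * (\<Sum>K\<in>T. (b K)\<^sup>2 * (h * measure lborel (?H K)))"
    by (simp add: sum_distrib_left mult_ac)
  also have "\<dots> \<le> c * (\<Sum>K\<in>T. (b K)\<^sup>2 * (cover_const l * h ^ DIM('a)))"
    using c0 measure_hit_set[OF _ lv] by (intro mult_left_mono sum_mono) auto
  also have "\<dots> = 4 * (cover_const l)\<^sup>2 * h ^ DIM('a) * energy"
    by (simp add: c_def energy_def power2_eq_square[of "cover_const l"] mult_ac flip: sum_distrib_right sum_distrib_left)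
  finally show ?thesis by (simp add: power2_eq_square mult_ac)
qed

end

subsection \<open>Transversal families of segments\<close>

lemma set_integral_sum:
  fixes g :: "'i \<Rightarrow> 'a \<Rightarrow> 'b::{banach, second_countable_topology}"
  assumes "finite I" "\<And>i. i \<in> I \<Longrightarrow> set_integrable M A (g i)"
  shows "set_integrable M A (\<lambda>x. \<Sum>i\<in>I. g i x)"
    and "(LINT x:A|M. \<Sum>i\<in>I. g i x) = (\<Sum>i\<in>I. LINT x:A|M. g i x)"
  using assms unfolding set_integrable_def set_lebesgue_integral_def
  by (simp_all only: scaleR_sum_right Bochner_Integration.integrable_sum Bochner_Integration.integral_sum)

context uniform_mesh
begin

text \<open>All elements of the family lie within distance of order \<open>h\<close> from each other, since the direction
  \<open>w\<close> is transversal to the hyperplane that contains the points \<open>x e\<close>.\<close>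

lemma card_transversal_hits:
  assumes "finite E" and q: "\<And>K. K \<in> T \<Longrightarrow> card {e \<in> E. k e = K} \<le> q"
    and E: "\<And>e. e \<in> E \<Longrightarrow> k e \<in> T \<and> x e \<in> k e \<and> n \<bullet> x e = c"
    and n: "norm n = 1" and \<delta>: "0 < \<delta>" "\<delta> \<le> \<bar>n \<bullet> w\<bar>" and w: "norm w \<le> l" and "K \<in> T"
  shows "\<theta> * card {e \<in> E. K \<in> hits (x e) w} \<le> q * (unit_ball_vol (real DIM('a)) * (2 + l / \<delta>) ^ DIM('a))"
proof (cases "{e \<in> E. K \<in> hits (x e) w} = {}")
  case True
  have "0 \<le> l" using w norm_ge_zero order_trans by blast
  moreover have "card {e \<in> E. K \<in> hits (x e) w} = 0" using True by (simp only: card.empty)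
  ultimately show ?thesis using \<delta> by simp
next
  case False
  let ?E = "{e \<in> E. K \<in> hits (x e) w}"
  obtain e0 where "e0 \<in> E" "K \<in> hits (x e0) w" using False by blast
  then obtain s0 where e0: "e0 \<in> E" "x e0 + s0 *\<^sub>R w \<in> K" unfolding hits_iff by blast
  have l: "0 \<le> l" using w norm_ge_zero order_trans by blast
  have near: "dist (x e0) (x e) \<le> h + h / \<delta> * l" if "e \<in> ?E" for e
  proof -
    obtain s where s: "x e + s *\<^sub>R w \<in> K" using \<open>e \<in> ?E\<close> by (auto simp: hits_iff)
    have d: "norm ((x e0 - x e) + (s0 - s) *\<^sub>R w) \<le> h"
      using dist_le[OF \<open>K \<in> T\<close> e0(2) s] by (simp add: dist_norm algebra_simps)
    \<comment> \<open>\<open>n\<close> annihilates \<open>x e0 - x e\<close>, both points lying on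
      one hyperplane, so the parameters at which the two segments meet \<open>K\<close> differ by at
      most \<open>h / \<delta>\<close>.\<close>
    have "n \<bullet> ((x e0 - x e) + (s0 - s) *\<^sub>R w) = (s0 - s) * (n \<bullet> w)"
      using E e0(1) that by (simp add: inner_add_right inner_diff_right)
    then have "\<bar>s0 - s\<bar> * \<bar>n \<bullet> w\<bar> \<le> h"
      using Cauchy_Schwarz_ineq2[of n "(x e0 - x e) + (s0 - s) *\<^sub>R w"] d n by (simp add: abs_mult)
    moreover have "\<bar>s0 - s\<bar> * \<delta> \<le> \<bar>s0 - s\<bar> * \<bar>n \<bullet> w\<bar>"
      using \<delta> by (intro mult_left_mono) auto
    ultimately have "\<bar>s0 - s\<bar> \<le> h / \<delta>"
      using \<delta> by (simp add: field_simps)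
    then have "norm ((s0 - s) *\<^sub>R w) \<le> h / \<delta> * l"
      unfolding norm_scaleR using w h_pos \<delta> by (intro mult_mono) auto
    then show ?thesis
      using d norm_triangle_ineq4[of "(x e0 - x e) + (s0 - s) *\<^sub>R w" "(s0 - s) *\<^sub>R w"] by (simp add: dist_norm)
  qed
  \<comment> \<open>The radius: \<open>near\<close> places \<open>x e\<close> within
    \<open>(1 + l / \<delta>) * h\<close> of \<open>x e0\<close>, and its element reaches at most
    \<open>h\<close> further.\<close>
  have "card (k ` ?E) * (\<theta> * h ^ DIM('a)) \<le>
      card {()} * (unit_ball_vol (real DIM('a)) * ((2 + l / \<delta>) * h) ^ DIM('a))"
  proof (rule card_elements_in_balls[where a = "\<lambda>_. x e0"])
    fix M assume "M \<in> k ` ?E"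
    then obtain e where e: "e \<in> ?E" "M = k e" by blast
    have "dist (x e0) z \<le> (2 + l / \<delta>) * h" if "z \<in> M" for z
    proof -
      have "dist (x e) z \<le> h" using E[of e] e that by (intro dist_le[of M]) auto
      then show ?thesis
        using near[OF e(1)] dist_triangle[of "x e0" z "x e"] by (simp add: algebra_simps)
    qed
    then show "M \<subseteq> (\<Union>i\<in>{()}. cball (x e0) ((2 + l / \<delta>) * h))" by auto
  qed (use E l \<delta> h_pos in auto)
  then have "(card (k ` ?E) * \<theta>) * h ^ DIM('a) \<le> (unit_ball_vol (real DIM('a)) * (2 + l / \<delta>) ^ DIM('a)) * h ^ DIM('a)"
    by (simp add: power_mult_distrib mult_ac)
  then have k: "card (k ` ?E) * \<theta> \<le> unit_ball_vol (real DIM('a)) * (2 + l / \<delta>) ^ DIM('a)"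
    using h_pos by simp
  have fin: "finite ?E" using \<open>finite E\<close> by simp
  \<comment> \<open>\<open>k\<close> is at most \<open>q\<close> to one, so the starting points are
    counted through their elements.\<close>
  have "card ?E = (\<Sum>K\<in>k ` ?E. card {e \<in> ?E. k e = K})"
    using sum.image_gen[OF fin, of "\<lambda>_. 1::nat" k] by (simp only: card_eq_sum)
  also have "\<dots> \<le> (\<Sum>K\<in>k ` ?E. q)"
  proof (rule sum_mono)
    fix M assume "M \<in> k ` ?E"
    then have "M \<in> T" using E by auto
    have "card {e \<in> ?E. k e = M} \<le> card {e \<in> E. k e = M}"
      using \<open>finite E\<close> by (intro card_mono) auto
    then show "card {e \<in> ?E. k e = M} \<le> q" using q[OF \<open>M \<in> T\<close>] by linarith
  qed
  finally have "card ?E \<le> q * card (k ` ?E)"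
    by (simp add: mult.commute)
  then have "real (card ?E) \<le> real (q * card (k ` ?E))"
    by (simp only: of_nat_le_iff)
  then have "real (card ?E) \<le> real q * real (card (k ` ?E))"
    by (simp only: of_nat_mult)
  then have "\<theta> * card ?E \<le> \<theta> * (q * card (k ` ?E))"
    using \<theta>_pos by simp
  also have "\<dots> = q * (card (k ` ?E) * \<theta>)" by simp
  also have "\<dots> \<le> q * (unit_ball_vol (real DIM('a)) * (2 + l / \<delta>) ^ DIM('a))"
    using k by (intro mult_left_mono) auto
  finally show ?thesis .
qed

text \<open>Double counting turns the overlap bound for one element into a bound by the sum over the
  mesh, without a factor \<open>card E\<close>.\<close>

lemma sum_hits_swap:
  assumes "finite E" "\<And>K. K \<in> T \<Longrightarrow> g K \<ge> 0"
    "\<And>K. K \<in> T \<Longrightarrow> card {e \<in> E. K \<in> hits (x e) w} \<le> (z::real)"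
  shows "(\<Sum>e\<in>E. \<Sum>K\<in>hits (x e) w. g K) \<le> z * (\<Sum>K\<in>T. g K)"
proof -
  have "(\<Sum>e\<in>E. \<Sum>K\<in>hits (x e) w. g K) = (\<Sum>e\<in>E. \<Sum>K | K \<in> T \<and> K \<in> hits (x e) w. g K)"
    by (intro sum.cong) (auto simp: hits_def)
  also have "\<dots> = (\<Sum>K\<in>T. \<Sum>e | e \<in> E \<and> K \<in> hits (x e) w. g K)"
    using assms(1) finite_mesh by (intro sum.swap_restrict) auto
  also have "\<dots> = (\<Sum>K\<in>T. card {e \<in> E. K \<in> hits (x e) w} * g K)"
    by simp
  also have "\<dots> \<le> (\<Sum>K\<in>T. z * g K)"
    using assms(2,3) by (intro sum_mono mult_right_mono) auto
  finally show ?thesis by (simp add: sum_distrib_left)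
qed

text \<open>This is the oscillation bound for the linear function given by \<open>n\<close>, sampled once per element.\<close>

lemma card_hits_ge:
  assumes seg: "closed_segment x (x + w) \<subseteq> \<Union>T" "closed_segment x (x + w) \<inter> codim2_skeleton T = {}"
    and n: "norm n = 1" "\<delta> \<le> \<bar>n \<bullet> w\<bar>"
  shows "\<delta> \<le> 4 * h * card (hits x w)"
proof -
  have "\<exists>p. p \<in> K" if "K \<in> T" for K
    using interior_element_nonempty[OF that] interior_subset by blast
  then obtain p where p: "\<And>K. K \<in> T \<Longrightarrow> p K \<in> K" by metis
  have bound: "\<bar>n \<bullet> y - n \<bullet> z\<bar> \<le> h" if "K \<in> T" "y \<in> K" "z \<in> K" for K y z
    using Cauchy_Schwarz_ineq2[of n "y - z"] dist_le[OF that] n by (simp add: inner_diff_right dist_norm)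
  have "x \<in> \<Union>T" "x + w \<in> \<Union>T"
    using seg(1) ends_in_segment[of x "x + w"] by (auto simp only: subset_iff)
  then obtain K L where K: "K \<in> T" "x \<in> K" and L: "L \<in> T" "x + w \<in> L"
    by blast
  have "\<bar>n \<bullet> p K - n \<bullet> p L\<bar> \<le> 2 * (\<Sum>M | M \<in> T \<and> M \<inter> closed_segment x (x + w) \<noteq> {}. h)"
  proof (rule connected_oscillation)
    fix M N assume MN: "M \<in> T" "N \<in> T" "facet_adjacent M N"
    then obtain e where e: "e facet_of M" "e facet_of N"
      unfolding facet_adjacent_def by blast
    then have "e \<noteq> {}" by (simp add: facet_of_def)
    then obtain z where z: "z \<in> M" "z \<in> N"
      using facet_of_imp_subset[OF e(1)] facet_of_imp_subset[OF e(2)] by blast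
    show "\<bar>n \<bullet> p M - n \<bullet> p N\<bar> \<le> h + h"
      using bound[OF MN(1) p[OF MN(1)] z(1)] bound[OF MN(2) p[OF MN(2)] z(2)] by linarith
  next
    show "K \<inter> closed_segment x (x + w) \<noteq> {}" "L \<inter> closed_segment x (x + w) \<noteq> {}"
      using K(2) L(2) ends_in_segment[of x "x + w"] by blast+
  qed (use h_pos in \<open>simp_all add: seg K L\<close>)
  then have osc: "\<bar>n \<bullet> p K - n \<bullet> p L\<bar> \<le> 2 * (h * card (hits x w))"
    by (simp add: hits_def mult.commute)
  define X where "X = h * card (hits x w)"
  have "K \<inter> closed_segment x (x + w) \<noteq> {}"
    using K(2) ends_in_segment(1)[of x "x + w"] by blast
  then have "K \<in> hits x w" by (simp add: hits_def K(1))
  then have "card (hits x w) \<noteq> 0"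
    using finite_hits[of x w] by (metis card_eq_0_iff empty_iff)
  \<comment> \<open>At least one element is hit, so the errors of size \<open>h\<close> at the two
    ends are absorbed; this raises the constant from 2 to 4.\<close>
  then have "h * 1 \<le> X"
    unfolding X_def using h_pos by (intro mult_left_mono) linarith+
  moreover have "n \<bullet> w = n \<bullet> (x + w) - n \<bullet> x"
    by (simp add: inner_add_right)
  then have "\<delta> \<le> h + h + 2 * X"
    using osc[folded X_def] bound[OF K(1) p[OF K(1)] K(2)] bound[OF L(1) p[OF L(1)] L(2)] n(2) by linarith
  ultimately have "\<delta> \<le> 4 * X" by linarith
  then show ?thesis by (simp add: X_def mult.assoc)
qed

lemma card_mesh:
  assumes "\<Union>T \<subseteq> cball a D" "D \<ge> 0"
  shows "card T * (\<theta> * h ^ DIM('a)) \<le> unit_ball_vol (real DIM('a)) * D ^ DIM('a)"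
  using card_elements_in_balls[of T "{()}" D "\<lambda>_. a"] assms by auto

end

context mesh_function
begin

lemma integrable_const_diff:
  "set_integrable lborel (ball 0 \<rho>) (\<lambda>r. (a - pw_const T f (y + r))\<^sup>2)"
  unfolding set_integrable_def
proof (rule integrableI_bounded_set_indicator)
  let ?M = "\<Sum>K\<in>T. \<bar>f K\<bar>"
  show "ball 0 \<rho> \<in> sets lborel" "emeasure lborel (ball (0::'a) \<rho>) < \<infinity>"
    using emeasure_lborel_ball_finite[of "0::'a" \<rho>] by (auto simp: infinity_ennreal_def)
  show "AE r in lborel. r \<in> ball 0 \<rho> \<longrightarrow> norm ((a - pw_const T f (y + r))\<^sup>2) \<le> (\<bar>a\<bar> + ?M)\<^sup>2"
  proof (intro AE_I2 impI)
    fix r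
    have "\<bar>a - pw_const T f (y + r)\<bar> \<le> \<bar>a\<bar> + ?M"
      using pw_const_bounded[of "y + r"] by linarith
    then show "norm ((a - pw_const T f (y + r))\<^sup>2) \<le> (\<bar>a\<bar> + ?M)\<^sup>2"
      by (metis abs_ge_zero norm_power power_mono real_norm_def)
  qed
qed measurable

end

text \<open>One class of segments: starting points on a common hyperplane, a common translation
  \<open>v\<close> and a common small perturbation \<open>r\<close>. Later \<open>E\<close> consists
  of boundary faces, \<open>k e\<close> is the element at the face \<open>e\<close>, and
  \<open>q\<close> bounds the number of facets of an element.\<close>

locale transversal_family = uniform_mesh T h \<theta> for T :: "'a::euclidean_space set set" and h \<theta> +
  fixes E :: "'b set" and k :: "'b \<Rightarrow> 'a set" and x :: "'b \<Rightarrow> 'a" and q :: nat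
    and n v :: 'a and c \<rho> \<delta> l :: real
  assumes finite_E: "finite E"
    and fibre: "K \<in> T \<Longrightarrow> card {e \<in> E. k e = K} \<le> q"
    and k_in: "e \<in> E \<Longrightarrow> k e \<in> T" and x_in: "e \<in> E \<Longrightarrow> x e \<in> k e"
    and x_plane: "e \<in> E \<Longrightarrow> n \<bullet> x e = c"
    and x_generic: "e \<in> E \<Longrightarrow> x e \<notin> codim2_skeleton T"
    and n_unit: "norm n = 1" and \<rho>_pos: "\<rho> > 0" and \<delta>_pos: "\<delta> > 0"
    and transversal: "r \<in> ball 0 \<rho> \<Longrightarrow> \<delta> \<le> \<bar>n \<bullet> (v + r)\<bar>"
    and seg: "e \<in> E \<Longrightarrow> r \<in> ball 0 \<rho> \<Longrightarrow> closed_segment (x e) (x e + (v + r)) \<subseteq> \<Union>T"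
    and v_le: "norm v + \<rho> \<le> l"
begin

text \<open>The packing bound for elements in a ball of radius
  \<open>(2 + l / \<delta>) * h\<close>, times the multiplicity \<open>q\<close>; the powers of
  \<open>h\<close> have cancelled.\<close>

definition overlap :: real where
  "overlap = q * (unit_ball_vol (real DIM('a)) * (2 + l / \<delta>) ^ DIM('a)) / \<theta>"

lemma l_pos: "l > 0"
  using v_le \<rho>_pos norm_ge_zero[of v] by linarith

lemma overlap_nonneg: "overlap \<ge> 0"
  unfolding overlap_def using l_pos \<delta>_pos \<theta>_pos by simp

lemma card_overlap:
  assumes "r \<in> ball 0 \<rho>" "K \<in> T"
  shows "card {e \<in> E. K \<in> hits (x e) (v + r)} \<le> overlap"
proof -
  have "norm (v + r) \<le> l"
    using norm_triangle_ineq[of v r] v_le assms(1) by simp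
  then have "\<theta> * card {e \<in> E. K \<in> hits (x e) (v + r)} \<le>
      q * (unit_ball_vol (real DIM('a)) * (2 + l / \<delta>) ^ DIM('a))"
    using finite_E fibre k_in x_in x_plane n_unit \<delta>_pos transversal[OF assms(1)] assms(2)
    by (intro card_transversal_hits[where k = k and n = n and c = c]) auto
  then show ?thesis
    using \<theta>_pos by (simp add: overlap_def field_simps)
qed

lemma AE_generic:
  "AE r in lborel. \<forall>e\<in>E. closed_segment (x e) (x e + (v + r)) \<inter> codim2_skeleton T = {}
     \<and> x e + v + r \<notin> (\<Union>K\<in>T. frontier K)"
proof (rule AE_finite_allI[OF finite_E])
  fix e assume "e \<in> E"
  have "AE r in lborel. r \<notin> {r. closed_segment (x e) (x e + (v + r)) \<inter> codim2_skeleton T \<noteq> {}}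
      \<union> {r. x e + v + r \<in> (\<Union>K\<in>T. frontier K)}"
    using x_generic[OF \<open>e \<in> E\<close>]
    by (intro AE_lborel_not_in negligible_Un negligible_frontier_bad negligible_cone_bad)
  then show "AE r in lborel. closed_segment (x e) (x e + (v + r)) \<inter> codim2_skeleton T = {}
     \<and> x e + v + r \<notin> (\<Union>K\<in>T. frontier K)"
    by (rule AE_mp) (intro AE_I2, auto)
qed

text \<open>This bounds the number of boundary faces by order h to the power 1 - d without reference
  to the area of the boundary: each segment meets at least \<open>\<delta> / (4 * h)\<close>
  elements, each element serves at most \<open>overlap\<close> segments, and the mesh has at most
  order h to the power -d elements.\<close>

lemma card_family:
  assumes D: "\<Union>T \<subseteq> cball a D" "D \<ge> 0"
  shows "card E * h ^ DIM('a) \<le> h * (4 * overlap * (unit_ball_vol (real DIM('a)) * D ^ DIM('a)) / (\<delta> * \<theta>))"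
proof -
  \<comment> \<open>The exceptional \<open>r\<close> form a null set and cannot exhaust the ball, so
    one direction serves all members of \<open>E\<close>.\<close>
  have "\<exists>r\<in>ball 0 \<rho>. \<forall>e\<in>E. closed_segment (x e) (x e + (v + r)) \<inter> codim2_skeleton T = {}"
  proof (rule ccontr)
    assume no: "\<not> ?thesis"
    have "AE r in lborel. r \<notin> ball (0::'a) \<rho>"
      by (rule AE_mp[OF AE_generic]) (use no in \<open>intro AE_I2, blast\<close>)
    then have "ball (0::'a) \<rho> \<in> null_sets lborel"
      by (subst AE_iff_null_sets) auto
    then have "measure lborel (ball (0::'a) \<rho>) = 0"
      by (simp add: measure_def null_setsD1)
    then show False using \<rho>_pos by simp
  qed
  then obtain r where r: "r \<in> ball 0 \<rho>"
    and gen: "\<And>e. e \<in> E \<Longrightarrow> closed_segment (x e) (x e + (v + r)) \<inter> codim2_skeleton T = {}" by blast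
  have "card E * \<delta> \<le> (\<Sum>e\<in>E. 4 * h * card (hits (x e) (v + r)))"
    using seg r gen n_unit transversal by (intro sum_bounded_below card_hits_ge) auto
  also have "\<dots> = 4 * h * (\<Sum>e\<in>E. \<Sum>K\<in>hits (x e) (v + r). 1)"
    by (simp add: sum_distrib_left)
  also have "\<dots> \<le> 4 * h * (overlap * (\<Sum>K\<in>T. 1))"
    using h_pos finite_E card_overlap[OF r] by (intro mult_left_mono sum_hits_swap) auto
  also have "\<dots> = 4 * h * overlap * card T" by simp
  finally have "(card E * \<delta>) * (\<theta> * h ^ DIM('a)) \<le> (4 * h * overlap * card T) * (\<theta> * h ^ DIM('a))"
    using \<theta>_pos h_pos by (intro mult_right_mono) auto
  also have "\<dots> = 4 * h * overlap * (card T * (\<theta> * h ^ DIM('a)))"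
    by simp
  also have "\<dots> \<le> 4 * h * overlap * (unit_ball_vol (real DIM('a)) * D ^ DIM('a))"
    using card_mesh[OF D] h_pos overlap_nonneg by (intro mult_left_mono) auto
  finally show ?thesis
    using \<delta>_pos \<theta>_pos by (simp add: field_simps)
qed

end

locale transversal_family_function = transversal_family T h \<theta> E k x q n v c \<rho> \<delta> l + mesh_function T h \<theta> f b
  for T :: "'a::euclidean_space set set" and h \<theta> and E :: "'b set" and k x q n v c \<rho> \<delta> l f b
begin

text \<open>Because of the bounded overlap the sum over all of \<open>E\<close> has a bound of the
  same form as a single segment.\<close>

lemma sum_jump_le:
  "AE r in lborel. r \<in> ball 0 \<rho> \<longrightarrow>
     h * (\<Sum>e\<in>E. (f (k e) - pw_const T f (x e + v + r))\<^sup>2) \<le> 4 * cover_const l * overlap / \<theta> * energy"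
  using AE_generic
proof (rule AE_mp, intro AE_I2 impI)
  fix r
  assume gen: "\<forall>e\<in>E. closed_segment (x e) (x e + (v + r)) \<inter> codim2_skeleton T = {}
     \<and> x e + v + r \<notin> (\<Union>K\<in>T. frontier K)" and r: "r \<in> ball 0 \<rho>"
  have "norm (v + r) \<le> l"
    using norm_triangle_ineq[of v r] v_le r by simp
  have "h * \<theta> * (f (k e) - pw_const T f (x e + v + r))\<^sup>2 \<le> 4 * cover_const l * (\<Sum>M\<in>hits (x e) (v + r). (b M)\<^sup>2)"
    if "e \<in> E" for e
  proof -
    have "x e + v + r \<in> \<Union>T"
      using seg[OF that r] ends_in_segment(2)[of "x e + (v + r)" "x e"] by (auto simp: add.assoc)
    moreover have "x e + v + r \<notin> (\<Union>K\<in>T. frontier K)"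
      using gen that by blast
    ultimately obtain L where L: "L \<in> T" "x e + v + r \<in> interior L" "x e + v + r \<in> L"
      by (rule in_interior_element)
    have "h * \<theta> * (f (k e) - f L)\<^sup>2 \<le> 4 * cover_const l * (\<Sum>M\<in>hits (x e) (v + r). (b M)\<^sup>2)"
      using seg[OF that r] gen that k_in x_in L \<open>norm (v + r) \<le> l\<close>
      by (intro segment_difference) (auto simp: add.assoc)
    then show ?thesis using pw_const_interior[OF L(1,2)] by simp
  qed
  then have "(\<Sum>e\<in>E. h * \<theta> * (f (k e) - pw_const T f (x e + v + r))\<^sup>2) \<le>
      (\<Sum>e\<in>E. 4 * cover_const l * (\<Sum>M\<in>hits (x e) (v + r). (b M)\<^sup>2))"
    by (rule sum_mono)
  also have "\<dots> = 4 * cover_const l * (\<Sum>e\<in>E. \<Sum>M\<in>hits (x e) (v + r). (b M)\<^sup>2)"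
    by (simp add: sum_distrib_left)
  also have "\<dots> \<le> 4 * cover_const l * (overlap * energy)"
    unfolding energy_def using cover_const_pos[of l] l_pos finite_E card_overlap[OF r]
    by (intro mult_left_mono sum_hits_swap) auto
  finally have "\<theta> * (h * (\<Sum>e\<in>E. (f (k e) - pw_const T f (x e + v + r))\<^sup>2)) \<le> 4 * cover_const l * (overlap * energy)"
    by (simp add: sum_distrib_left mult_ac)
  then show "h * (\<Sum>e\<in>E. (f (k e) - pw_const T f (x e + v + r))\<^sup>2) \<le> 4 * cover_const l * overlap / \<theta> * energy"
    using \<theta>_pos by (simp add: field_simps)
qed

lemma integral_sum_jump_le:
  "h * (\<Sum>e\<in>E. LINT r:ball 0 \<rho>|lborel. (f (k e) - pw_const T f (x e + v + r))\<^sup>2)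
     \<le> 4 * cover_const l * overlap / \<theta> * measure lborel (ball (0::'a) \<rho>) * energy"
proof -
  let ?C = "4 * cover_const l * overlap / \<theta> * energy"
  have int: "set_integrable lborel (ball 0 \<rho>) (\<lambda>r. h * (\<Sum>e\<in>E. (f (k e) - pw_const T f (x e + v + r))\<^sup>2))"
    using finite_E integrable_const_diff by (intro set_integrable_mult_right set_integral_sum(1)) auto
  have intC: "set_integrable lborel (ball (0::'a) \<rho>) (\<lambda>r. ?C)"
    unfolding set_integrable_def using emeasure_lborel_ball_finite[of "0::'a" \<rho>]
    by (intro integrable_scaleR_left) (auto simp: infinity_ennreal_def)
  have "h * (\<Sum>e\<in>E. LINT r:ball 0 \<rho>|lborel. (f (k e) - pw_const T f (x e + v + r))\<^sup>2)
      = (LINT r:ball 0 \<rho>|lborel. h * (\<Sum>e\<in>E. (f (k e) - pw_const T f (x e + v + r))\<^sup>2))"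
    using finite_E integrable_const_diff by (simp add: set_integral_sum(2))
  also have "\<dots> \<le> (LINT r:ball (0::'a) \<rho>|lborel. ?C)"
    using int intC sum_jump_le by (intro set_integral_mono_AE) (auto simp: set_integrable_def)
  also have "\<dots> = ?C * measure lborel (ball (0::'a) \<rho>)"
    by (simp add: set_lebesgue_integral_def)
  finally show ?thesis by (simp add: mult_ac)
qed

end

subsection \<open>Polyhedral domains\<close>

lemma finite_uniform_bound:
  fixes g :: "'a \<Rightarrow> real"
  assumes "finite A" "\<And>a. a \<in> A \<Longrightarrow> g a > 0"
  obtains m where "m > 0" "\<And>a. a \<in> A \<Longrightarrow> m \<le> g a"
\<comment> \<open>The extra 1 covers the case that \<open>A\<close> is empty.\<close>
proof (rule that[of "Min (insert 1 (g ` A))"])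
  show "0 < Min (insert 1 (g ` A))" using assms by (subst Min_gr_iff) auto
  show "Min (insert 1 (g ` A)) \<le> g a" if "a \<in> A" for a
    using assms that by (intro Min_le) auto
qed

text \<open>Cells without interior may be dropped: their union is negligible, while the part of
  \<open>\<Omega>\<close> outside the remaining cells is open.\<close>

lemma polyhedral_domain_cells:
  assumes "polyhedral_domain \<Omega>"
  obtains P where "finite P" "\<And>p. p \<in> P \<Longrightarrow> polytope p \<and> interior p \<noteq> {} \<and> interior p \<subseteq> \<Omega>"
    "closure \<Omega> = \<Union>P"
proof -
  obtain P where P: "finite P" "\<And>p. p \<in> P \<Longrightarrow> polytope p" "\<Omega> = interior (\<Union>P)" and "open \<Omega>"
    using assms unfolding polyhedral_domain_def by auto
  define P' where "P' = {p \<in> P. interior p \<noteq> {}}"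
  have fin: "finite P'" using P(1) by (simp add: P'_def)
  have closed: "closed (\<Union>P')"
    using P(2) fin by (intro closed_Union) (auto simp: P'_def polytope_imp_closed)
  have int: "interior p \<subseteq> \<Omega>" if "p \<in> P" for p
    using that by (auto simp: P(3) intro: subsetD[OF interior_mono])
  have "negligible (\<Omega> - \<Union>P')"
  proof (rule negligible_subset)
    show "negligible (\<Union>(P - P'))"
      using P(1,2) by (intro negligible_Union) (auto simp: P'_def negligible_convex_interior polytope_imp_convex)
    show "\<Omega> - \<Union>P' \<subseteq> \<Union>(P - P')"
      unfolding P(3) using interior_subset by blast
  qed
  then have "\<Omega> \<subseteq> \<Union>P'"
    using open_not_negligible[of "\<Omega> - \<Union>P'"] closed \<open>open \<Omega>\<close> open_Diff by blast
  then have "closure \<Omega> \<subseteq> \<Union>P'" using closed by (rule closure_minimal)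
  moreover have "p \<subseteq> closure \<Omega>" if "p \<in> P'" for p
  proof -
    have "closure (interior p) = closure p"
      using that P(2) by (intro convex_closure_interior) (auto simp: P'_def polytope_imp_convex)
    then have "p \<subseteq> closure (interior p)" using closure_subset by auto
    also have "\<dots> \<subseteq> closure \<Omega>" using int that by (intro closure_mono) (auto simp: P'_def)
    finally show ?thesis .
  qed
  ultimately have "closure \<Omega> = \<Union>P'" by blast
  then show ?thesis
    using fin int P(2) by (intro that[of P']) (auto simp: P'_def)
qed

text \<open>This excludes slits. It is used to show that a face not contained in the frontier has an
  element on each side, and that a boundary face has only one.\<close>

lemma polyhedral_domain_interior_closure:
  assumes "polyhedral_domain \<Omega>"
  shows "interior (closure \<Omega>) = \<Omega>"
proof -
  obtain P where P: "finite P" "\<And>p. p \<in> P \<Longrightarrow> polytope p" "\<Omega> = interior (\<Union>P)" and "open \<Omega>"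
    using assms unfolding polyhedral_domain_def by auto
  have "closed (\<Union>P)" using P by (intro closed_Union) (auto simp: polytope_imp_closed)
  then have "closure \<Omega> \<subseteq> \<Union>P" unfolding P(3) by (intro closure_minimal interior_subset)
  then have "interior (closure \<Omega>) \<subseteq> \<Omega>" unfolding P(3) by (rule interior_mono)
  then show ?thesis using \<open>open \<Omega>\<close> by (simp add: interior_maximal closure_subset subset_antisym)
qed

lemma polytope_frontier_hyperplanes:
  fixes p :: "'a::euclidean_space set"
  assumes "polytope p" "interior p \<noteq> {}"
  obtains N :: "('a \<times> real) set" where "finite N" "\<And>n c. (n, c) \<in> N \<Longrightarrow> norm n = 1"
    "\<And>x. x \<in> frontier p \<Longrightarrow> \<exists>(n, c)\<in>N. n \<bullet> x = c"
proof -
  have poly: "polyhedron p" using assms(1) by (rule polytope_imp_polyhedron)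
  have "\<exists>n c. norm n = 1 \<and> (\<forall>x\<in>F. n \<bullet> x = c)" if F: "F facet_of p" for F
  proof -
    obtain a b where "a \<noteq> 0" "p \<subseteq> {x. a \<bullet> x \<le> b}" "F = p \<inter> {x. a \<bullet> x = b}"
      by (rule facet_of_polyhedron[OF poly F])
    then show ?thesis
      by (intro exI[of _ "a /\<^sub>R norm a"] exI[of _ "b / norm a"]) (auto simp: divide_inverse mult.commute)
  qed
  then obtain n c where nc: "\<And>F. F facet_of p \<Longrightarrow> norm (n F) = 1 \<and> (\<forall>x\<in>F. n F \<bullet> x = c F)"
    by metis
  let ?N = "(\<lambda>F. (n F, c F)) ` {F. F facet_of p}"
  have "finite ?N" using finite_polytope_facets[OF assms(1)] by simp
  moreover have "frontier p = \<Union>{F. F facet_of p}"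
    using rel_frontier_of_polyhedron[OF poly] rel_frontier_nonempty_interior[OF assms(2)] by simp
  ultimately show ?thesis using nc by (intro that[of ?N]) auto
qed

text \<open>Cell interiors lie in \<open>\<Omega>\<close>, so a frontier point of
  \<open>\<Omega>\<close> is a frontier point of any cell that contains it. \<open>N\<close> may
  contain hyperplanes through the inside of the domain as well.\<close>

lemma polyhedral_frontier_hyperplanes:
  assumes "polyhedral_domain \<Omega>"
  obtains N :: "((real^'n) \<times> real) set" where "finite N" "\<And>n c. (n, c) \<in> N \<Longrightarrow> norm n = 1"
    "\<And>x. x \<in> frontier \<Omega> \<Longrightarrow> \<exists>(n, c)\<in>N. n \<bullet> x = c"
proof -
  obtain P where P: "finite P" "\<And>p. p \<in> P \<Longrightarrow> polytope p \<and> interior p \<noteq> {} \<and> interior p \<subseteq> \<Omega>"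
    "closure \<Omega> = \<Union>P"
    using polyhedral_domain_cells[OF assms] by blast
  have "\<exists>N::((real^'n) \<times> real) set. finite N \<and> (\<forall>n c. (n, c) \<in> N \<longrightarrow> norm n = 1) \<and>
      (\<forall>x \<in> frontier p. \<exists>(n, c)\<in>N. n \<bullet> x = c)" if "p \<in> P" for p
    using polytope_frontier_hyperplanes[of p] P(2)[OF that] by metis
  then obtain N where N: "\<And>p. p \<in> P \<Longrightarrow> finite (N p)" "\<And>p n c. p \<in> P \<Longrightarrow> (n, c) \<in> N p \<Longrightarrow> norm (n::real^'n) = 1"
      "\<And>p x. p \<in> P \<Longrightarrow> x \<in> frontier p \<Longrightarrow> \<exists>(n, c)\<in>N p. n \<bullet> x = c"
    by metis
  have "\<exists>(n, c)\<in>(\<Union>p\<in>P. N p). n \<bullet> x = c" if x: "x \<in> frontier \<Omega>" for x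
  proof -
    have "x \<notin> \<Omega>" "x \<in> closure \<Omega>"
      using x assms by (auto simp: frontier_def polyhedral_domain_def interior_open)
    then obtain p where p: "p \<in> P" "x \<in> p" "x \<notin> interior p" using P by blast
    then have "x \<in> frontier p" using closure_subset by (auto simp: frontier_def)
    then show ?thesis using N(3)[OF p(1)] p(1) by blast
  qed
  then show ?thesis using that[of "\<Union>p\<in>P. N p"] N(1,2) P(1) by blast
qed

text \<open>Some vertex \<open>b\<close> has a barycentric weight of at least \<open>1 / card V\<close> at \<open>x\<close>, so \<open>x\<close> can be translated
  by a fixed fraction of \<open>y - b\<close> without leaving the polytope.\<close>

lemma polytope_translation:
  fixes p :: "'a::real_vector set" and t :: real
  assumes V: "finite V" "p = convex hull V" and x: "x \<in> p"
    and t: "0 < t" "t < 1" "t * card V \<le> 1"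
  obtains b where "b \<in> V" "\<And>y. y \<in> p \<Longrightarrow> x + t *\<^sub>R (y - b) \<in> p"
proof -
  obtain u where u: "\<And>i. i \<in> V \<Longrightarrow> 0 \<le> u i" "sum u V = 1" "(\<Sum>i\<in>V. u i *\<^sub>R i) = x"
    using x V by (auto simp: convex_hull_finite)
  have "\<exists>b\<in>V. t \<le> u b"
  proof (rule ccontr)
    assume "\<not> ?thesis"
    moreover have "V \<noteq> {}" using u(2) by auto
    ultimately have "sum u V < (\<Sum>i\<in>V. t)" using V(1) by (intro sum_strict_mono) auto
    then show False using u(2) t(3) by (simp add: mult.commute)
  qed
  then obtain b where b: "b \<in> V" "t \<le> u b" by blast
  \<comment> \<open>The weights of \<open>x\<close> with \<open>t\<close> removed at
    \<open>b\<close>, rescaled to sum 1. Thus \<open>x\<close> is a convex combination of a point of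
    \<open>p\<close> and \<open>b\<close>, in which \<open>b\<close> is then exchanged for
    \<open>y\<close>.\<close>
  define w where "w i = (if i = b then u i - t else u i) / (1 - t)" for i
  have sumb: "(\<Sum>i\<in>V. if i = b then t else 0) = t" "(\<Sum>i\<in>V. (if i = b then t else 0) *\<^sub>R i) = t *\<^sub>R b"
    using b(1) V(1) by (simp_all add: if_distrib[of "\<lambda>s. s *\<^sub>R _"] cong: if_cong)
  have w: "w i = (u i - (if i = b then t else 0)) / (1 - t)" for i
    by (simp add: w_def)
  have "(\<Sum>i\<in>V. w i) = 1"
    using t u(2) sumb(1) by (simp add: w sum_subtractf flip: sum_divide_distrib)
  moreover have "(\<Sum>i\<in>V. w i *\<^sub>R i) = (1 / (1 - t)) *\<^sub>R (x - t *\<^sub>R b)"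
  proof -
    have "(\<Sum>i\<in>V. w i *\<^sub>R i) = (\<Sum>i\<in>V. (1 / (1 - t)) *\<^sub>R (u i *\<^sub>R i - (if i = b then t else 0) *\<^sub>R i))"
      by (intro sum.cong) (auto simp: w scaleR_diff_left[symmetric])
    also have "\<dots> = (1 / (1 - t)) *\<^sub>R ((\<Sum>i\<in>V. u i *\<^sub>R i) - (\<Sum>i\<in>V. (if i = b then t else 0) *\<^sub>R i))"
      by (simp only: scaleR_sum_right[symmetric] sum_subtractf)
    finally show ?thesis using sumb u(3) by simp
  qed
  moreover have "0 \<le> w i" if "i \<in> V" for i
    using u(1)[OF that] b t by (auto simp: w_def)
  ultimately have q: "(1 / (1 - t)) *\<^sub>R (x - t *\<^sub>R b) \<in> p"
    unfolding V(2) convex_hull_finite[OF V(1)] by auto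
  have "convex p" using V by simp
  show ?thesis
  proof (rule that[OF b(1)])
    fix y assume "y \<in> p"
    then have "(1 - t) *\<^sub>R ((1 / (1 - t)) *\<^sub>R (x - t *\<^sub>R b)) + t *\<^sub>R y \<in> p"
      using \<open>convex p\<close> q t by (intro convexD) auto
    moreover have "(1 - t) *\<^sub>R ((1 / (1 - t)) *\<^sub>R (x - t *\<^sub>R b)) = x - t *\<^sub>R b"
      using t by simp
    ultimately have "x - t *\<^sub>R b + t *\<^sub>R y \<in> p" by simp
    then show "x + t *\<^sub>R (y - b) \<in> p"
      by (simp add: algebra_simps)
  qed
qed

text \<open>In a cell with vertex set \<open>V\<close>, an interior point \<open>y\<close> is chosen
  off the hyperplanes through the vertices parallel to those of \<open>N\<close>. The multiples
  \<open>t\<close> of \<open>y - b\<close>, with \<open>b\<close> in \<open>V\<close>, are finitely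
  many transversal vectors, and by \<open>polytope_translation\<close> each point of the cell admits
  one of them. As they come from the vertices of cells and not from a local graph of the boundary,
  non-Lipschitz boundaries are covered.\<close>

lemma polyhedral_transversals:
  fixes \<Omega> :: "(real^'n) set"
  assumes \<Omega>: "polyhedral_domain \<Omega>"
  obtains W :: "((real^'n) \<times> (real^'n)) set" and N :: "((real^'n) \<times> real) set" and \<rho> \<delta> where
    "finite W" "finite N" "\<rho> > 0" "\<delta> > 0"
    "\<And>n c. (n, c) \<in> N \<Longrightarrow> norm n = 1"
    "\<And>x. x \<in> frontier \<Omega> \<Longrightarrow> \<exists>(n, c)\<in>N. n \<bullet> x = c"
    "\<And>v y. (v, y) \<in> W \<Longrightarrow> y \<in> \<Omega>"
    "\<And>v y n c r. (v, y) \<in> W \<Longrightarrow> (n, c) \<in> N \<Longrightarrow> r \<in> ball 0 \<rho> \<Longrightarrow> \<delta> \<le> \<bar>n \<bullet> (v + r)\<bar>"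
    "\<And>x. x \<in> closure \<Omega> \<Longrightarrow> \<exists>(v, y)\<in>W. \<forall>r\<in>ball 0 \<rho>.
       closed_segment x (x + (v + r)) \<subseteq> closure \<Omega> \<and> closed_segment (x + v + r) (y + r) \<subseteq> closure \<Omega>"
proof -
  obtain P where P: "finite P" "\<And>p. p \<in> P \<Longrightarrow> polytope p \<and> interior p \<noteq> {} \<and> interior p \<subseteq> \<Omega>"
    "closure \<Omega> = \<Union>P"
    using polyhedral_domain_cells[OF \<Omega>] by blast
  obtain N :: "((real^'n) \<times> real) set" where N: "finite N" "\<And>n c. (n, c) \<in> N \<Longrightarrow> norm n = 1"
    "\<And>x. x \<in> frontier \<Omega> \<Longrightarrow> \<exists>(n, c)\<in>N. n \<bullet> x = c"
    using polyhedral_frontier_hyperplanes[OF \<Omega>] by blast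
  define good where "good p z \<longleftrightarrow> (case z of (V, y, s) \<Rightarrow> finite V \<and> p = convex hull V \<and> y \<in> \<Omega> \<and> s > 0 \<and>
      ball y s \<subseteq> p \<and> (\<forall>b\<in>V. \<forall>(n, c)\<in>N. n \<bullet> (y - b) \<noteq> 0))" for p :: "(real^'n) set" and z :: "(real^'n) set \<times> (real^'n) \<times> real"
  have "\<exists>z. good p z" if p: "p \<in> P" for p
  proof -
    obtain V where V: "finite V" "p = convex hull V" using P(2)[OF p] by (auto simp: polytope_def)
    have "negligible (\<Union>b\<in>V. \<Union>nc\<in>N. {y. fst nc \<bullet> y = fst nc \<bullet> b})"
      using N(2) by (intro negligible_UN_finite V N(1) negligible_hyperplane) fastforce
    then have "\<not> interior p \<subseteq> (\<Union>b\<in>V. \<Union>nc\<in>N. {y. fst nc \<bullet> y = fst nc \<bullet> b})"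
      using open_not_negligible[of "interior p"] P(2)[OF p] negligible_subset by blast
    then obtain y where y: "y \<in> interior p" "\<And>b nc. b \<in> V \<Longrightarrow> nc \<in> N \<Longrightarrow> fst nc \<bullet> y \<noteq> fst nc \<bullet> b"
      by blast
    obtain s where "s > 0" "ball y s \<subseteq> p" using y(1) by (auto simp: mem_interior)
    then show ?thesis
      using V y P(2)[OF p] by (intro exI[of _ "(V, y, s)"]) (auto simp: good_def inner_diff_right)
  qed
  then have "\<forall>p\<in>P. \<exists>z. good p z" by blast
  from bchoice[OF this] obtain z where z: "\<forall>p\<in>P. good p (z p)" by blast
  define V y s where "V p = fst (z p)" and "y p = fst (snd (z p))" and "s p = snd (snd (z p))" for p
  have Vys: "finite (V p) \<and> p = convex hull (V p) \<and> y p \<in> \<Omega> \<and> s p > 0 \<and>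
      ball (y p) (s p) \<subseteq> p \<and> (\<forall>b\<in>V p. \<forall>(n, c)\<in>N. n \<bullet> (y p - b) \<noteq> 0)" if "p \<in> P" for p
    using bspec[OF z that] by (simp add: good_def V_def y_def s_def case_prod_beta)
  \<comment> \<open>Half of \<open>1 / card (V p)\<close>, which is below 1 even for a single
    vertex.\<close>
  define t where "t p = 1 / (2 * real (card (V p)))" for p
  have cardV: "card (V p) > 0" if "p \<in> P" for p
  proof -
    have "V p \<noteq> {}"
    proof
      assume "V p = {}"
      then have "p = {}" using Vys[OF that] by simp
      then show False using P(2)[OF that] by simp
    qed
    then show ?thesis using Vys[OF that] by (simp add: card_gt_0_iff)
  qed
  have t: "0 < t p" "t p < 1" "t p * card (V p) \<le> 1" if "p \<in> P" for p
    using cardV[OF that] by (auto simp: t_def field_simps)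
  define W where "W = (\<Union>p\<in>P. (\<lambda>b. (t p *\<^sub>R (y p - b), y p)) ` V p)"
  have finW: "finite W" using P(1) Vys by (auto simp: W_def)
  have "finite (W \<times> N)" using finW N(1) by simp
  moreover have "0 < \<bar>fst (snd wn) \<bullet> fst (fst wn)\<bar>" if "wn \<in> W \<times> N" for wn
  proof -
    obtain p b n c where p: "p \<in> P" "b \<in> V p" "(n, c) \<in> N" "wn = ((t p *\<^sub>R (y p - b), y p), (n, c))"
      using \<open>wn \<in> W \<times> N\<close> by (auto simp: W_def)
    have "n \<bullet> (y p - b) \<noteq> 0" using Vys[OF p(1)] p(2,3) by blast
    then show ?thesis using p(4) t(1)[OF p(1)] by simp
  qed
  ultimately obtain \<delta> where \<delta>: "\<delta> > 0" "\<And>wn. wn \<in> W \<times> N \<Longrightarrow> \<delta> \<le> \<bar>fst (snd wn) \<bullet> fst (fst wn)\<bar>"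
    using finite_uniform_bound[of "W \<times> N" "\<lambda>wn. \<bar>fst (snd wn) \<bullet> fst (fst wn)\<bar>"] by blast
  obtain \<sigma> where \<sigma>: "\<sigma> > 0" "\<And>p. p \<in> P \<Longrightarrow> \<sigma> \<le> t p * s p"
  proof -
    have "0 < t p * s p" if "p \<in> P" for p
      using t(1)[OF that] Vys[OF that] by simp
    then show ?thesis
      using finite_uniform_bound[OF P(1), of "\<lambda>p. t p * s p"] that by blast
  qed
  \<comment> \<open>The first bound keeps \<open>y + r / t\<close> in the ball around
    \<open>y\<close>; the second lets \<open>r\<close> change \<open>n \<bullet> v\<close> by at
    most half of \<open>\<delta>\<close>.\<close>
  define \<rho> where "\<rho> = min \<sigma> (\<delta> / 2)"
  show ?thesis
  proof (rule that[OF finW N(1) _ _ N(2) N(3)])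
    show "\<rho> > 0" "\<delta> / 2 > 0" using \<sigma>(1) \<delta>(1) by (auto simp: \<rho>_def)
    show "yy \<in> \<Omega>" if "(v, yy) \<in> W" for v yy
      using that Vys by (auto simp: W_def)
    show "\<delta> / 2 \<le> \<bar>n \<bullet> (v + r)\<bar>" if "(v, yy) \<in> W" "(n, c) \<in> N" "r \<in> ball 0 \<rho>" for v yy n c r
    proof -
      have "\<delta> \<le> \<bar>n \<bullet> v\<bar>" using \<delta>(2)[of "((v, yy), (n, c))"] that by simp
      moreover have "\<bar>n \<bullet> r\<bar> \<le> \<delta> / 2"
        using Cauchy_Schwarz_ineq2[of n r] N(2)[OF that(2)] that(3) by (simp add: \<rho>_def)
      ultimately show ?thesis unfolding inner_add_right by linarith
    qed
    fix x assume "x \<in> closure \<Omega>"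
    then obtain p where p: "p \<in> P" "x \<in> p" using P(3) by blast
    obtain b where b: "b \<in> V p" "\<And>z. z \<in> p \<Longrightarrow> x + t p *\<^sub>R (z - b) \<in> p"
    proof (rule polytope_translation[of "V p" p x "t p"])
      show "finite (V p)" "p = convex hull (V p)" using Vys[OF p(1)] by blast+
    qed (use p(2) t[OF p(1)] that in \<open>blast+\<close>)
    have conv: "convex p" using P(2)[OF p(1)] polytope_imp_convex by blast
    have sub: "p \<subseteq> closure \<Omega>" using P(3) p(1) by blast
    have "closed_segment x (x + (t p *\<^sub>R (y p - b) + r)) \<subseteq> closure \<Omega> \<and>
        closed_segment (x + t p *\<^sub>R (y p - b) + r) (y p + r) \<subseteq> closure \<Omega>" if r: "r \<in> ball 0 \<rho>" for r
    proof -
      have nr: "norm r < t p * s p" using r \<sigma>(2)[OF p(1)] by (simp add: \<rho>_def)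
      also have "\<dots> \<le> 1 * s p" using t[OF p(1)] Vys[OF p(1)] by (intro mult_right_mono) auto
      finally have "y p + r \<in> ball (y p) (s p)" by (simp add: dist_norm)
      then have 1: "y p + r \<in> p" using Vys[OF p(1)] by blast
      \<comment> \<open>Translating by \<open>v + r\<close> means moving towards
        \<open>y + r / t\<close> in place of \<open>y\<close>.\<close>
      have "norm ((1 / t p) *\<^sub>R r) < s p"
        using nr t[OF p(1)] by (simp add: field_simps)
      then have "y p + (1 / t p) *\<^sub>R r \<in> ball (y p) (s p)" by (simp add: dist_norm)
      then have "y p + (1 / t p) *\<^sub>R r \<in> p" using Vys[OF p(1)] by blast
      from b(2)[OF this] have 2: "x + t p *\<^sub>R (y p - b) + r \<in> p"
        using t[OF p(1)] by (simp add: algebra_simps)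
      show ?thesis
        using closed_segment_subset[OF p(2) 2 conv] closed_segment_subset[OF 2 1 conv] sub
        by (simp only: add.assoc) blast
    qed
    moreover have "(t p *\<^sub>R (y p - b), y p) \<in> W" using p(1) b(1) by (auto simp: W_def)
    ultimately show "\<exists>(v, y)\<in>W. \<forall>r\<in>ball 0 \<rho>.
       closed_segment x (x + (v + r)) \<subseteq> closure \<Omega> \<and> closed_segment (x + v + r) (y + r) \<subseteq> closure \<Omega>"
      by (intro bexI[of _ "(t p *\<^sub>R (y p - b), y p)"]) auto
  qed auto
qed

subsection \<open>The discrete trace inequality\<close>

context mesh_function
begin

lemma cover_const_le:
  assumes "h \<le> D" "0 \<le> l"
  shows "cover_const l \<le> (l + 3 * D) * unit_ball_vol (real DIM('a)) * 2 ^ DIM('a)" "0 \<le> cover_const l"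
  using assms cover_const_pos[OF assms(2)]
  by (auto simp: cover_const_def intro!: mult_right_mono)

text \<open>\<open>cover_const\<close> contains \<open>h\<close>; replacing it there by the bound
  \<open>D\<close> makes the constant independent of the mesh.\<close>

lemma shift_diff_le_uniform:
  assumes seg: "\<And>r. r \<in> ball 0 \<rho> \<Longrightarrow> closed_segment (y + r) (y' + r) \<subseteq> \<Union>T"
    and "dist y y' \<le> l" "h \<le> D"
  shows "h\<^sup>2 * shift_diff \<rho> y y' \<le>
    4 * ((l + 3 * D) * unit_ball_vol (real DIM('a)) * 2 ^ DIM('a))\<^sup>2 / \<theta> * h ^ DIM('a) * energy"
proof -
  have "0 \<le> l" using assms(2) zero_le_dist order_trans by blast
  have "h\<^sup>2 * \<theta> * shift_diff \<rho> y y' \<le> 4 * (cover_const l)\<^sup>2 * h ^ DIM('a) * energy"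
    using assms by (intro shift_diff_le) auto
  also have "\<dots> \<le> 4 * ((l + 3 * D) * unit_ball_vol (real DIM('a)) * 2 ^ DIM('a))\<^sup>2 * h ^ DIM('a) * energy"
    using cover_const_le[OF assms(3) \<open>0 \<le> l\<close>] h_pos energy_nonneg
    by (intro mult_right_mono mult_left_mono power_mono) auto
  finally show ?thesis using \<theta>_pos by (simp add: field_simps)
qed

end

text \<open>Comparability of two points, with constants chosen before the mesh, is an equivalence
  relation on \<open>\<Omega>\<close>, and nearby points are comparable because a ball contains the
  segments. Connectedness leaves a single class, so \<open>\<rho>\<close> and \<open>C\<close> come
  without an explicit chain of balls.\<close>

lemma shift_diff_connected:
  fixes \<Omega> :: "'a::euclidean_space set"
  assumes "open \<Omega>" "connected \<Omega>" "y \<in> \<Omega>" "y' \<in> \<Omega>"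
  obtains \<rho> C where "\<rho> > 0" "C \<ge> 0"
    "\<And>T h f b. mesh_function T h \<theta> f b \<Longrightarrow> \<Union>T = closure \<Omega> \<Longrightarrow> h \<le> D \<Longrightarrow>
       h\<^sup>2 * mesh_function.shift_diff T f \<rho> y y' \<le> C * h ^ DIM('a) * mesh_function.energy T b"
proof -
  define R where "R y y' \<longleftrightarrow> (\<exists>\<rho>>0. \<exists>C\<ge>0. \<forall>T h f b. mesh_function T h \<theta> f b \<longrightarrow> \<Union>T = closure \<Omega> \<longrightarrow> h \<le> D \<longrightarrow>
       h\<^sup>2 * mesh_function.shift_diff T f \<rho> y y' \<le> C * h ^ DIM('a) * mesh_function.energy T b)" for y y'
  have RI: "R y y'" if "\<rho> > 0" "C \<ge> 0" "\<And>T h f b. mesh_function T h \<theta> f b \<Longrightarrow> \<Union>T = closure \<Omega> \<Longrightarrow> h \<le> D \<Longrightarrow>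
       h\<^sup>2 * mesh_function.shift_diff T f \<rho> y y' \<le> C * h ^ DIM('a) * mesh_function.energy T b" for \<rho> C y y'
    unfolding R_def using that by blast
  have "R y y'"
  proof (rule connected_equivalence_relation[OF assms(2-4)])
    fix x y assume "R x y"
    then show "R y x"
      unfolding R_def by (metis mesh_function.shift_diff_sym)
  next
    fix x y z assume "R x y" "R y z"
    then obtain \<rho>1 C1 \<rho>2 C2 where
      1: "\<rho>1 > 0" "C1 \<ge> 0" "\<And>T h f b. mesh_function T h \<theta> f b \<Longrightarrow> \<Union>T = closure \<Omega> \<Longrightarrow> h \<le> D \<Longrightarrow>
       h\<^sup>2 * mesh_function.shift_diff T f \<rho>1 x y \<le> C1 * h ^ DIM('a) * mesh_function.energy T b" and
      2: "\<rho>2 > 0" "C2 \<ge> 0" "\<And>T h f b. mesh_function T h \<theta> f b \<Longrightarrow> \<Union>T = closure \<Omega> \<Longrightarrow> h \<le> D \<Longrightarrow>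
       h\<^sup>2 * mesh_function.shift_diff T f \<rho>2 y z \<le> C2 * h ^ DIM('a) * mesh_function.energy T b"
      unfolding R_def by (elim exE conjE) blast
    show "R x z"
    proof (rule RI[of "min \<rho>1 \<rho>2" "2 * C1 + 2 * C2"])
      fix T h f b
      assume M: "mesh_function T h \<theta> f b" "\<Union>T = closure \<Omega>" "h \<le> D"
      interpret mesh_function T h \<theta> f b by fact
      have "shift_diff (min \<rho>1 \<rho>2) x z \<le> 2 * shift_diff (min \<rho>1 \<rho>2) x y + 2 * shift_diff (min \<rho>1 \<rho>2) y z"
        by (rule shift_diff_triangle)
      also have "\<dots> \<le> 2 * shift_diff \<rho>1 x y + 2 * shift_diff \<rho>2 y z"
        by (intro add_mono mult_left_mono shift_diff_mono) auto
      finally have "h\<^sup>2 * shift_diff (min \<rho>1 \<rho>2) x z \<le> h\<^sup>2 * (2 * shift_diff \<rho>1 x y + 2 * shift_diff \<rho>2 y z)"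
        by (intro mult_left_mono) auto
      also have "\<dots> = 2 * (h\<^sup>2 * shift_diff \<rho>1 x y) + 2 * (h\<^sup>2 * shift_diff \<rho>2 y z)"
        by (simp add: algebra_simps)
      also have "\<dots> \<le> 2 * (C1 * h ^ DIM('a) * energy) + 2 * (C2 * h ^ DIM('a) * energy)"
        using 1(3)[OF M] 2(3)[OF M] by linarith
      finally show "h\<^sup>2 * shift_diff (min \<rho>1 \<rho>2) x z \<le> (2 * C1 + 2 * C2) * h ^ DIM('a) * energy"
        by (simp add: algebra_simps)
    qed (use 1 2 in auto)
  next
    fix a assume "a \<in> \<Omega>"
    then obtain s where s: "s > 0" "ball a s \<subseteq> \<Omega>"
      using assms(1) open_contains_ball by blast
    show "\<exists>U. openin (top_of_set \<Omega>) U \<and> a \<in> U \<and> (\<forall>x\<in>U. R a x)"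
    proof (intro exI[of _ "ball a (s / 2)"] conjI ballI)
      have "ball a (s / 2) \<subseteq> \<Omega>" using s by (auto simp: subset_iff)
      then show "openin (top_of_set \<Omega>) (ball a (s / 2))"
        by (simp add: open_subset)
      show "a \<in> ball a (s / 2)" using s by simp
      fix x assume x: "x \<in> ball a (s / 2)"
      show "R a x"
      proof (rule RI[of "s / 2" "\<bar>4 * ((s + 3 * D) * unit_ball_vol (real DIM('a)) * 2 ^ DIM('a))\<^sup>2 / \<theta>\<bar>"])
        fix T h f b
        assume M: "mesh_function T h \<theta> f b" "\<Union>T = closure \<Omega>" "h \<le> D"
        interpret mesh_function T h \<theta> f b by fact
        have "closed_segment (a + r) (x + r) \<subseteq> \<Union>T" if r: "r \<in> ball 0 (s / 2)" for r
        proof -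
          have "norm (a - x) + norm r < s" using x r by (simp add: dist_norm)
          moreover have "dist a (x + r) \<le> norm (a - x) + norm r"
            unfolding dist_norm using norm_triangle_ineq4[of "a - x" r] by (simp add: algebra_simps)
          ultimately have "x + r \<in> ball a s" "a + r \<in> ball a s"
            using r s by (auto simp: dist_norm)
          then have "closed_segment (a + r) (x + r) \<subseteq> ball a s"
            by (simp add: closed_segment_subset)
          then show ?thesis using s(2) closure_subset M(2) by blast
        qed
        moreover have "dist a x \<le> s" using x s by simp
        ultimately have "h\<^sup>2 * shift_diff (s / 2) a x \<le>
            4 * ((s + 3 * D) * unit_ball_vol (real DIM('a)) * 2 ^ DIM('a))\<^sup>2 / \<theta> * h ^ DIM('a) * energy"
          using M(3) by (rule shift_diff_le_uniform)
        also have "\<dots> \<le> \<bar>4 * ((s + 3 * D) * unit_ball_vol (real DIM('a)) * 2 ^ DIM('a))\<^sup>2 / \<theta>\<bar> * h ^ DIM('a) * energy"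
          using h_pos energy_nonneg by (intro mult_right_mono abs_ge_self) auto
        finally show "h\<^sup>2 * shift_diff (s / 2) a x \<le>
            \<bar>4 * ((s + 3 * D) * unit_ball_vol (real DIM('a)) * 2 ^ DIM('a))\<^sup>2 / \<theta>\<bar> * h ^ DIM('a) * energy" .
      qed (use s in auto)
    qed
  qed
  then show ?thesis
    unfolding R_def using that by blast
qed

context transversal_family_function
begin

text \<open>The way from the face to \<open>y1 + r\<close> is split at \<open>x e + v + r\<close>
  and \<open>y0 + r\<close>. The first difference is summed with bounded overlap. The other two are
  bounded for each face separately, and \<open>card E\<close>, of order h to the power 1 - d, is
  paid for by the gain from averaging.\<close>

lemma family_bound:
  assumes "\<And>e. e \<in> E \<Longrightarrow> h\<^sup>2 * shift_diff \<rho> (x e + v) y0 \<le> S * h ^ DIM('a) * energy"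
    and "h\<^sup>2 * shift_diff \<rho> y0 y1 \<le> S * h ^ DIM('a) * energy"
    and Q: "card E * h ^ DIM('a) \<le> h * Q" and "S \<ge> 0"
  shows "h * (\<Sum>e\<in>E. LINT r:ball 0 \<rho>|lborel. (f (k e) - pw_const T f (y1 + r))\<^sup>2)
    \<le> (12 * cover_const l * overlap / \<theta> * measure lborel (ball (0::'a) \<rho>) + 6 * S * Q) * energy"
proof -
  let ?m = "pw_const T f"
  let ?I = "\<lambda>e. LINT r:ball 0 \<rho>|lborel. (f (k e) - ?m (x e + v + r))\<^sup>2"
  have each: "(LINT r:ball 0 \<rho>|lborel. (f (k e) - ?m (y1 + r))\<^sup>2)
      \<le> 3 * ?I e + 3 * shift_diff \<rho> (x e + v) y0 + 3 * shift_diff \<rho> y0 y1" for e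
  proof -
    have "(LINT r:ball 0 \<rho>|lborel. (f (k e) - ?m (y1 + r))\<^sup>2) \<le>
        (LINT r:ball 0 \<rho>|lborel. (3 * (f (k e) - ?m (x e + v + r))\<^sup>2 + 3 * (?m (x e + v + r) - ?m (y0 + r))\<^sup>2)
           + 3 * (?m (y0 + r) - ?m (y1 + r))\<^sup>2)"
    proof (rule set_integral_mono)
      show "(f (k e) - ?m (y1 + r))\<^sup>2 \<le> 3 * (f (k e) - ?m (x e + v + r))\<^sup>2 + 3 * (?m (x e + v + r) - ?m (y0 + r))\<^sup>2
           + 3 * (?m (y0 + r) - ?m (y1 + r))\<^sup>2" for r
      proof -
        have "(a + b + c)\<^sup>2 \<le> 3 * a\<^sup>2 + 3 * b\<^sup>2 + 3 * c\<^sup>2" for a b c :: real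
          using zero_le_power2[of "a - b"] zero_le_power2[of "b - c"] zero_le_power2[of "a - c"]
          by (simp add: power2_eq_square algebra_simps)
        from this[of "f (k e) - ?m (x e + v + r)" "?m (x e + v + r) - ?m (y0 + r)" "?m (y0 + r) - ?m (y1 + r)"]
        show ?thesis by simp
      qed
    qed (intro integrable_const_diff integrable_pw_const_diff set_integral_add(1) set_integrable_mult_right impI)+
    also have "\<dots> = 3 * ?I e + 3 * shift_diff \<rho> (x e + v) y0 + 3 * shift_diff \<rho> y0 y1"
      unfolding shift_diff_def
      by (subst set_integral_add(2), (intro integrable_const_diff integrable_pw_const_diff set_integral_add(1) set_integrable_mult_right impI)+)+ simp
    finally show ?thesis .
  qed
  have "h * (h * (\<Sum>e\<in>E. LINT r:ball 0 \<rho>|lborel. (f (k e) - ?m (y1 + r))\<^sup>2)) \<le>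
      h * (h * (\<Sum>e\<in>E. 3 * ?I e + 3 * shift_diff \<rho> (x e + v) y0 + 3 * shift_diff \<rho> y0 y1))"
    using h_pos each by (intro mult_left_mono sum_mono) auto
  also have "\<dots> = 3 * h * (h * (\<Sum>e\<in>E. ?I e)) + 3 * (\<Sum>e\<in>E. h\<^sup>2 * shift_diff \<rho> (x e + v) y0 + h\<^sup>2 * shift_diff \<rho> y0 y1)"
    by (simp add: sum.distrib sum_distrib_left power2_eq_square algebra_simps)
  also have "\<dots> \<le> 3 * h * (4 * cover_const l * overlap / \<theta> * measure lborel (ball (0::'a) \<rho>) * energy)
      + 3 * (\<Sum>e\<in>E. S * h ^ DIM('a) * energy + S * h ^ DIM('a) * energy)"
    using integral_sum_jump_le h_pos assms(1,2) by (intro add_mono mult_left_mono sum_mono) auto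
  also have "3 * (\<Sum>e\<in>E. S * h ^ DIM('a) * energy + S * h ^ DIM('a) * energy) = 6 * S * energy * (card E * h ^ DIM('a))"
    by simp
  also have "\<dots> \<le> 6 * S * energy * (h * Q)"
    using Q energy_nonneg \<open>S \<ge> 0\<close> by (intro mult_left_mono) auto
  finally have "h * (h * (\<Sum>e\<in>E. LINT r:ball 0 \<rho>|lborel. (f (k e) - ?m (y1 + r))\<^sup>2)) \<le>
      h * ((12 * cover_const l * overlap / \<theta> * measure lborel (ball (0::'a) \<rho>) + 6 * S * Q) * energy)"
    by (simp add: algebra_simps)
  then show ?thesis using h_pos by simp
qed

end

text \<open>Otherwise \<open>g\<close> would exceed \<open>M\<close> divided by the volume at every
  point of the ball. This turns an average over \<open>r\<close> into a single constant.\<close>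

lemma exists_le_average:
  fixes g :: "'a::euclidean_space \<Rightarrow> real"
  assumes int: "set_integrable lborel (ball 0 \<rho>) g" and le: "(LINT r:ball 0 \<rho>|lborel. g r) \<le> M" and "\<rho> > 0"
  obtains r where "r \<in> ball 0 \<rho>" "g r * measure lborel (ball (0::'a) \<rho>) \<le> M"
proof (rule ccontr)
  assume "\<not> thesis"
  then have no: "\<not> g r * measure lborel (ball (0::'a) \<rho>) \<le> M" if "r \<in> ball 0 \<rho>" for r
    using \<open>\<And>r. \<lbrakk>r \<in> ball 0 \<rho>; g r * measure lborel (ball (0::'a) \<rho>) \<le> M\<rbrakk> \<Longrightarrow> thesis\<close> that by blast
  let ?V = "measure lborel (ball (0::'a) \<rho>)"
  have V: "?V > 0" using \<open>\<rho> > 0\<close> by simp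
  have gt: "g r - M / ?V > 0" if r: "r \<in> ball 0 \<rho>" for r
  proof -
    have "\<not> g r * ?V \<le> M" using no r by blast
    then show ?thesis using V by (simp add: field_simps)
  qed
  have intc: "set_integrable lborel (ball (0::'a) \<rho>) (\<lambda>r. M / ?V)"
    unfolding set_integrable_def using emeasure_lborel_ball_finite[of "0::'a" \<rho>]
    by (intro integrable_scaleR_left) (auto simp: infinity_ennreal_def)
  have intd: "integrable lborel (\<lambda>r. indicator (ball 0 \<rho>) r *\<^sub>R (g r - M / ?V))"
    using set_integral_diff(1)[OF int intc] by (simp add: set_integrable_def)
  have "(LINT r:ball 0 \<rho>|lborel. g r - M / ?V) = (LINT r:ball 0 \<rho>|lborel. g r) - M"
    using set_integral_diff(2)[OF int intc] V by (simp add: set_lebesgue_integral_def)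
  then have "(LINT r|lborel. indicator (ball 0 \<rho>) r *\<^sub>R (g r - M / ?V)) \<le> 0"
    using le by (simp add: set_lebesgue_integral_def)
  moreover have nonneg: "0 \<le> indicator (ball 0 \<rho>) r *\<^sub>R (g r - M / ?V)" for r
    using gt[of r] by (auto simp: indicator_def)
  ultimately have "(LINT r|lborel. indicator (ball 0 \<rho>) r *\<^sub>R (g r - M / ?V)) = 0"
    using Bochner_Integration.integral_nonneg[of lborel "\<lambda>r. indicator (ball 0 \<rho>) r *\<^sub>R (g r - M / ?V)"] by (intro antisym) auto
  then have "AE r in lborel. indicator (ball 0 \<rho>) r *\<^sub>R (g r - M / ?V) = 0"
    using integral_nonneg_eq_0_iff_AE[OF intd] nonneg by simp
  then have "AE r in lborel. r \<notin> ball (0::'a) \<rho>"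
    by (rule AE_mp) (use gt in \<open>intro AE_I2, force simp: indicator_def\<close>)
  then have "ball (0::'a) \<rho> \<in> null_sets lborel"
    by (subst AE_iff_null_sets) auto
  then show False using V by (simp add: measure_def null_setsD1)
qed

section \<open>Facets of elements and their relative interiors\<close>

context uniform_mesh
begin

lemma card_facets:
  assumes "K \<in> T"
  shows "finite {F. F facet_of K}" "card {F. F facet_of K} \<le> DIM('a) + 1"
proof -
  obtain V where V: "\<not> affine_dependent V" "int (card V) = int DIM('a) + 1" "K = convex hull V"
    using full_dim[OF assms] unfolding simplex_def by blast
  have "finite V" using V(1) aff_independent_finite by blast
  moreover have sub: "{F. F facet_of K} \<subseteq> (\<lambda>u. convex hull (V - {u})) ` V"
    unfolding V(3) facet_of_convex_hull_affine_independent[OF V(1)] by blast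
  ultimately show "finite {F. F facet_of K}" by (meson finite_imageI finite_subset)
  have "card {F. F facet_of K} \<le> card ((\<lambda>u. convex hull (V - {u})) ` V)"
    using sub \<open>finite V\<close> by (intro card_mono) auto
  also have "\<dots> \<le> card V" using \<open>finite V\<close> by (rule card_image_le)
  finally show "card {F. F facet_of K} \<le> DIM('a) + 1" using V(2) by linarith
qed

text \<open>\<open>K \<inter> L\<close> is a face of \<open>K\<close>, and a face of
  \<open>K\<close> that contains a relative interior point of \<open>e\<close> contains
  \<open>e\<close>. Here the absence of hanging nodes is used.\<close>

lemma rel_interior_facet_subset:
  assumes "K \<in> T" "L \<in> T" "e facet_of K" "x \<in> rel_interior e" "x \<in> L"
  shows "e \<subseteq> L"
proof -
  have "e \<subseteq> K" using assms(3) by (rule facet_of_imp_subset)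
  moreover have "x \<in> e" using assms(4) rel_interior_subset by blast
  ultimately have "e \<subseteq> K \<inter> L"
    using subset_of_face_of[OF Int_face_of[OF assms(1,2)], of e] assms(4,5) by blast
  then show ?thesis by blast
qed

lemma rel_interior_facet_generic:
  assumes "K \<in> T" "e facet_of K" "x \<in> rel_interior e"
  shows "x \<notin> codim2_skeleton T"
proof
  assume "x \<in> codim2_skeleton T"
  then obtain F L where F: "L \<in> T" "F face_of L" "aff_dim F + 2 \<le> int DIM('a)" "x \<in> F"
    unfolding codim2_skeleton_def by blast
  have "e \<subseteq> L"
    using rel_interior_facet_subset[OF assms(1) F(1) assms(2,3)] face_of_imp_subset[OF F(2)] F(4) by blast
  then have "e \<subseteq> F"
    using subset_of_face_of[OF F(2), of e] F(4) assms(3) by blast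
  then have "aff_dim e \<le> aff_dim F" by (rule aff_dim_subset)
  then show False
    using F(3) assms(1,2) aff_dim_element by (simp add: facet_of_def)
qed

lemma rel_interior_facet_nonempty:
  assumes "K \<in> T" "e facet_of K"
  obtains x where "x \<in> rel_interior e"
  using assms convex_element face_of_imp_convex rel_interior_eq_empty
  unfolding facet_of_def by blast

end

text \<open>The boundary faces fall into at most \<open>card (W \<times> N)\<close> classes, by the
  translation chosen for them and the hyperplane that carries them; each class is a transversal
  family with constants fixed before the mesh. The constant \<open>c\<close> is the value of
  \<open>pw_const\<close> at one point \<open>y1 + r\<close>, the same for all classes.\<close>

lemma discrete_trace:
  fixes \<Omega> :: "(real^'n) set" and \<theta> D :: real
  assumes \<Omega>: "polyhedral_domain \<Omega>" and \<theta>: "\<theta> > 0"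
  obtains C where "C > 0"
    "\<And>T (h::real) f b k. mesh_function T h \<theta> f b \<Longrightarrow> \<Union>T = closure \<Omega> \<Longrightarrow> h \<le> D \<Longrightarrow>
       (\<And>e. e \<in> boundary_faces \<Omega> T \<Longrightarrow> k e \<in> T \<and> e facet_of k e) \<Longrightarrow>
       real (card (boundary_faces \<Omega> T)) * h ^ CARD('n) \<le> C * h \<and>
       (\<exists>c. h * (\<Sum>e\<in>boundary_faces \<Omega> T. (f (k e) - c)\<^sup>2) \<le> C * (\<Sum>K\<in>T. (b K)\<^sup>2))"
proof -
  let ?d = "CARD('n)"
  have open': "open \<Omega>" "connected \<Omega>" "\<Omega> \<noteq> {}" "bounded \<Omega>"
    using \<Omega> by (auto simp: polyhedral_domain_def)
  then obtain y1 where y1: "y1 \<in> \<Omega>" by blast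
  obtain R where "R > 0" "\<And>x. x \<in> closure \<Omega> \<Longrightarrow> norm x \<le> R"
    using bounded_closure[OF open'(4)] unfolding bounded_pos by blast
  then have R: "closure \<Omega> \<subseteq> cball 0 R" "R \<ge> 0" by auto
  obtain W N \<rho>0 \<delta> where fin: "finite W" "finite N" and pos: "\<rho>0 > 0" "\<delta> > 0"
    and N1: "\<And>n c. (n, c) \<in> N \<Longrightarrow> norm (n::real^'n) = 1"
    and N2: "\<And>x. x \<in> frontier \<Omega> \<Longrightarrow> \<exists>(n, c)\<in>N. n \<bullet> x = c"
    and W1: "\<And>v y. (v, y) \<in> W \<Longrightarrow> (y::real^'n) \<in> \<Omega>"
    and W2: "\<And>v y n c r. (v, y) \<in> W \<Longrightarrow> (n, c) \<in> N \<Longrightarrow> r \<in> ball 0 \<rho>0 \<Longrightarrow> \<delta> \<le> \<bar>n \<bullet> (v + r)\<bar>"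
    and W3: "\<And>x. x \<in> closure \<Omega> \<Longrightarrow> \<exists>(v, y)\<in>W. \<forall>r\<in>ball 0 \<rho>0.
       closed_segment x (x + (v + r)) \<subseteq> closure \<Omega> \<and> closed_segment (x + v + r) (y + r) \<subseteq> closure \<Omega>"
    by (rule polyhedral_transversals[OF \<Omega>]) blast
  \<comment> \<open>Radius and constant are packed into a pair, to be chosen at once for each of the
    finitely many members of \<open>W\<close>.\<close>
  define chain where "chain y z \<longleftrightarrow> fst z > 0 \<and> snd z \<ge> 0 \<and>
    (\<forall>T h f b. mesh_function T h \<theta> f b \<longrightarrow> \<Union>T = closure \<Omega> \<longrightarrow> h \<le> D \<longrightarrow>
       h\<^sup>2 * mesh_function.shift_diff T f (fst z) y y1 \<le> snd z * h ^ ?d * mesh_function.energy T b)"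
    for y :: "real^'n" and z :: "real \<times> real"
  have "\<forall>w\<in>W. \<exists>z. chain (snd w) z"
  proof
    fix w assume "w \<in> W"
    then have "snd w \<in> \<Omega>" using W1[of "fst w" "snd w"] by simp
    obtain \<rho> C where "\<rho> > 0" "C \<ge> 0"
      "\<And>T h f b. mesh_function T h \<theta> f b \<Longrightarrow> \<Union>T = closure \<Omega> \<Longrightarrow> h \<le> D \<Longrightarrow>
         h\<^sup>2 * mesh_function.shift_diff T f \<rho> (snd w) y1 \<le> C * h ^ DIM(real^'n) * mesh_function.energy T b"
      using shift_diff_connected[OF open'(1,2) \<open>snd w \<in> \<Omega>\<close> y1, of \<theta> D] by blast
    then have "chain (snd w) (\<rho>, C)" by (simp add: chain_def)
    then show "\<exists>z. chain (snd w) z" by blast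
  qed
  from bchoice[OF this] obtain z where z: "\<And>w. w \<in> W \<Longrightarrow> chain (snd w) (z w)" by blast
  obtain \<rho>1 where \<rho>1: "\<rho>1 > 0" "\<And>w. w \<in> W \<Longrightarrow> \<rho>1 \<le> fst (z w)"
    using finite_uniform_bound[OF fin(1), of "\<lambda>w. fst (z w)"] z chain_def by blast
  define \<rho> where "\<rho> = min \<rho>0 \<rho>1"
  have \<rho>: "\<rho> > 0" "\<rho> \<le> \<rho>0" using pos(1) \<rho>1(1) by (auto simp: \<rho>_def)
  \<comment> \<open>Large enough for two uses: distances within the closure, at most
    \<open>2 * R\<close>, and the lengths \<open>norm v + \<rho>\<close> of all
    translations.\<close>
  define L where "L = 2 * R + \<rho>0 + (\<Sum>w\<in>W. norm (fst w))"
  have L0: "L \<ge> 2 * R" "L > 0"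
  proof -
    have "0 \<le> (\<Sum>w\<in>W. norm (fst w))" by (intro sum_nonneg) auto
    then show "L \<ge> 2 * R" "L > 0" using R(2) pos(1) unfolding L_def by linarith+
  qed
  \<comment> \<open>The first summand serves the way from \<open>x e + v\<close> to the interior
    point \<open>y0\<close> of the cell, the second the way from there to \<open>y1\<close>.\<close>
  define S where "S = \<bar>4 * ((L + 3 * D) * unit_ball_vol (real ?d) * 2 ^ ?d)\<^sup>2 / \<theta>\<bar> + (\<Sum>w\<in>W. snd (z w))"
  have zS: "0 \<le> snd (z w)" "snd (z w) \<le> S" if "w \<in> W" for w
  proof -
    have nn: "0 \<le> snd (z w)" if "w \<in> W" for w using z[OF that] by (simp add: chain_def)
    show "0 \<le> snd (z w)" using nn that .
    have "snd (z w) \<le> (\<Sum>w\<in>W. snd (z w))" using nn fin(1) that by (intro member_le_sum) auto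
    then show "snd (z w) \<le> S" unfolding S_def by linarith
  qed
  have S0: "4 * ((L + 3 * D) * unit_ball_vol (real ?d) * 2 ^ ?d)\<^sup>2 / \<theta> \<le> S" "S \<ge> 0"
  proof -
    have "0 \<le> (\<Sum>w\<in>W. snd (z w))" using zS(1) by (intro sum_nonneg) auto
    then show "4 * ((L + 3 * D) * unit_ball_vol (real ?d) * 2 ^ ?d)\<^sup>2 / \<theta> \<le> S" "S \<ge> 0"
      unfolding S_def by linarith+
  qed
  define ov where "ov = (?d + 1) * (unit_ball_vol (real ?d) * (2 + L / \<delta>) ^ ?d) / \<theta>"
  define Q where "Q = 4 * ov * (unit_ball_vol (real ?d) * R ^ ?d) / (\<delta> * \<theta>)"
  define V where "V = measure lborel (ball (0::real^'n) \<rho>)"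
  define C1 where "C1 = 12 * ((L + 3 * D) * unit_ball_vol (real ?d) * 2 ^ ?d) * ov / \<theta> * V + 6 * S * Q"
  have V: "V > 0" using \<rho> by (simp add: V_def)
  have ov: "ov \<ge> 0" using \<theta> L0 pos by (simp add: ov_def)
  define X where "X = card (W \<times> N) * C1 / V"
  define C where "C = \<bar>X\<bar> + \<bar>card (W \<times> N) * Q\<bar> + 1"
  show ?thesis
  proof (rule that[of C])
    show "C > 0" unfolding C_def by linarith
    fix T h f b and k :: "(real^'n) set \<Rightarrow> (real^'n) set"
    assume M: "mesh_function T h \<theta> f b" and T: "\<Union>T = closure \<Omega>" and hD: "h \<le> D"
      and k: "\<And>e. e \<in> boundary_faces \<Omega> T \<Longrightarrow> k e \<in> T \<and> e facet_of k e"
    interpret mesh_function T h \<theta> f b by fact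
    let ?B = "boundary_faces \<Omega> T"
    have "?B \<subseteq> (\<Union>K\<in>T. {F. F facet_of K})" by (auto simp: boundary_faces_def faces_def)
    then have finB: "finite ?B" using finite_mesh card_facets(1) by (meson finite_UN_I finite_subset)
    have "\<forall>e\<in>?B. \<exists>x. x \<in> rel_interior e" using k rel_interior_facet_nonempty by meson
    from bchoice[OF this] obtain x where x: "\<And>e. e \<in> ?B \<Longrightarrow> x e \<in> rel_interior e" by blast
    have xe: "x e \<in> e" "x e \<in> frontier \<Omega>" "x e \<in> closure \<Omega>" if "e \<in> ?B" for e
      using x[OF that] rel_interior_subset[of e] that by (auto simp: boundary_faces_def frontier_def)
    have "\<forall>e\<in>?B. \<exists>w. w \<in> W \<and> (\<forall>r\<in>ball 0 \<rho>0.
       closed_segment (x e) (x e + (fst w + r)) \<subseteq> closure \<Omega> \<and> closed_segment (x e + fst w + r) (snd w + r) \<subseteq> closure \<Omega>)"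
      using W3[OF xe(3)] by fastforce
    from bchoice[OF this] obtain w where w: "\<And>e. e \<in> ?B \<Longrightarrow> w e \<in> W"
      "\<And>e r. e \<in> ?B \<Longrightarrow> r \<in> ball 0 \<rho>0 \<Longrightarrow> closed_segment (x e) (x e + (fst (w e) + r)) \<subseteq> closure \<Omega>"
      "\<And>e r. e \<in> ?B \<Longrightarrow> r \<in> ball 0 \<rho>0 \<Longrightarrow> closed_segment (x e + fst (w e) + r) (snd (w e) + r) \<subseteq> closure \<Omega>"
      by blast
    have "\<forall>e\<in>?B. \<exists>p. p \<in> N \<and> fst p \<bullet> x e = snd p"
      using N2[OF xe(2)] by fastforce
    from bchoice[OF this] obtain p where p: "\<And>e. e \<in> ?B \<Longrightarrow> p e \<in> N" "\<And>e. e \<in> ?B \<Longrightarrow> fst (p e) \<bullet> x e = snd (p e)"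
      by blast
    define I where "I e = (LINT r:ball 0 \<rho>|lborel. (f (k e) - pw_const T f (y1 + r))\<^sup>2)" for e
    have class_bound: "real (card {e \<in> ?B. (w e, p e) = wp}) * h ^ ?d \<le> h * Q \<and>
        h * (\<Sum>e | e \<in> ?B \<and> (w e, p e) = wp. I e) \<le> C1 * energy" if wp: "wp \<in> W \<times> N" for wp
    proof -
      define E where "E = {e \<in> ?B. (w e, p e) = wp}"
      obtain v y0 n c where wp': "wp = ((v, y0), (n, c))" by (metis surj_pair)
      have W': "(v, y0) \<in> W" and N': "(n, c) \<in> N" using wp wp' by auto
      have E: "e \<in> ?B" "w e = (v, y0)" "p e = (n, c)" if "e \<in> E" for e
        using that wp' by (auto simp: E_def)
      interpret F: transversal_family_function T h \<theta> E k x "?d + 1" n v c \<rho> \<delta> L f b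
      proof unfold_locales
        show "finite E" using finB by (simp add: E_def)
        show "card {e \<in> E. k e = K} \<le> ?d + 1" if "K \<in> T" for K
        proof -
          have "card {e \<in> E. k e = K} \<le> card {F. F facet_of K}"
            using card_facets(1)[OF that] k E(1) by (intro card_mono) auto
          then show ?thesis using card_facets(2)[OF that] by simp
        qed
        show "k e \<in> T" "x e \<in> k e" "n \<bullet> x e = c" "x e \<notin> codim2_skeleton T" if "e \<in> E" for e
        proof -
          note ke = k[OF E(1)[OF that]]
          show "k e \<in> T" using ke by blast
          show "x e \<in> k e" using ke xe(1)[OF E(1)[OF that]] facet_of_imp_subset by blast
          show "n \<bullet> x e = c" using p(2)[OF E(1)[OF that]] E(3)[OF that] by simp
          show "x e \<notin> codim2_skeleton T"
            using ke x[OF E(1)[OF that]] by (intro rel_interior_facet_generic[of "k e" e]) auto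
        qed
        show "norm n = 1" using N1[OF N'] .
        show "\<rho> > 0" "\<delta> > 0" by fact+
        show "\<delta> \<le> \<bar>n \<bullet> (v + r)\<bar>" if "r \<in> ball 0 \<rho>" for r
          using W2[OF W' N', of r] that \<rho>(2) by simp
        show "closed_segment (x e) (x e + (v + r)) \<subseteq> \<Union>T" if "e \<in> E" "r \<in> ball 0 \<rho>" for e r
          using w(2)[OF E(1)[OF that(1)], of r] E(2)[OF that(1)] that(2) \<rho>(2) T by simp
        have "norm v \<le> (\<Sum>w\<in>W. norm (fst w))"
          using member_le_sum[OF W', of "\<lambda>w. norm (fst w)"] fin(1) by simp
        then show "norm v + \<rho> \<le> L" using \<rho>(2) R(2) by (simp add: L_def)
      qed
      have ov_eq: "F.overlap = ov" unfolding F.overlap_def ov_def by simp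
      have cov: "cover_const L \<le> (L + 3 * D) * unit_ball_vol (real ?d) * 2 ^ ?d"
        using cover_const_le(1)[OF hD, of L] L0(2) by simp
      have "h * (\<Sum>e\<in>E. LINT r:ball 0 \<rho>|lborel. (f (k e) - pw_const T f (y1 + r))\<^sup>2) \<le>
          (12 * cover_const L * F.overlap / \<theta> * measure lborel (ball (0::real^'n) \<rho>) + 6 * S * Q) * energy"
      proof (rule F.family_bound[where ?y0.0 = y0])
        show "h\<^sup>2 * shift_diff \<rho> (x e + v) y0 \<le> S * h ^ DIM(real^'n) * energy" if "e \<in> E" for e
        proof -
          have "x e + v \<in> closure \<Omega>" "y0 \<in> closure \<Omega>"
            using w(3)[OF E(1)[OF that], of 0] E(2)[OF that] pos(1) by auto
          then have "norm (x e + v) \<le> R" "norm y0 \<le> R" using R(1) by auto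
          then have "dist (x e + v) y0 \<le> L"
            using L0(1) norm_triangle_ineq4[of "x e + v" y0] by (simp add: dist_norm)
          then have "h\<^sup>2 * shift_diff \<rho> (x e + v) y0 \<le>
              4 * ((L + 3 * D) * unit_ball_vol (real DIM(real^'n)) * 2 ^ DIM(real^'n))\<^sup>2 / \<theta> * h ^ DIM(real^'n) * energy"
            using w(3)[OF E(1)[OF that]] E(2)[OF that] \<rho>(2) T hD
            by (intro shift_diff_le_uniform) auto
          also have "\<dots> \<le> S * h ^ DIM(real^'n) * energy"
            using S0(1) h_pos energy_nonneg by (intro mult_right_mono) auto
          finally show ?thesis .
        qed
        have "h\<^sup>2 * shift_diff \<rho> y0 y1 \<le> h\<^sup>2 * shift_diff (fst (z (v, y0))) y0 y1"
          using \<rho>1(2)[OF W'] by (intro mult_left_mono shift_diff_mono) (auto simp: \<rho>_def)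
        also have "\<dots> \<le> snd (z (v, y0)) * h ^ ?d * energy"
          using z[OF W'] M T hD by (auto simp: chain_def)
        also have "\<dots> \<le> S * h ^ ?d * energy"
          using zS(2)[OF W'] h_pos energy_nonneg by (intro mult_right_mono) auto
        finally show "h\<^sup>2 * shift_diff \<rho> y0 y1 \<le> S * h ^ DIM(real^'n) * energy" by simp
        show "card E * h ^ DIM(real^'n) \<le> h * Q"
          using F.card_family[of 0 R] R T unfolding Q_def ov_eq by simp
        show "S \<ge> 0" by (rule S0)
      qed
      also have "\<dots> \<le> C1 * energy"
        unfolding C1_def ov_eq V_def
        using cov energy_nonneg ov \<theta>
        by (intro mult_right_mono add_right_mono divide_right_mono mult_left_mono) auto
      finally have "h * (\<Sum>e\<in>E. I e) \<le> C1 * energy" by (simp add: I_def)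
      moreover have "card E * h ^ ?d \<le> h * Q"
        using F.card_family[of 0 R] R T unfolding Q_def ov_eq by simp
      ultimately show ?thesis unfolding E_def by blast
    qed
    have "real (card ?B) * h ^ ?d = (\<Sum>wp\<in>W \<times> N. real (card {e \<in> ?B. (w e, p e) = wp}) * h ^ ?d)"
    proof -
      have "(\<lambda>e. (w e, p e)) ` ?B \<subseteq> W \<times> N" using w(1) p(1) by auto
      from sum.group[OF finB finite_cartesian_product[OF fin] this, of "\<lambda>_. h ^ ?d"]
      show ?thesis by simp
    qed
    also have "\<dots> \<le> card (W \<times> N) * (h * Q)"
      using class_bound by (intro sum_bounded_above) blast
    also have "\<dots> = (card (W \<times> N) * Q) * h" by simp
    also have "\<dots> \<le> C * h"
    proof (rule mult_right_mono)
      show "card (W \<times> N) * Q \<le> C" unfolding C_def by linarith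
    qed (use h_pos in simp)
    finally have count: "real (card ?B) * h ^ ?d \<le> C * h" .
    have "h * (\<Sum>e\<in>?B. I e) = (\<Sum>wp\<in>W \<times> N. h * (\<Sum>e | e \<in> ?B \<and> (w e, p e) = wp. I e))"
    proof -
      have "(\<lambda>e. (w e, p e)) ` ?B \<subseteq> W \<times> N" using w(1) p(1) by auto
      from sum.group[OF finB finite_cartesian_product[OF fin] this, of I]
      show ?thesis by (simp add: sum_distrib_left[symmetric])
    qed
    also have "\<dots> \<le> card (W \<times> N) * (C1 * energy)"
      using class_bound by (intro sum_bounded_above) blast
    finally have total: "h * (\<Sum>e\<in>?B. I e) \<le> card (W \<times> N) * (C1 * energy)" .
    have "set_integrable lborel (ball 0 \<rho>) (\<lambda>r. h * (\<Sum>e\<in>?B. (f (k e) - pw_const T f (y1 + r))\<^sup>2))"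
      using finB integrable_const_diff by (intro set_integrable_mult_right set_integral_sum(1)) auto
    moreover have "(LINT r:ball 0 \<rho>|lborel. h * (\<Sum>e\<in>?B. (f (k e) - pw_const T f (y1 + r))\<^sup>2)) \<le> card (W \<times> N) * (C1 * energy)"
      using total finB integrable_const_diff by (simp add: set_integral_sum(2) I_def)
    \<comment> \<open>A translation that is no worse than average for all the boundary faces
      together.\<close>
    ultimately obtain r where r: "h * (\<Sum>e\<in>?B. (f (k e) - pw_const T f (y1 + r))\<^sup>2) * V \<le> card (W \<times> N) * (C1 * energy)"
      unfolding V_def using exists_le_average[OF _ _ \<rho>(1)] by blast
    have "h * (\<Sum>e\<in>?B. (f (k e) - pw_const T f (y1 + r))\<^sup>2) \<le> X * energy"
      using r V by (simp add: X_def field_simps)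
    also have "\<dots> \<le> C * energy"
    proof (rule mult_right_mono[OF _ energy_nonneg])
      show "X \<le> C" unfolding C_def by linarith
    qed
    finally show "real (card ?B) * h ^ ?d \<le> C * h \<and>
        (\<exists>c. h * (\<Sum>e\<in>?B. (f (k e) - c)\<^sup>2) \<le> C * (\<Sum>K\<in>T. (b K)\<^sup>2))"
      using count unfolding energy_def by blast
  qed
qed

subsection \<open>An inverse inequality for polynomials\<close>

text \<open>Induction on the number of nodes: with the last node \<open>c\<close>, writing
  \<open>P(t) = (t - c) * Q(t) + P(c)\<close> lowers the degree, and the values of \<open>Q\<close>
  at the other nodes are difference quotients of \<open>P\<close>.\<close>

lemma poly_extrapolation:
  fixes \<tau> :: "nat \<Rightarrow> real"
  assumes "inj_on \<tau> {..k}"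
  shows "\<exists>C\<ge>0. \<forall>P. degree P \<le> k \<longrightarrow> \<bar>poly P s\<bar> \<le> C * (\<Sum>i\<le>k. \<bar>poly P (\<tau> i)\<bar>)"
  using assms
proof (induction k)
  case 0
  have "\<bar>poly P s\<bar> \<le> 1 * (\<Sum>i\<le>0. \<bar>poly P (\<tau> i)\<bar>)" if "degree P \<le> 0" for P :: "real poly"
  proof -
    from that have "degree P = 0" by simp
    then obtain a where "P = [:a:]" by (rule degree_eq_zeroE)
    then show ?thesis by simp
  qed
  then show ?case by (intro exI[of _ 1]) auto
next
  case (Suc k)
  have "inj_on \<tau> {..k}" by (rule inj_on_subset[OF Suc.prems]) auto
  from Suc.IH[OF this]
  obtain C where C: "C \<ge> 0" "\<And>P. degree P \<le> k \<Longrightarrow> \<bar>poly P s\<bar> \<le> C * (\<Sum>i\<le>k. \<bar>poly P (\<tau> i)\<bar>)"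
    by blast
  define c where "c = \<tau> (Suc k)"
  have ne: "0 < \<bar>\<tau> i - c\<bar>" if "i \<in> {..k}" for i
    using that inj_onD[OF Suc.prems, of i "Suc k"] by (auto simp: c_def)
  obtain m where m: "m > 0" "\<And>i. i \<in> {..k} \<Longrightarrow> m \<le> \<bar>\<tau> i - c\<bar>"
    using finite_uniform_bound[of "{..k}" "\<lambda>i. \<bar>\<tau> i - c\<bar>"] ne by blast
  \<comment> \<open>The values of \<open>Q\<close> sum up to at most \<open>(k + 2) / m\<close>
    times those of \<open>P\<close>; the final 1 accounts for \<open>P(c)\<close>.\<close>
  define C' where "C' = \<bar>s - c\<bar> * (C / m) * (k + 2) + 1"
  have main: "\<bar>poly P s\<bar> \<le> C' * (\<Sum>i\<le>Suc k. \<bar>poly P (\<tau> i)\<bar>)" if P: "degree P \<le> Suc k" for P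
  proof -
    define Q where "Q = synthetic_div P c"
    let ?S = "\<Sum>i\<le>Suc k. \<bar>poly P (\<tau> i)\<bar>"
    have eq: "poly P t = (t - c) * poly Q t + poly P c" for t
      using arg_cong[OF synthetic_div_correct'[of c P], of "\<lambda>p. poly p t"]
      by (simp add: Q_def algebra_simps)
    have mem: "\<bar>poly P (\<tau> i)\<bar> \<le> ?S" if "i \<le> Suc k" for i
      using that by (intro member_le_sum) auto
    have "\<bar>poly Q (\<tau> i)\<bar> \<le> (\<bar>poly P (\<tau> i)\<bar> + \<bar>poly P c\<bar>) / m" if "i \<in> {..k}" for i
    proof -
      have "m * \<bar>poly Q (\<tau> i)\<bar> \<le> \<bar>\<tau> i - c\<bar> * \<bar>poly Q (\<tau> i)\<bar>"
        using m(2)[OF that] by (intro mult_right_mono) auto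
      also have "\<dots> = \<bar>poly P (\<tau> i) - poly P c\<bar>"
        using eq[of "\<tau> i"] by (simp add: abs_mult)
      also have "\<dots> \<le> \<bar>poly P (\<tau> i)\<bar> + \<bar>poly P c\<bar>" by linarith
      finally show ?thesis using m(1) by (simp add: field_simps)
    qed
    then have "(\<Sum>i\<le>k. \<bar>poly Q (\<tau> i)\<bar>) \<le> (\<Sum>i\<le>k. (\<bar>poly P (\<tau> i)\<bar> + \<bar>poly P c\<bar>) / m)"
      by (intro sum_mono) auto
    also have "\<dots> = ((\<Sum>i\<le>k. \<bar>poly P (\<tau> i)\<bar>) + (k + 1) * \<bar>poly P c\<bar>) / m"
      by (simp add: sum.distrib add_divide_distrib flip: sum_divide_distrib)
    also have "\<dots> \<le> (?S + (k + 1) * ?S) / m"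
      using m(1) mem[of "Suc k"] by (intro divide_right_mono add_mono mult_left_mono) (auto simp: c_def)
    finally have Q: "(\<Sum>i\<le>k. \<bar>poly Q (\<tau> i)\<bar>) \<le> (k + 2) * ?S / m"
      by (simp add: algebra_simps)
    have degQ: "degree Q \<le> k" using P by (simp add: Q_def degree_synthetic_div)
    have "\<bar>poly P s\<bar> \<le> \<bar>s - c\<bar> * \<bar>poly Q s\<bar> + \<bar>poly P c\<bar>"
      unfolding eq[of s] abs_mult[symmetric] by (rule abs_triangle_ineq)
    also have "\<dots> \<le> \<bar>s - c\<bar> * (C * ((k + 2) * ?S / m)) + ?S"
      using C(1) order_trans[OF C(2)[OF degQ] mult_left_mono[OF Q C(1)]] mem[of "Suc k"]
      by (intro add_mono mult_left_mono) (auto simp: c_def)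
    also have "\<dots> = C' * ?S"
      by (simp add: C'_def algebra_simps)
    finally show ?thesis .
  qed
  have "C' \<ge> 0" using C(1) m(1) by (simp add: C'_def)
  then show ?case using main by blast
qed

text \<open>The inverse inequality uses a polynomial only along lines; in this form the degree bound
  passes through sums and products without reference to coefficients.\<close>

definition line_poly :: "nat \<Rightarrow> ('a::real_vector \<Rightarrow> real) \<Rightarrow> bool" where
  "line_poly k q \<longleftrightarrow> (\<forall>x d. \<exists>P. degree P \<le> k \<and> (\<forall>t. q (x + t *\<^sub>R d) = poly P t))"

lemma line_poly_mono: "line_poly k q \<Longrightarrow> k \<le> l \<Longrightarrow> line_poly l q"
  unfolding line_poly_def by (meson order_trans)

lemma line_poly_const: "line_poly 0 (\<lambda>_. c)"
  unfolding line_poly_def by (intro allI exI[of _ "[:c:]"]) auto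

lemma line_poly_nth: "line_poly 1 (\<lambda>x::real^'n. x $ i)"
  unfolding line_poly_def
  by (intro allI, rule_tac x = "[:x $ i, d $ i:]" in exI) (auto simp: mult.commute)

lemma line_poly_mult:
  assumes "line_poly k p" "line_poly l q"
  shows "line_poly (k + l) (\<lambda>x. p x * q x)"
  unfolding line_poly_def
proof (intro allI)
  fix x d
  obtain P Q where "degree P \<le> k" "\<forall>t. p (x + t *\<^sub>R d) = poly P t" "degree Q \<le> l" "\<forall>t. q (x + t *\<^sub>R d) = poly Q t"
    using assms unfolding line_poly_def by meson
  then show "\<exists>R. degree R \<le> k + l \<and> (\<forall>t. p (x + t *\<^sub>R d) * q (x + t *\<^sub>R d) = poly R t)"
    by (intro exI[of _ "P * Q"]) (auto intro: order_trans[OF degree_mult_le])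
qed

lemma line_poly_add:
  assumes "line_poly k p" "line_poly k q"
  shows "line_poly k (\<lambda>x. p x + q x)"
  unfolding line_poly_def
proof (intro allI)
  fix x d
  obtain P Q where "degree P \<le> k" "\<forall>t. p (x + t *\<^sub>R d) = poly P t" "degree Q \<le> k" "\<forall>t. q (x + t *\<^sub>R d) = poly Q t"
    using assms unfolding line_poly_def by meson
  then show "\<exists>R. degree R \<le> k \<and> (\<forall>t. p (x + t *\<^sub>R d) + q (x + t *\<^sub>R d) = poly R t)"
    by (intro exI[of _ "P + Q"]) (auto intro: degree_add_le)
qed

lemma line_poly_sum:
  assumes "\<And>i. i \<in> I \<Longrightarrow> line_poly k (p i)"
  shows "line_poly k (\<lambda>x. \<Sum>i\<in>I. p i x)"
  using assms
  by (induction I rule: infinite_finite_induct)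
    (auto intro: line_poly_add line_poly_mono[OF line_poly_const])

lemma line_poly_power: "line_poly k p \<Longrightarrow> line_poly (a * k) (\<lambda>x. p x ^ a)"
  by (induction a) (auto intro: line_poly_mult line_poly_const)

lemma line_poly_prod:
  assumes "finite I" "\<And>i. i \<in> I \<Longrightarrow> line_poly (k i) (p i)"
  shows "line_poly (\<Sum>i\<in>I. k i) (\<lambda>x. \<Prod>i\<in>I. p i x)"
  using assms by (induction I) (auto intro: line_poly_mult line_poly_const)

lemma lborel_integral_affine:
  fixes f :: "'a::euclidean_space \<Rightarrow> real"
  assumes [measurable]: "f \<in> borel_measurable borel" and "c \<noteq> 0"
  shows "\<bar>c\<bar> ^ DIM('a) * (LINT y|lborel. f (a + c *\<^sub>R y)) = (LINT y|lborel. f y)"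
proof -
  have "(LINT y|lborel. f y) = (LINT y|density (distr lborel borel (\<lambda>y. a + c *\<^sub>R y)) (\<lambda>_. ennreal (\<bar>c\<bar> ^ DIM('a))). f y)"
    using lborel_affine[OF \<open>c \<noteq> 0\<close>, of a] by simp
  also have "\<dots> = (LINT y|distr lborel borel (\<lambda>y. a + c *\<^sub>R y). \<bar>c\<bar> ^ DIM('a) * f y)"
    by (subst integral_density) auto
  also have "\<dots> = (LINT y|lborel. \<bar>c\<bar> ^ DIM('a) * f (a + c *\<^sub>R y))"
    by (subst integral_distr) auto
  finally show ?thesis by simp
qed

lemma lborel_integrable_affine:
  fixes f :: "'a::euclidean_space \<Rightarrow> real"
  assumes "integrable lborel f" and "c \<noteq> 0"
  shows "integrable lborel (\<lambda>y. f (a + c *\<^sub>R y))"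
proof -
  have m [measurable]: "f \<in> borel_measurable borel"
    using borel_measurable_integrable[OF assms(1)] by simp
  have "integrable (density (distr lborel borel (\<lambda>y. a + c *\<^sub>R y)) (\<lambda>_. ennreal (\<bar>c\<bar> ^ DIM('a)))) f"
    using lborel_affine[OF \<open>c \<noteq> 0\<close>, of a] assms(1) by simp
  then have "integrable (distr lborel borel (\<lambda>y. a + c *\<^sub>R y)) (\<lambda>y. \<bar>c\<bar> ^ DIM('a) * f y)"
    by (subst (asm) integrable_density) auto
  then have "integrable lborel (\<lambda>y. \<bar>c\<bar> ^ DIM('a) * f (a + c *\<^sub>R y))"
    by (subst (asm) integrable_distr_eq) auto
  then show ?thesis using assms(2) by simp
qed

lemma set_integrable_continuous_compact:
  fixes f :: "'a::euclidean_space \<Rightarrow> real"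
  assumes "compact K" "continuous_on UNIV f"
  shows "set_integrable lborel K f"
  using borel_integrable_compact[OF assms(1) continuous_on_subset[OF assms(2)]]
  by (simp add: set_integrable_def)

text \<open>On a convex set \<open>K\<close>, \<open>q x\<close> is extrapolated from the values of \<open>q\<close> at the points \<open>y + \<tau> (x - y)\<close>
  with \<open>\<tau> \<le> 1/2\<close>; averaging over \<open>y\<close> makes the inverse inequality independent of the shape of \<open>K\<close>.\<close>

lemma inverse_inequality:
  obtains C where "C > 0"
    "\<And>(K::'a::euclidean_space set) q x. compact K \<Longrightarrow> convex K \<Longrightarrow> continuous_on UNIV q \<Longrightarrow> line_poly k q \<Longrightarrow> x \<in> K \<Longrightarrow>
      measure lborel K * (q x)\<^sup>2 \<le> C * (LINT y:K|lborel. (q y)\<^sup>2)"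
proof -
  \<comment> \<open>\<open>k + 1\<close> distinct nodes in \<open>[0, 1/2]\<close>: the contraction
    \<open>y \<mapsto> \<tau> x + (1 - \<tau>) y\<close> then shrinks volumes at most by the factor
    \<open>2 ^ d\<close>.\<close>
  define \<tau> where "\<tau> i = real i / (2 * (real k + 1))" for i :: nat
  have "inj_on \<tau> {..k}" by (auto simp: inj_on_def \<tau>_def)
  from poly_extrapolation[OF this, of 1] obtain c where
    c: "c \<ge> 0" "\<And>P. degree P \<le> k \<Longrightarrow> \<bar>poly P 1\<bar> \<le> c * (\<Sum>i\<le>k. \<bar>poly P (\<tau> i)\<bar>)" by blast
  have \<tau>: "0 \<le> \<tau> i" "\<tau> i \<le> 1 / 2" if "i \<in> {..k}" for i
    using that by (auto simp: \<tau>_def field_simps)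
  define C where "C = c\<^sup>2 * (k + 1) * (k + 1) * 2 ^ DIM('a) + 1"
  show ?thesis
  proof (rule that[of C])
    show "C > 0" using c(1) by (simp add: C_def add_nonneg_pos)
    fix K :: "'a set" and q :: "'a \<Rightarrow> real" and x
    assume K: "compact K" "convex K" and q: "continuous_on UNIV q" "line_poly k q" and x: "x \<in> K"
    let ?J = "LINT y:K|lborel. (q y)\<^sup>2"
    have cont: "continuous_on UNIV (\<lambda>y. (q (a *\<^sub>R x + b *\<^sub>R y))\<^sup>2)" for a b
      by (intro continuous_intros continuous_on_compose2[OF q(1)]) auto
    have qm [measurable]: "q \<in> borel_measurable borel" using q(1) by (rule borel_measurable_continuous_onI)
    have Km [measurable]: "K \<in> sets borel" using K(1) by (rule borel_compact)
    have J0: "?J \<ge> 0"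
      unfolding set_lebesgue_integral_def by (intro Bochner_Integration.integral_nonneg) auto
    have pt: "(q x)\<^sup>2 \<le> c\<^sup>2 * (k + 1) * (\<Sum>i\<le>k. (q (\<tau> i *\<^sub>R x + (1 - \<tau> i) *\<^sub>R y))\<^sup>2)" for y
    proof -
      obtain P where P: "degree P \<le> k" "\<And>t. q (y + t *\<^sub>R (x - y)) = poly P t"
        using q(2) unfolding line_poly_def by meson
      have e: "y + t *\<^sub>R (x - y) = t *\<^sub>R x + (1 - t) *\<^sub>R y" for t by (simp add: algebra_simps)
      have "\<bar>q x\<bar> \<le> c * (\<Sum>i\<le>k. \<bar>q (\<tau> i *\<^sub>R x + (1 - \<tau> i) *\<^sub>R y)\<bar>)"
        using c(2)[OF P(1)] P(2)[of 1] P(2) by (simp add: e)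
      then have "\<bar>q x\<bar>\<^sup>2 \<le> (c * (\<Sum>i\<le>k. \<bar>q (\<tau> i *\<^sub>R x + (1 - \<tau> i) *\<^sub>R y)\<bar>))\<^sup>2"
        by (intro power_mono) auto
      also have "\<dots> = c\<^sup>2 * (\<Sum>i\<le>k. \<bar>q (\<tau> i *\<^sub>R x + (1 - \<tau> i) *\<^sub>R y)\<bar>)\<^sup>2" by (simp add: power_mult_distrib)
      also have "\<dots> \<le> c\<^sup>2 * (card {..k} * (\<Sum>i\<le>k. \<bar>q (\<tau> i *\<^sub>R x + (1 - \<tau> i) *\<^sub>R y)\<bar>\<^sup>2))"
        by (intro mult_left_mono sum_power2_le_card) auto
      finally show ?thesis by (simp add: mult_ac)
    qed
    have each: "(LINT y:K|lborel. (q (\<tau> i *\<^sub>R x + (1 - \<tau> i) *\<^sub>R y))\<^sup>2) \<le> 2 ^ DIM('a) * ?J" if i: "i \<in> {..k}" for i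
    proof -
      define s where "s = 1 - \<tau> i"
      have s: "1 / 2 \<le> s" "s \<le> 1" using \<tau>[OF i] by (auto simp: s_def)
      let ?F = "\<lambda>y. indicat_real K y *\<^sub>R (q y)\<^sup>2"
      have intF: "integrable lborel ?F"
        using set_integrable_continuous_compact[OF K(1), of "\<lambda>y. (q y)\<^sup>2"] q(1)
        by (simp add: set_integrable_def continuous_on_power)
      have intF': "integrable lborel (\<lambda>y. ?F (\<tau> i *\<^sub>R x + s *\<^sub>R y))"
        by (rule lborel_integrable_affine[OF intF]) (use s in simp)
      \<comment> \<open>The contraction with centre \<open>x\<close> maps the convex set
        \<open>K\<close> into itself.\<close>
      have le: "(LINT y:K|lborel. (q (\<tau> i *\<^sub>R x + s *\<^sub>R y))\<^sup>2) \<le> (LINT y|lborel. ?F (\<tau> i *\<^sub>R x + s *\<^sub>R y))"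
        unfolding set_lebesgue_integral_def
      proof (rule integral_mono[OF _ intF'])
        show "integrable lborel (\<lambda>y. indicat_real K y *\<^sub>R (q (\<tau> i *\<^sub>R x + s *\<^sub>R y))\<^sup>2)"
          using set_integrable_continuous_compact[OF K(1) cont] by (simp add: set_integrable_def)
        fix y
        have "\<tau> i *\<^sub>R x + s *\<^sub>R y \<in> K" if "y \<in> K"
          using convexD[OF K(2) x that, of "\<tau> i" s] \<tau>[OF i] s by (simp add: s_def)
        then show "indicat_real K y *\<^sub>R (q (\<tau> i *\<^sub>R x + s *\<^sub>R y))\<^sup>2 \<le> ?F (\<tau> i *\<^sub>R x + s *\<^sub>R y)"
          by (auto simp: indicator_def)
      qed
      have eq: "s ^ DIM('a) * (LINT y|lborel. ?F (\<tau> i *\<^sub>R x + s *\<^sub>R y)) = ?J"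
        using lborel_integral_affine[of ?F s "\<tau> i *\<^sub>R x"] s by (simp add: set_lebesgue_integral_def)
      have "s ^ DIM('a) * (LINT y:K|lborel. (q (\<tau> i *\<^sub>R x + s *\<^sub>R y))\<^sup>2) \<le> ?J"
        unfolding eq[symmetric] using s by (intro mult_left_mono le) simp
      moreover have "(1 / 2) ^ DIM('a) \<le> s ^ DIM('a)" using s by (intro power_mono) auto
      then have "(1 / 2) ^ DIM('a) * (LINT y:K|lborel. (q (\<tau> i *\<^sub>R x + s *\<^sub>R y))\<^sup>2) \<le>
          s ^ DIM('a) * (LINT y:K|lborel. (q (\<tau> i *\<^sub>R x + s *\<^sub>R y))\<^sup>2)"
        by (intro mult_right_mono) (auto simp: set_lebesgue_integral_def)
      ultimately have "(1 / 2) ^ DIM('a) * (LINT y:K|lborel. (q (\<tau> i *\<^sub>R x + s *\<^sub>R y))\<^sup>2) \<le> ?J"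
        by linarith
      then show ?thesis by (simp add: s_def power_one_over field_simps)
    qed
    have intc: "set_integrable lborel K (\<lambda>y. (q x)\<^sup>2)"
      by (intro set_integrable_continuous_compact K(1)) auto
    have "measure lborel K * (q x)\<^sup>2 = (LINT y:K|lborel. (q x)\<^sup>2)"
      by (simp add: set_lebesgue_integral_def)
    also have "\<dots> \<le> (LINT y:K|lborel. c\<^sup>2 * (k + 1) * (\<Sum>i\<le>k. (q (\<tau> i *\<^sub>R x + (1 - \<tau> i) *\<^sub>R y))\<^sup>2))"
      by (intro set_integral_mono intc pt set_integrable_mult_right set_integral_sum(1)
          set_integrable_continuous_compact K(1) cont impI) auto
    also have "\<dots> = c\<^sup>2 * (k + 1) * (\<Sum>i\<le>k. LINT y:K|lborel. (q (\<tau> i *\<^sub>R x + (1 - \<tau> i) *\<^sub>R y))\<^sup>2)"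
      using set_integral_sum(2)[of "{..k}" lborel K "\<lambda>i y. (q (\<tau> i *\<^sub>R x + (1 - \<tau> i) *\<^sub>R y))\<^sup>2"]
        set_integrable_continuous_compact[OF K(1) cont] by simp
    also have "\<dots> \<le> c\<^sup>2 * (k + 1) * (\<Sum>i\<le>k. 2 ^ DIM('a) * ?J)"
      using each by (intro mult_left_mono sum_mono) auto
    also have "\<dots> \<le> C * ?J"
      using J0 by (simp add: C_def algebra_simps)
    finally show "measure lborel K * (q x)\<^sup>2 \<le> C * ?J" .
  qed
qed

lemma polys_gradient:
  assumes "p \<in> polys k"
  obtains g :: "real^'n \<Rightarrow> real^'n" where "\<And>x. GDERIV p x :> g x" "continuous_on UNIV g" "\<And>i. line_poly k (\<lambda>x. g x $ i)"
proof -
  let ?A = "{\<alpha> :: 'n \<Rightarrow> nat. (\<Sum>i\<in>UNIV. \<alpha> i) \<le> k}"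
  obtain c where p: "p = (\<lambda>x. \<Sum>\<alpha>\<in>?A. c \<alpha> * (\<Prod>i\<in>UNIV. (x $ i) ^ \<alpha> i))"
    using assms unfolding polys_def by blast
  define g where "g x = (\<chi> i. \<Sum>\<alpha>\<in>?A. c \<alpha> * (real (\<alpha> i) * (x $ i) ^ (\<alpha> i - 1) * (\<Prod>j\<in>UNIV - {i}. (x $ j) ^ \<alpha> j)))" for x :: "real^'n"
  show ?thesis
  proof (rule that[of g])
    show "GDERIV p x :> g x" for x
      unfolding gderiv_def
    proof (rule has_derivative_eq_rhs)
      show "(p has_derivative (\<lambda>h. \<Sum>\<alpha>\<in>?A. c \<alpha> * (\<Sum>i\<in>UNIV. (real (\<alpha> i) * (h $ i) * (x $ i) ^ (\<alpha> i - 1)) * (\<Prod>j\<in>UNIV - {i}. (x $ j) ^ \<alpha> j)))) (at x)"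
        unfolding p
        by (intro has_derivative_sum has_derivative_mult_right has_derivative_prod has_derivative_power bounded_linear.has_derivative[OF bounded_linear_vec_nth] has_derivative_ident)
      show "(\<lambda>h. \<Sum>\<alpha>\<in>?A. c \<alpha> * (\<Sum>i\<in>UNIV. (real (\<alpha> i) * (h $ i) * (x $ i) ^ (\<alpha> i - 1)) * (\<Prod>j\<in>UNIV - {i}. (x $ j) ^ \<alpha> j))) = (\<lambda>h. h \<bullet> g x)"
      proof
        fix h
        have "h \<bullet> g x = (\<Sum>i\<in>UNIV. \<Sum>\<alpha>\<in>?A. h $ i * (c \<alpha> * (real (\<alpha> i) * (x $ i) ^ (\<alpha> i - 1) * (\<Prod>j\<in>UNIV - {i}. (x $ j) ^ \<alpha> j))))"
          by (simp add: inner_vec_def g_def sum_distrib_left)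
        also have "\<dots> = (\<Sum>\<alpha>\<in>?A. \<Sum>i\<in>UNIV. h $ i * (c \<alpha> * (real (\<alpha> i) * (x $ i) ^ (\<alpha> i - 1) * (\<Prod>j\<in>UNIV - {i}. (x $ j) ^ \<alpha> j))))"
          by (rule sum.swap)
        finally show "(\<Sum>\<alpha>\<in>?A. c \<alpha> * (\<Sum>i\<in>UNIV. (real (\<alpha> i) * (h $ i) * (x $ i) ^ (\<alpha> i - 1)) * (\<Prod>j\<in>UNIV - {i}. (x $ j) ^ \<alpha> j))) = h \<bullet> g x"
          by (simp add: sum_distrib_left mult_ac)
      qed
    qed
    show "continuous_on UNIV g"
      unfolding g_def by (intro continuous_intros)
    show "line_poly k (\<lambda>x. g x $ i)" for i
      unfolding g_def vec_lambda_beta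
    proof (rule line_poly_sum)
      fix \<alpha> :: "'n \<Rightarrow> nat" assume "\<alpha> \<in> ?A"
      \<comment> \<open>The subtraction \<open>\<alpha> i - 1\<close> is truncated; for
        \<open>\<alpha> i = 0\<close> the coefficient vanishes, and the degree count remains
        valid.\<close>
      have "line_poly (0 + ((0 + (\<alpha> i - 1) * 1) + (\<Sum>j\<in>UNIV - {i}. \<alpha> j * 1)))
          (\<lambda>x. c \<alpha> * (real (\<alpha> i) * (x $ i) ^ (\<alpha> i - 1) * (\<Prod>j\<in>UNIV - {i}. (x $ j) ^ \<alpha> j)))"
        by (intro line_poly_mult line_poly_const line_poly_power line_poly_nth line_poly_prod) auto
      moreover have "(\<Sum>j\<in>UNIV. \<alpha> j) = \<alpha> i + (\<Sum>j\<in>UNIV - {i}. \<alpha> j)"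
        by (intro sum.remove) auto
      ultimately show "line_poly k (\<lambda>x. c \<alpha> * (real (\<alpha> i) * (x $ i) ^ (\<alpha> i - 1) * (\<Prod>j\<in>UNIV - {i}. (x $ j) ^ \<alpha> j)))"
        using \<open>\<alpha> \<in> ?A\<close> by (elim line_poly_mono) auto
    qed
  qed
qed

lemma polys_continuous:
  assumes "p \<in> polys k"
  shows "continuous_on UNIV (p :: real^'n \<Rightarrow> real)"
  using assms unfolding polys_def by (auto intro!: continuous_intros)

lemma grad_eqI: "GDERIV f x :> D \<Longrightarrow> grad f x = D"
  unfolding grad_def
proof (rule the_equality)
  fix D' assume "GDERIV f x :> D'" and "GDERIV f x :> D"
  then have "(\<lambda>h. h \<bullet> D') = (\<lambda>h. h \<bullet> D)"
    unfolding gderiv_def by (rule has_derivative_unique)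
  then show "D' = D" by (metis vector_eq_ldot)
qed

text \<open>\<open>f\<close> is prescribed on \<open>K\<close> only, so its gradient is determined
  in the interior of \<open>K\<close>.\<close>

lemma grad_polys_interior:
  assumes "GDERIV p x :> D" "\<And>y. y \<in> K \<Longrightarrow> f y = p y" "x \<in> interior K"
  shows "grad f x = D"
proof (rule grad_eqI)
  have "(f has_derivative (\<lambda>h. h \<bullet> D)) (at x)"
    using assms(1) unfolding gderiv_def
    by (rule has_derivative_transform_within_open[OF _ open_interior assms(3)])
      (use assms(2) interior_subset[of K] in \<open>auto simp: subset_iff\<close>)
  then show "GDERIV f x :> D" by (simp add: gderiv_def)
qed

lemma measure_compact_pos:
  fixes K :: "'a::euclidean_space set"
  assumes "compact K" "interior K \<noteq> {}"
  shows "measure lborel K > 0"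
proof -
  obtain z e where z: "e > 0" "ball z e \<subseteq> K"
    using assms(2) by (metis equals0I mem_interior)
  then have "0 < measure lborel (ball z e)" by simp
  also have "\<dots> \<le> measure lborel K"
    using z(2) assms(1) by (intro measure_mono_fmeasurable fmeasurable_compact) auto
  finally show ?thesis .
qed

text \<open>The inverse inequality for the components of the gradient bounds its supremum by its
  mean square; the mean value inequality on the convex set \<open>K\<close> does the rest. The
  constant depends on \<open>k\<close> and the dimension, not on the shape of
  \<open>K\<close>.\<close>

lemma polynomial_oscillation:
  obtains C where "C > 0"
    "\<And>(K :: (real^'n) set) f p x y. compact K \<Longrightarrow> convex K \<Longrightarrow> interior K \<noteq> {} \<Longrightarrow> p \<in> polys k \<Longrightarrow>
      (\<And>z. z \<in> K \<Longrightarrow> f z = p z) \<Longrightarrow> x \<in> K \<Longrightarrow> y \<in> K \<Longrightarrow>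
      measure lborel K * (f x - f y)\<^sup>2 \<le> C * (dist x y)\<^sup>2 * (LINT z:interior K|lborel. (norm (grad f z))\<^sup>2)"
proof -
  obtain C where C: "C > 0"
    "\<And>(K::(real^'n) set) q x. compact K \<Longrightarrow> convex K \<Longrightarrow> continuous_on UNIV q \<Longrightarrow> line_poly k q \<Longrightarrow> x \<in> K \<Longrightarrow>
      measure lborel K * (q x)\<^sup>2 \<le> C * (LINT y:K|lborel. (q y)\<^sup>2)"
    using inverse_inequality[where k = k] by blast
  show ?thesis
  proof (rule that[OF C(1)])
    fix K :: "(real^'n) set" and f p :: "real^'n \<Rightarrow> real" and x y
    assume K: "compact K" "convex K" "interior K \<noteq> {}" and p: "p \<in> polys k" and f: "\<And>z. z \<in> K \<Longrightarrow> f z = p z"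
      and xy: "x \<in> K" "y \<in> K"
    obtain g where g: "\<And>x. GDERIV p x :> g x" "continuous_on UNIV g" "\<And>i. line_poly k (\<lambda>x. g x $ i)"
      using polys_gradient[OF p] by blast
    let ?J = "LINT z:interior K|lborel. (norm (grad f z))\<^sup>2"
    have neg: "negligible (frontier K)" using K(2) by (rule negligible_convex_frontier)
    have Jeq: "?J = (LINT z:K|lborel. (norm (g z))\<^sup>2)"
    proof -
      have "?J = (LINT z:interior K|lborel. (norm (g z))\<^sup>2)"
        using grad_polys_interior[OF g(1) f] by (intro set_lebesgue_integral_cong) auto
      also have "\<dots> = (LINT z:K|lborel. (norm (g z))\<^sup>2)"
      proof (rule set_integral_cong_set)
        have "g \<in> borel_measurable borel" using g(2) by (rule borel_measurable_continuous_onI)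
        then have m: "(\<lambda>z. (norm (g z))\<^sup>2) \<in> borel_measurable lborel" by simp
        show "set_borel_measurable lborel (interior K) (\<lambda>z. (norm (g z))\<^sup>2)"
          "set_borel_measurable lborel K (\<lambda>z. (norm (g z))\<^sup>2)"
          unfolding set_borel_measurable_def using m K(1) borel_compact by measurable
        show "AE z in lborel. (z \<in> K) = (z \<in> interior K)"
          using AE_lborel_not_in[OF neg]
          by (rule AE_mp) (use K(1) interior_subset in \<open>auto simp: frontier_def compact_imp_closed intro!: AE_I2\<close>)
      qed
      finally show ?thesis .
    qed
    have int: "set_integrable lborel K (\<lambda>z. (g z $ i)\<^sup>2)" for i
      using g(2) by (intro set_integrable_continuous_compact K(1) continuous_intros)
    have bound: "measure lborel K * (norm (g z))\<^sup>2 \<le> C * ?J" if "z \<in> K" for z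
    proof -
      have n: "(norm (v :: real^'n))\<^sup>2 = (\<Sum>i\<in>UNIV. (v $ i)\<^sup>2)" for v
        unfolding power2_norm_eq_inner by (simp add: inner_vec_def power2_eq_square)
      have "measure lborel K * (norm (g z))\<^sup>2 = (\<Sum>i\<in>UNIV. measure lborel K * (g z $ i)\<^sup>2)"
        by (simp add: n sum_distrib_left)
      also have "\<dots> \<le> (\<Sum>i\<in>UNIV. C * (LINT z:K|lborel. (g z $ i)\<^sup>2))"
        using g(2,3) that K by (intro sum_mono C(2) continuous_intros) auto
      also have "\<dots> = C * ?J"
        unfolding Jeq n[of "g _"] using int by (simp add: set_integral_sum(2) sum_distrib_left)
      finally show ?thesis .
    qed
    have "measure lborel K > 0"
      using K(1,3) by (rule measure_compact_pos)
    define B where "B = sqrt (C * ?J / measure lborel K)"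
    have J0: "?J \<ge> 0"
      unfolding set_lebesgue_integral_def by (intro Bochner_Integration.integral_nonneg) auto
    have gB: "norm (g z) \<le> B" if "z \<in> K" for z
      unfolding B_def using bound[OF that] \<open>measure lborel K > 0\<close>
      by (intro real_le_rsqrt) (simp add: field_simps)
    have "norm (p x - p y) \<le> B * norm (x - y)"
    proof (rule differentiable_bound[OF K(2)])
      show "(p has_derivative (\<lambda>h. h \<bullet> g z)) (at z within K)" if "z \<in> K" for z
        using g(1)[of z] unfolding gderiv_def by (rule has_derivative_at_withinI)
      show "onorm (\<lambda>h. h \<bullet> g z) \<le> B" if "z \<in> K" for z
      proof (rule onorm_le)
        fix h
        have "norm (h \<bullet> g z) \<le> norm h * norm (g z)" by (simp add: Cauchy_Schwarz_ineq2)
        also have "\<dots> \<le> norm h * B" using gB[OF that] by (intro mult_left_mono) auto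
        finally show "norm (h \<bullet> g z) \<le> B * norm h" by (simp add: mult.commute)
      qed
    qed (use xy in auto)
    then have "\<bar>f x - f y\<bar> \<le> B * dist x y" using f xy by (simp add: dist_norm)
    then have "\<bar>f x - f y\<bar>\<^sup>2 \<le> (B * dist x y)\<^sup>2" by (intro power_mono) auto
    then have "(f x - f y)\<^sup>2 \<le> B\<^sup>2 * (dist x y)\<^sup>2" by (simp add: power_mult_distrib)
    also have "B\<^sup>2 = C * ?J / measure lborel K"
      using C(1) J0 \<open>measure lborel K > 0\<close> by (simp add: B_def)
    finally show "measure lborel K * (f x - f y)\<^sup>2 \<le> C * (dist x y)\<^sup>2 * ?J"
      using \<open>measure lborel K > 0\<close> by (simp add: field_simps)
  qed
qed

subsection \<open>Facets of a mesh\<close>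

text \<open>\<open>m\<close> is constant on the hyperplane spanned by \<open>e\<close>, hence
  orthogonal to its own tangential component, which therefore vanishes.\<close>

lemma unit_normal_unique:
  fixes n m :: "'a::euclidean_space"
  assumes "affine hull e = {x. n \<bullet> x = c}" "norm n = 1" "norm m = 1"
    and perp: "\<And>x y. x \<in> e \<Longrightarrow> y \<in> e \<Longrightarrow> m \<bullet> (x - y) = 0"
  shows "m = n \<or> m = - n"
proof -
  have nn: "n \<bullet> n = 1" using assms(2) by (simp add: dot_square_norm)
  then have "c *\<^sub>R n \<in> affine hull e" using assms(1) by simp
  then have "e \<noteq> {}" by auto
  then obtain y where y: "y \<in> e" by blast
  have "m \<bullet> x = m \<bullet> y" if "x \<in> e" for x using perp[OF that y] by (simp add: inner_diff_right)
  then have "e \<subseteq> {x. m \<bullet> x = m \<bullet> y}" by blast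
  then have "affine hull e \<subseteq> {x. m \<bullet> x = m \<bullet> y}"
    by (rule hull_minimal) (rule affine_hyperplane)
  then have sub: "m \<bullet> x = m \<bullet> y" if "n \<bullet> x = c" for x using assms(1) that by auto
  have ny: "n \<bullet> y = c" using y hull_subset[of e affine] assms(1) by auto
  let ?d = "m - (m \<bullet> n) *\<^sub>R n"
  have nd: "n \<bullet> ?d = 0" by (simp add: inner_diff_right nn inner_commute)
  then have "m \<bullet> (y + ?d) = m \<bullet> y" using ny by (intro sub) (simp add: inner_add_right)
  then have md: "m \<bullet> ?d = 0" by (simp add: inner_add_right)
  have "?d \<bullet> ?d = 0" using nd md by (simp only: inner_diff_left inner_scaleR_left)
  then have eq: "m = (m \<bullet> n) *\<^sub>R n" by simp
  then have "norm m = norm ((m \<bullet> n) *\<^sub>R n)" by (rule arg_cong)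
  then have "\<bar>m \<bullet> n\<bar> = 1" using assms(2,3) by simp
  then have "m \<bullet> n = 1 \<or> m \<bullet> n = -1" by linarith
  then show ?thesis
  proof
    assume "m \<bullet> n = 1"
    from eq[unfolded this] show ?thesis by simp
  next
    assume "m \<bullet> n = -1"
    from eq[unfolded this] show ?thesis by simp
  qed
qed

text \<open>Central projection from \<open>a\<close> carries a point \<open>y\<close> near
  \<open>x\<close> to a point \<open>y'\<close> of the hyperplane near \<open>x\<close>, hence of
  \<open>e\<close>; and \<open>y\<close> lies between \<open>y'\<close> and
  \<open>a\<close>.\<close>

lemma half_ball_subset:
  fixes K :: "'a::euclidean_space set"
  assumes "convex K" "a \<in> K" "n \<bullet> a < c" "norm n = 1" and hull: "affine hull e = {x. n \<bullet> x = c}"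
    and "e \<subseteq> K" "x \<in> rel_interior e"
  shows "\<exists>s>0. \<forall>y\<in>ball x s. n \<bullet> y \<le> c \<longrightarrow> y \<in> K"
proof -
  define \<alpha> where "\<alpha> = c - n \<bullet> a"
  have \<alpha>: "\<alpha> > 0" using assms(3) by (simp add: \<alpha>_def)
  obtain \<epsilon> where \<epsilon>: "\<epsilon> > 0" "ball x \<epsilon> \<inter> affine hull e \<subseteq> e" and "x \<in> e"
    using assms(7) by (auto simp: mem_rel_interior_ball)
  then have nx: "n \<bullet> x = c" using hull_subset[of e affine] hull by auto
  define M where "M = 2 * (1 + norm (a - x) / \<alpha>)"
  have M: "M > 0" using \<alpha> by (simp add: M_def add_pos_nonneg)
  \<comment> \<open>\<open>\<alpha> / 2\<close> keeps the weight \<open>\<tau>\<close> of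
    \<open>a\<close> at most one half, and \<open>\<epsilon> / M\<close> keeps \<open>y'\<close>
    within \<open>\<epsilon>\<close> of \<open>x\<close>.\<close>
  define s where "s = min (\<alpha> / 2) (\<epsilon> / M)"
  show ?thesis
  proof (intro exI[of _ s] conjI ballI impI)
    show "s > 0" using \<alpha> \<epsilon>(1) M by (simp add: s_def)
    fix y assume y: "y \<in> ball x s" "n \<bullet> y \<le> c"
    define \<tau> where "\<tau> = (c - n \<bullet> y) / \<alpha>"
    have "c - n \<bullet> y = n \<bullet> (x - y)" by (simp add: inner_diff_right nx)
    also have "\<dots> \<le> norm (x - y)" using Cauchy_Schwarz_ineq2[of n "x - y"] assms(4) by simp
    finally have \<tau>1: "\<tau> \<le> norm (x - y) / \<alpha>" using \<alpha> by (simp add: \<tau>_def divide_right_mono)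
    also have "\<dots> \<le> 1 / 2" using y(1) \<alpha> by (simp add: s_def dist_norm field_simps)
    finally have \<tau>: "0 \<le> \<tau>" "\<tau> \<le> 1 / 2" using y(2) \<alpha> by (auto simp: \<tau>_def)
    define y' where "y' = (1 / (1 - \<tau>)) *\<^sub>R (y - \<tau> *\<^sub>R a)"
    have "n \<bullet> (y - \<tau> *\<^sub>R a) = (1 - \<tau>) * c"
      using \<alpha> by (simp add: inner_diff_right \<tau>_def \<alpha>_def field_simps)
    then have "n \<bullet> y' = c" using \<tau> by (simp add: y'_def)
    moreover have "norm (y' - x) < \<epsilon>"
    proof -
      have "y' - x = (1 / (1 - \<tau>)) *\<^sub>R (y - \<tau> *\<^sub>R a - (1 - \<tau>) *\<^sub>R x)"
        using \<tau> by (simp add: y'_def scaleR_diff_right)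
      also have "y - \<tau> *\<^sub>R a - (1 - \<tau>) *\<^sub>R x = (y - x) - \<tau> *\<^sub>R (a - x)" by (simp add: algebra_simps)
      finally have "norm (y' - x) = (1 / (1 - \<tau>)) * norm ((y - x) - \<tau> *\<^sub>R (a - x))"
        using \<tau> by simp
      also have "\<dots> \<le> 2 * (norm (x - y) + norm (x - y) / \<alpha> * norm (a - x))"
      proof (rule mult_mono)
        show "1 / (1 - \<tau>) \<le> 2" using \<tau> by (simp add: field_simps)
        have "norm ((y - x) - \<tau> *\<^sub>R (a - x)) \<le> norm (y - x) + norm (\<tau> *\<^sub>R (a - x))" by (rule norm_triangle_ineq4)
        also have "norm (\<tau> *\<^sub>R (a - x)) = \<tau> * norm (a - x)" using \<tau> by simp
        also have "\<dots> \<le> norm (x - y) / \<alpha> * norm (a - x)" using \<tau>1 by (intro mult_right_mono) auto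
        finally show "norm ((y - x) - \<tau> *\<^sub>R (a - x)) \<le> norm (x - y) + norm (x - y) / \<alpha> * norm (a - x)"
          by (simp add: norm_minus_commute)
      qed auto
      also have "\<dots> = norm (x - y) * M" by (simp add: M_def algebra_simps)
      also have "\<dots> < \<epsilon>" using y(1) M by (simp add: s_def dist_norm field_simps)
      finally show ?thesis .
    qed
    ultimately have "y' \<in> e" using \<epsilon>(2) hull by (auto simp: dist_norm norm_minus_commute)
    then have "(1 - \<tau>) *\<^sub>R y' + \<tau> *\<^sub>R a \<in> K"
      using assms(1,2,6) \<tau> by (intro convexD) auto
    then show "y \<in> K" using \<tau> by (simp add: y'_def)
  qed
qed

section \<open>Elements on the two sides of a facet\<close>

context uniform_mesh
begin

lemma facet_normal:
  assumes "K \<in> T" "e facet_of K"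
  obtains n c where "norm n = 1" "\<And>x. x \<in> K \<Longrightarrow> n \<bullet> x \<le> c" "e = K \<inter> {x. n \<bullet> x = c}"
    "affine hull e = {x. n \<bullet> x = c}" "\<And>x. x \<in> interior K \<Longrightarrow> n \<bullet> x < c"
proof -
  obtain a b where ab: "a \<noteq> 0" "K \<subseteq> {x. a \<bullet> x \<le> b}" "e = K \<inter> {x. a \<bullet> x = b}"
    by (rule facet_of_polyhedron[OF polytope_imp_polyhedron[OF polytope_element[OF assms(1)]] assms(2)])
  define n c where "n = a /\<^sub>R norm a" and "c = b / norm a"
  have le: "n \<bullet> x \<le> c \<longleftrightarrow> a \<bullet> x \<le> b" and eq: "n \<bullet> x = c \<longleftrightarrow> a \<bullet> x = b"
    and lt: "n \<bullet> x < c \<longleftrightarrow> a \<bullet> x < b" for x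
    using ab(1) by (auto simp: n_def c_def field_simps)
  have "affine hull e = {x. a \<bullet> x = b}"
  proof (rule affine_dim_equal)
    show "affine hull e \<subseteq> {x. a \<bullet> x = b}"
      using ab(3) by (intro hull_minimal affine_hyperplane) auto
    show "affine hull e \<noteq> {}" using assms(2) by (simp add: facet_of_def)
    show "aff_dim (affine hull e) = aff_dim {x. a \<bullet> x = b}"
      using assms ab(1) aff_dim_element by (simp add: facet_of_def aff_dim_hyperplane)
  qed (auto intro: affine_hyperplane)
  moreover have "a \<bullet> x < b" if "x \<in> interior K" for x
    using interior_mono[OF ab(2)] that interior_halfspace_le[OF ab(1)] by auto
  moreover have "norm n = 1" using ab(1) by (simp add: n_def)
  ultimately show ?thesis
    using that[of n c] ab(2,3) by (auto simp: le eq lt)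
qed

text \<open>Near a relative interior point of \<open>e\<close> both elements fill the same half
  ball, so their interiors overlap.\<close>

lemma same_side_eq:
  assumes "K \<in> T" "L \<in> T" "e facet_of K" "e facet_of L" "norm n = 1" "affine hull e = {x. n \<bullet> x = c}"
    and "\<And>x. x \<in> interior K \<Longrightarrow> n \<bullet> x < c" "\<And>x. x \<in> interior L \<Longrightarrow> n \<bullet> x < c"
  shows "K = L"
proof -
  obtain x where x: "x \<in> rel_interior e" using rel_interior_facet_nonempty[OF assms(1,3)] .
  have half: "\<exists>s>0. \<forall>y\<in>ball x s. n \<bullet> y \<le> c \<longrightarrow> y \<in> M"
    if M: "M \<in> T" "e facet_of M" "\<And>x. x \<in> interior M \<Longrightarrow> n \<bullet> x < c" for M
  proof -
    obtain a where a: "a \<in> interior M" using interior_element_nonempty[OF M(1)] by blast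
    show ?thesis
      by (rule half_ball_subset[OF convex_element[OF M(1)] subsetD[OF interior_subset a] M(3)[OF a] assms(5,6)
        facet_of_imp_subset[OF M(2)] x])
  qed
  obtain s1 s2 where s: "s1 > 0" "\<And>y. y \<in> ball x s1 \<Longrightarrow> n \<bullet> y \<le> c \<Longrightarrow> y \<in> K"
    "s2 > 0" "\<And>y. y \<in> ball x s2 \<Longrightarrow> n \<bullet> y \<le> c \<Longrightarrow> y \<in> L"
    using half[OF assms(1,3,7)] half[OF assms(2,4,8)] by blast
  let ?U = "ball x (min s1 s2) \<inter> {y. n \<bullet> y < c}"
  have "open ?U" by (intro open_Int open_ball open_halfspace_lt)
  moreover have "?U \<subseteq> K \<inter> L" using s by auto
  ultimately have "?U \<subseteq> interior (K \<inter> L)" by (simp add: interior_maximal)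
  moreover have "x - (min s1 s2 / 2) *\<^sub>R n \<in> ?U"
  proof -
    have "n \<bullet> x = c" using x rel_interior_subset[of e] hull_subset[of e affine] assms(6) by auto
    moreover have "0 < min s1 s2 / 2" "min s1 s2 / 2 < s1" "min s1 s2 / 2 < s2" using s by linarith+
    ultimately show ?thesis using assms(5) by (simp add: inner_diff_right dot_square_norm dist_norm)
  qed
  ultimately show ?thesis using element_eqI[OF assms(1,2)] by blast
qed

lemma opposite_sides:
  assumes "K \<in> T" "L \<in> T" "K \<noteq> L" "e facet_of K" "e facet_of L"
    and n: "norm n = 1" "affine hull e = {x. n \<bullet> x = c}" "\<And>x. x \<in> interior K \<Longrightarrow> n \<bullet> x < c"
  shows "\<And>x. x \<in> interior L \<Longrightarrow> n \<bullet> x > c"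
proof -
  obtain m d where m: "norm m = 1" "affine hull e = {x. m \<bullet> x = d}" "\<And>x. x \<in> interior L \<Longrightarrow> m \<bullet> x < d"
    using facet_normal[OF assms(2,5)] by blast
  have "m \<bullet> (x - y) = 0" if "x \<in> e" "y \<in> e" for x y
    using that m(2) hull_subset[of e affine] by (auto simp: inner_diff_right)
  then have mn: "m = n \<or> m = - n" by (rule unit_normal_unique[OF n(2,1) m(1)])
  obtain x where x: "x \<in> e" using assms(4) by (auto simp: facet_of_def)
  then have nx: "n \<bullet> x = c" and mx: "m \<bullet> x = d" using n(2) m(2) hull_subset[of e affine] by auto
  have "m \<noteq> n"
  proof
    assume "m = n"
    then have "d = c" using nx mx by simp
    then have "K = L"
      using same_side_eq[OF assms(1,2,4,5) n(1,2,3)] m(3) \<open>m = n\<close> by blast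
    then show False using assms(3) by blast
  qed
  with mn have m': "m = - n" by blast
  then have "d = - c" using nx mx by simp
  then show "n \<bullet> z > c" if "z \<in> interior L" for z
    using m(3)[OF that] m' by simp
qed

lemma at_most_two_elements:
  assumes "K \<in> T" "L \<in> T" "M \<in> T" "K \<noteq> L" "e facet_of K" "e facet_of L" "e facet_of M"
  shows "M = K \<or> M = L"
proof (rule ccontr)
  assume no: "\<not> (M = K \<or> M = L)"
  obtain n c where n: "norm n = 1" "affine hull e = {x. n \<bullet> x = c}" "\<And>x. x \<in> interior K \<Longrightarrow> n \<bullet> x < c"
    using facet_normal[OF assms(1,5)] by blast
  have n': "norm (- n) = 1" "affine hull e = {x. (- n) \<bullet> x = - c}" using n by auto
  have L: "(- n) \<bullet> x < - c" if "x \<in> interior L" for x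
    using opposite_sides[OF assms(1,2,4,5,6) n that] by simp
  have M: "(- n) \<bullet> x < - c" if "x \<in> interior M" for x
    using opposite_sides[OF assms(1,3) _ assms(5,7) n that] no by auto
  have "L = M" using same_side_eq[OF assms(2,3,6,7) n' L M] .
  then show False using no by blast
qed

text \<open>The two elements lie on opposite sides of \<open>e\<close>, and their half balls at
  \<open>x\<close> make up a ball.\<close>

lemma shared_facet_interior:
  assumes "K \<in> T" "L \<in> T" "K \<noteq> L" "e facet_of K" "e facet_of L" "x \<in> rel_interior e"
  shows "x \<in> interior (K \<union> L)"
proof -
  obtain n c where n: "norm n = 1" "affine hull e = {x. n \<bullet> x = c}" "\<And>x. x \<in> interior K \<Longrightarrow> n \<bullet> x < c"
    using facet_normal[OF assms(1,4)] by blast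
  have n': "norm (- n) = 1" "affine hull e = {x. (- n) \<bullet> x = - c}" using n by auto
  have L: "(- n) \<bullet> x < - c" if "x \<in> interior L" for x
    using opposite_sides[OF assms(1-5) n that] by simp
  obtain a b where a: "a \<in> interior K" and b: "b \<in> interior L"
    using interior_element_nonempty assms(1,2) by blast
  have "\<exists>s>0. \<forall>y\<in>ball x s. n \<bullet> y \<le> c \<longrightarrow> y \<in> K"
    by (rule half_ball_subset[OF convex_element[OF assms(1)] subsetD[OF interior_subset a] n(3)[OF a] n(1,2)
        facet_of_imp_subset[OF assms(4)] assms(6)])
  then obtain s1 where s1: "s1 > 0" "\<And>y. y \<in> ball x s1 \<Longrightarrow> n \<bullet> y \<le> c \<Longrightarrow> y \<in> K" by blast
  have "\<exists>s>0. \<forall>y\<in>ball x s. (- n) \<bullet> y \<le> - c \<longrightarrow> y \<in> L"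
    by (rule half_ball_subset[OF convex_element[OF assms(2)] subsetD[OF interior_subset b] L[OF b] n'
        facet_of_imp_subset[OF assms(5)] assms(6)])
  then obtain s2 where s2: "s2 > 0" "\<And>y. y \<in> ball x s2 \<Longrightarrow> (- n) \<bullet> y \<le> - c \<Longrightarrow> y \<in> L" by blast
  have "ball x (min s1 s2) \<subseteq> K \<union> L"
  proof
    fix y assume "y \<in> ball x (min s1 s2)"
    then have y: "y \<in> ball x s1" "y \<in> ball x s2" by auto
    show "y \<in> K \<union> L"
      using s1(2)[OF y(1)] s2(2)[OF y(2)] by (cases "n \<bullet> y \<le> c") auto
  qed
  then have "ball x (min s1 s2) \<subseteq> interior (K \<union> L)" by (simp add: interior_maximal)
  moreover have "x \<in> ball x (min s1 s2)" using s1(1) s2(1) by simp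
  ultimately show ?thesis by blast
qed

text \<open>\<open>K\<close> stays on one side of the hyperplane of \<open>e\<close>, so another
  element must contain \<open>x\<close>. It contains all of \<open>e\<close>, and the common face is
  of lower dimension than \<open>K\<close>, so it is \<open>e\<close>.\<close>

lemma interior_facet_neighbour:
  assumes "K \<in> T" "e facet_of K" "x \<in> rel_interior e" "x \<in> interior (\<Union>T)"
  obtains L where "L \<in> T" "L \<noteq> K" "e facet_of L"
proof -
  obtain n c where n: "norm n = 1" "\<And>x. x \<in> K \<Longrightarrow> n \<bullet> x \<le> c" "affine hull e = {x. n \<bullet> x = c}"
    using facet_normal[OF assms(1,2)] by blast
  have nx: "n \<bullet> x = c" using assms(3) rel_interior_subset[of e] hull_subset[of e affine] n(3) by auto
  have xe: "x \<in> e" using assms(3) rel_interior_subset by blast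
  let ?Z = "\<Union>(T - {K})"
  have "closed ?Z" using finite_mesh closed_element by (intro closed_Union) auto
  have "x \<in> ?Z"
  proof (rule ccontr)
    assume "x \<notin> ?Z"
    then have "x \<in> interior (\<Union>T) \<inter> - ?Z" using assms(4) by blast
    moreover have "open (interior (\<Union>T) \<inter> - ?Z)" using \<open>closed ?Z\<close> by (simp add: open_Int open_Compl)
    ultimately obtain s where s: "s > 0" "ball x s \<subseteq> interior (\<Union>T) \<inter> - ?Z"
      using open_contains_ball by blast
    let ?y = "x + (s / 2) *\<^sub>R n"
    have "?y \<in> ball x s" using s(1) n(1) by (simp add: dist_norm)
    then have "?y \<in> \<Union>T" "?y \<notin> ?Z" using s(2) interior_subset by blast+
    then have "?y \<in> K" by blast
    then have "n \<bullet> ?y \<le> c" by (rule n(2))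
    then show False using nx s(1) n(1) by (simp add: inner_add_right dot_square_norm)
  qed
  then obtain L where L: "L \<in> T" "L \<noteq> K" "x \<in> L" by blast
  have eL: "e \<subseteq> L" using rel_interior_facet_subset[OF assms(1) L(1) assms(2,3) L(3)] .
  have eK: "e \<subseteq> K \<inter> L" using eL facet_of_imp_subset[OF assms(2)] by blast
  have face: "K \<inter> L face_of K" "K \<inter> L face_of L"
    using Int_face_of[OF assms(1) L(1)] Int_face_of[OF L(1) assms(1)] by (simp_all add: Int_commute)
  have "K \<inter> L \<noteq> K"
  proof
    assume "K \<inter> L = K"
    then have "interior (K \<inter> L) \<noteq> {}" using interior_element_nonempty[OF assms(1)] by simp
    then show False using element_eqI[OF assms(1) L(1)] L(2) by blast
  qed
  then have lt: "aff_dim (K \<inter> L) < aff_dim K" using face_of_aff_dim_lt[OF convex_element[OF assms(1)] face(1)] by blast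
  have "e = K \<inter> L"
  proof (rule ccontr)
    assume "e \<noteq> K \<inter> L"
    moreover have "e face_of K \<inter> L"
      using face_of_subset[OF facet_of_imp_face_of[OF assms(2)] eK] by simp
    moreover have "convex (K \<inter> L)" using convex_element assms(1) L(1) by (simp add: convex_Int)
    ultimately have "aff_dim e < aff_dim (K \<inter> L)" by (simp add: face_of_aff_dim_lt)
    then show False using lt assms(2) by (simp add: facet_of_def)
  qed
  then have "e facet_of L"
    using face(2) assms(2) aff_dim_element[OF assms(1)] aff_dim_element[OF L(1)] by (simp add: facet_of_def)
  with L show ?thesis using that by blast
qed

end

subsection \<open>Surface measure of a face\<close>

definition flat_face :: "(real^'n) set \<Rightarrow> bool" where
  "flat_face e \<longleftrightarrow> compact e \<and> convex e \<and> e \<noteq> {} \<and> aff_dim e = int CARD('n) - 1"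

lemma flat_face_normal:
  fixes e :: "(real^'n) set"
  assumes "flat_face e"
  obtains c where "norm (unit_normal e) = 1" "affine hull e = {x. unit_normal e \<bullet> x = c}"
proof -
  obtain a b where ab: "a \<noteq> 0" "affine hull e = {x. a \<bullet> x = b}"
    using assms aff_dim_eq_hyperplane[of e] by (auto simp: flat_face_def)
  define n where "n = a /\<^sub>R norm a"
  have n1: "norm n = 1" using ab(1) by (simp add: n_def)
  have hull: "affine hull e = {x. n \<bullet> x = b / norm a}"
    unfolding ab(2) using ab(1) by (auto simp: n_def field_simps)
  have "n \<bullet> x = b / norm a" if "x \<in> e" for x
    using hull_inc[OF that, of affine] hull by simp
  then have "norm n = 1 \<and> (\<forall>x\<in>e. \<forall>y\<in>e. n \<bullet> (x - y) = 0)"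
    using n1 by (simp add: inner_diff_right)
  then have "norm (unit_normal e) = 1 \<and> (\<forall>x\<in>e. \<forall>y\<in>e. unit_normal e \<bullet> (x - y) = 0)"
    unfolding unit_normal_def by (rule someI)
  then have u: "norm (unit_normal e) = 1" "unit_normal e = n \<or> unit_normal e = - n"
    using unit_normal_unique[OF hull n1] by auto
  from u(2) show ?thesis
  proof
    assume "unit_normal e = n"
    then show ?thesis using that[of "b / norm a"] u(1) hull by simp
  next
    assume "unit_normal e = - n"
    then show ?thesis using that[of "- (b / norm a)"] u(1) hull by simp
  qed
qed

lemma (in uniform_mesh) compact_facet: "K \<in> T \<Longrightarrow> e facet_of K \<Longrightarrow> compact e"
  using compact_element convex_element face_of_imp_compact facet_of_imp_face_of by blast

lemma flat_faceI:
  assumes "uniform_mesh T h \<theta>" "K \<in> T" "e facet_of K"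
  shows "flat_face (e :: (real^'n) set)"
proof -
  interpret uniform_mesh T h \<theta> by fact
  have "convex e" by (rule face_of_imp_convex[OF facet_of_imp_face_of[OF assms(3)]])
  then show ?thesis
    using compact_facet[OF assms(2,3)] assms(3) aff_dim_element[OF assms(2)]
    by (simp add: flat_face_def facet_of_def)
qed

definition plane_proj :: "'a::real_inner \<Rightarrow> real \<Rightarrow> 'a \<Rightarrow> 'a" where
  "plane_proj n c z = z - (n \<bullet> z - c) *\<^sub>R n"

lemma continuous_plane_proj: "continuous_on S (plane_proj n c)"
  unfolding plane_proj_def by (intro continuous_intros)

lemma closest_point_plane:
  fixes n :: "'a::euclidean_space"
  assumes "norm n = 1"
  shows "closest_point {x. n \<bullet> x = c} z = plane_proj n c z"
proof (rule sym, rule closest_point_unique)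
  show "plane_proj n c z \<in> {x. n \<bullet> x = c}"
    using assms by (simp add: plane_proj_def inner_diff_right dot_square_norm)
  show "\<forall>y\<in>{x. n \<bullet> x = c}. dist z (plane_proj n c z) \<le> dist z y"
  proof clarify
    fix y
    have "\<bar>n \<bullet> z - n \<bullet> y\<bar> \<le> norm (z - y)"
      using Cauchy_Schwarz_ineq2[of n "z - y"] assms by (simp add: inner_diff_right)
    then show "dist z (plane_proj n (n \<bullet> y) z) \<le> dist z y"
      using assms by (simp add: plane_proj_def dist_norm)
  qed
qed (auto intro: convex_hyperplane closed_hyperplane)

lemma plane_proj_prism:
  assumes "norm n = 1" "n \<bullet> x = c"
  shows "plane_proj n c (x + t *\<^sub>R n) = x"
  using assms by (simp add: plane_proj_def inner_add_right dot_square_norm)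

lemma compact_prism:
  assumes "compact e"
  shows "compact (prism e)"
proof -
  have "prism e = (\<lambda>(x, t). x + t *\<^sub>R unit_normal e) ` (e \<times> {0..1})"
    by (force simp: prism_def)
  moreover have "compact ((\<lambda>(x, t). x + t *\<^sub>R unit_normal e) ` (e \<times> {0..1}))"
    unfolding case_prod_beta using assms
    by (intro compact_continuous_image continuous_intros compact_Times) auto
  ultimately show ?thesis by simp
qed

lemma face_proj:
  assumes "flat_face e" "affine hull e = {x. unit_normal e \<bullet> x = c}" "norm (unit_normal e) = 1"
  shows "closest_point (affine hull e) = plane_proj (unit_normal e) c"
    and "plane_proj (unit_normal e) c \<in> prism e \<rightarrow> e"
proof -
  show "closest_point (affine hull e) = plane_proj (unit_normal e) c"
    unfolding assms(2) using closest_point_plane[OF assms(3)] by blast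
  have "unit_normal e \<bullet> x = c" if "x \<in> e" for x using that assms(2) hull_subset[of e affine] by auto
  then show "plane_proj (unit_normal e) c \<in> prism e \<rightarrow> e"
    using plane_proj_prism[OF assms(3)] by (auto simp: prism_def)
qed

text \<open>Surface integrals become volume integrals over the prism. The integrand is prescribed on
  \<open>e\<close> only, so a continuous function \<open>g\<close> that extends it stands in where
  measurability is at stake.\<close>

lemma face_measure_integral:
  fixes g :: "real^'n \<Rightarrow> 'b::{banach, second_countable_topology}"
  assumes e: "flat_face e" and hull: "affine hull e = {x. unit_normal e \<bullet> x = c}" and n: "norm (unit_normal e) = 1"
    and g: "continuous_on UNIV g" and f: "\<And>x. x \<in> e \<Longrightarrow> f x = g x"
  shows "(LINT x|face_measure e. f x) = (LINT z:prism e|lborel. g (plane_proj (unit_normal e) c z))"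
    and "integrable (face_measure e) f"
    and "set_integrable lborel (prism e) (\<lambda>z. g (plane_proj (unit_normal e) c z))"
proof -
  let ?p = "plane_proj (unit_normal e) c"
  have comp: "compact (prism e)" using e by (auto simp: flat_face_def intro: compact_prism)
  have [measurable]: "prism e \<in> sets borel" using comp by (rule borel_compact)
  have "e \<in> sets borel" using e by (auto simp: flat_face_def intro: borel_compact)
  have pm: "?p \<in> borel_measurable borel" by (intro borel_measurable_continuous_onI continuous_plane_proj)
  have meas: "?p \<in> restrict_space lborel (prism e) \<rightarrow>\<^sub>M restrict_space borel e"
  proof (rule measurable_restrict_space2)
    show "?p \<in> space (restrict_space lborel (prism e)) \<rightarrow> e"
      using face_proj(2)[OF e hull n] by (simp add: space_restrict_space)
    show "?p \<in> borel_measurable (restrict_space lborel (prism e))"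
      using pm by (intro measurable_restrict_space1) simp
  qed
  have gm: "g \<in> borel_measurable (restrict_space borel e)"
    using g by (intro measurable_restrict_space1 borel_measurable_continuous_onI)
  have sp: "space (face_measure e) = e"
    by (simp add: face_measure_def space_restrict_space)
  have fg: "f x = g x" if "x \<in> space (face_measure e)" for x using f that sp by simp
  have cont: "continuous_on UNIV (\<lambda>z. g (?p z))"
    using g continuous_plane_proj by (rule continuous_on_compose2) auto
  have int: "integrable lborel (\<lambda>z. indicator (prism e) z *\<^sub>R g (?p z))"
    using cont by (intro borel_integrable_compact comp) (rule continuous_on_subset, auto)
  then show si: "set_integrable lborel (prism e) (\<lambda>z. g (?p z))"
    by (simp add: set_integrable_def)
  have "(LINT x|face_measure e. f x) = (LINT x|face_measure e. g x)"
    using fg by (intro Bochner_Integration.integral_cong) auto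
  also have "\<dots> = (LINT z|restrict_space lborel (prism e). g (?p z))"
    unfolding face_measure_def face_proj(1)[OF e hull n] using meas gm by (rule integral_distr)
  also have "\<dots> = (LINT z:prism e|lborel. g (?p z))"
    by (subst integral_restrict_space) (auto simp: set_lebesgue_integral_def)
  finally show "(LINT x|face_measure e. f x) = (LINT z:prism e|lborel. g (?p z))" .
  have "integrable (face_measure e) f \<longleftrightarrow> integrable (face_measure e) g"
    using fg by (intro Bochner_Integration.integrable_cong) auto
  also have "\<dots> \<longleftrightarrow> integrable (restrict_space lborel (prism e)) (\<lambda>z. g (?p z))"
    unfolding face_measure_def face_proj(1)[OF e hull n] using meas gm by (rule integrable_distr_eq)
  also have "\<dots> \<longleftrightarrow> integrable lborel (\<lambda>z. indicator (prism e) z *\<^sub>R g (?p z))"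
    by (subst integrable_restrict_space) auto
  finally show "integrable (face_measure e) f" using int by simp
qed

lemma face_measure_integrable:
  fixes g :: "real^'n \<Rightarrow> 'b::{banach, second_countable_topology}"
  assumes "flat_face e" "continuous_on UNIV g" "\<And>x. x \<in> e \<Longrightarrow> f x = g x"
  shows "integrable (face_measure e) f"
  using flat_face_normal[OF assms(1)] face_measure_integral(2)[OF assms(1) _ _ assms(2,3)] by metis

lemma space_face_measure: "space (face_measure e) = e"
  by (simp add: face_measure_def space_restrict_space)

lemma face_area_eq:
  assumes "flat_face (e :: (real^'n) set)"
  shows "face_area e = measure lborel (prism e)"
proof -
  obtain c where c: "norm (unit_normal e) = 1" "affine hull e = {x. unit_normal e \<bullet> x = c}"
    using flat_face_normal[OF assms] by blast
  have "(LINT x|face_measure e. (1::real)) = (LINT z:prism e|lborel. (1::real))"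
    by (rule face_measure_integral(1)[OF assms c(2,1), of "\<lambda>_. 1::real"]) auto
  then show ?thesis
    by (simp add: face_area_def set_lebesgue_integral_def space_face_measure)
qed

lemma face_area_nonneg: "face_area e \<ge> 0"
  by (simp add: face_area_def)

section \<open>Invariance of Lebesgue measure under affine involutions\<close>

lemma lborel_distr_involution_wellorder:
  fixes L :: "real^'n::{finite,wellorder} \<Rightarrow> real^'n::{finite,wellorder}"
  assumes L: "linear L" "\<And>x. L (L x) = x"
  shows "distr lborel borel L = lborel"
proof -
  have LL: "L \<circ> L = id" using L(2) by auto
  \<comment> \<open>An involution has determinant 1 or -1, so it preserves volumes.\<close>
  have "det (matrix L) * det (matrix L) = det (matrix L ** matrix L)" by (simp add: det_mul)
  also have "matrix L ** matrix L = matrix (L \<circ> L)" using L(1) by (simp add: matrix_compose)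
  also have "\<dots> = mat 1" by (simp add: LL matrix_id_mat_1)
  finally have "\<bar>det (matrix L)\<bar> = 1"
    by (metis abs_mult_self_eq abs_one det_I real_sqrt_abs2 real_sqrt_one)
  have Lm: "L \<in> borel_measurable borel"
    using L(1) by (intro borel_measurable_continuous_onI linear_continuous_on) (simp add: linear_conv_bounded_linear)
  show ?thesis
  proof (rule lborel_eqI[symmetric])
    fix l u :: "real^'n::{finite,wellorder}" assume le: "\<And>b. b \<in> Basis \<Longrightarrow> l \<bullet> b \<le> u \<bullet> b"
    have eq: "L -` box l u = L ` box l u" using L(2) by (auto simp: image_iff) metis
    have "emeasure (distr lborel borel L) (box l u) = emeasure lborel (L ` box l u)"
      using Lm by (subst emeasure_distr) (auto simp: eq)
    also have "L ` box l u \<in> sets borel"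
      unfolding eq[symmetric] using measurable_sets[OF Lm, of "box l u"] by simp
    then have "emeasure lborel (L ` box l u) = emeasure lebesgue (L ` box l u)"
      by (simp add: emeasure_completion)
    also have "\<dots> = ennreal (measure lebesgue (L ` box l u))"
      using measurable_linear_image[OF L(1), of "box l u"] by (intro emeasure_eq_measure2) simp
    also have "measure lebesgue (L ` box l u) = measure lebesgue (box l u)"
      using measure_linear_image[OF L(1), of "box l u"] \<open>\<bar>det (matrix L)\<bar> = 1\<close> by simp
    also have "\<dots> = (\<Prod>b\<in>Basis. (u - l) \<bullet> b)"
      using le by (simp add: measure_completion)
    finally show "emeasure (distr lborel borel L) (box l u) = (\<Prod>b\<in>Basis. (u - l) \<bullet> b)" .
  qed simp
qed

lemma lborel_reindex:
  fixes r :: "'m::finite \<Rightarrow> 'n::finite"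
  assumes "bij r"
  shows "distr lborel borel (\<lambda>x::real^'n. \<chi> j. x $ r j) = (lborel :: (real^'m) measure)"
proof (rule lborel_eqI[symmetric])
  let ?f = "\<lambda>x::real^'n. \<chi> j. x $ r j"
  have fm: "?f \<in> borel_measurable borel"
    by (intro borel_measurable_continuous_onI continuous_intros)
  fix l u :: "real^'m" assume lu: "\<And>b. b \<in> Basis \<Longrightarrow> l \<bullet> b \<le> u \<bullet> b"
  have le: "l $ j \<le> u $ j" for j
    using lu[of "axis j 1"] by (simp add: axis_in_Basis_iff inner_axis)
  define l' u' :: "real^'n" where "l' = (\<chi> i. l $ inv r i)" and "u' = (\<chi> i. u $ inv r i)"
  have ri: "r (inv r i) = i" "inv r (r j) = j" for i j
    using assms by (simp_all add: bij_is_surj surj_f_inv_f bij_is_inj)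
  have eq: "?f -` box l u = box l' u'"
    unfolding l'_def u'_def by (auto simp: mem_box_cart) (metis ri)+
  have Basis_prod: "(\<Prod>b\<in>Basis. (x :: real^'k::finite) \<bullet> b) = (\<Prod>i\<in>UNIV. x $ i)" for x
  proof -
    have B: "(Basis :: (real^'k) set) = range (\<lambda>i. axis i 1)" by (auto simp: Basis_vec_def)
    have "inj (\<lambda>i. axis i 1 :: real^'k)" by (simp add: inj_on_def axis_eq_axis)
    then show ?thesis unfolding B by (subst prod.reindex) (auto simp: inner_axis comp_def)
  qed
  have "emeasure (distr lborel borel ?f) (box l u) = emeasure lborel (box l' u')"
    using fm by (subst emeasure_distr) (auto simp: eq)
  also have "\<dots> = (\<Prod>b\<in>Basis. (u' - l') \<bullet> b)"
  proof (rule emeasure_lborel_box)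
    fix b :: "real^'n" assume "b \<in> Basis"
    then obtain i where "b = axis i 1" by (auto simp: Basis_vec_def)
    then show "l' \<bullet> b \<le> u' \<bullet> b" using le by (simp add: inner_axis l'_def u'_def)
  qed
  also have "(\<Prod>b\<in>Basis. (u' - l') \<bullet> b) = (\<Prod>i\<in>UNIV. u' $ i - l' $ i)"
    by (simp add: Basis_prod)
  also have "\<dots> = (\<Prod>j\<in>UNIV. u $ j - l $ j)"
    using assms by (intro prod.reindex_bij_witness[of _ r "inv r"]) (auto simp: l'_def u'_def ri)
  also have "\<dots> = (\<Prod>b\<in>Basis. (u - l) \<bullet> b)"
    by (simp add: Basis_prod)
  finally show "emeasure (distr lborel borel ?f) (box l u) = (\<Prod>b\<in>Basis. (u - l) \<bullet> b)" .
qed simp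

text \<open>Conjugation with a renaming of coordinates carries the well-ordered case to any index
  type of the same size.\<close>

lemma lborel_distr_involution_reindex:
  fixes L :: "real^'n \<Rightarrow> real^'n"
    and r :: "'m::{finite,wellorder} \<Rightarrow> 'n"
  assumes L: "linear L" "\<And>x. L (L x) = x" and r: "bij r"
  shows "distr lborel borel L = lborel"
proof -
  let ?f = "\<lambda>x::real^'n. \<chi> j. x $ r j" and ?g = "\<lambda>y::(real, 'm) vec. \<chi> i. y $ inv r i"
  have gf: "?g (?f x) = x" and fg: "?f (?g y) = y" for x y
    using r by (simp_all add: vec_eq_iff bij_is_surj surj_f_inv_f bij_is_inj)
  have lin: "linear ?f" "linear ?g"
    by (auto intro!: linearI simp: vec_eq_iff)
  have meas: "f \<in> borel_measurable borel" if "linear f" for f :: "'x::euclidean_space \<Rightarrow> 'y::euclidean_space"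
    using that by (intro borel_measurable_continuous_onI linear_continuous_on) (simp add: linear_conv_bounded_linear)
  let ?M = "\<lambda>y. ?f (L (?g y))"
  have M: "linear ?M"
    using linear_compose[OF linear_compose[OF lin(2) L(1)] lin(1)] by (simp add: comp_def)
  have "L = ?g \<circ> (?M \<circ> ?f)" unfolding comp_def gf ..
  then have "distr lborel borel L = distr (distr (distr lborel borel ?f) borel ?M) borel ?g"
    using meas[OF lin(1)] meas[OF lin(2)] meas[OF M] by (simp add: distr_distr)
  also have "\<dots> = distr (distr lborel borel ?M) borel ?g"
    by (simp only: lborel_reindex[OF r])
  also have "distr lborel borel ?M = lborel"
    using M by (rule lborel_distr_involution_wellorder) (simp only: gf fg L(2))
  also have "distr lborel borel ?g = lborel"
    using r by (intro lborel_reindex bij_imp_bij_inv)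
  finally show ?thesis .
qed

lemma lborel_distr_involution:
  fixes L :: "real^'n \<Rightarrow> real^'n"
  assumes L: "linear L" "\<And>x. L (L x) = x" and card: "CARD('n) \<in> {2, 3}"
  shows "distr lborel borel (\<lambda>x. L x + a) = lborel"
proof -
  have Lm: "L \<in> borel_measurable borel"
    using L(1) by (intro borel_measurable_continuous_onI linear_continuous_on) (simp add: linear_conv_bounded_linear)
  have d: "distr lborel borel L = lborel"
  \<comment> \<open>The numeral types 2 and 3 serve as well-ordered index types; here the dimension
    enters.\<close>
  proof (cases "CARD('n) = 2")
    case True
    then obtain r :: "2 \<Rightarrow> 'n" where "bij r"
      using finite_same_card_bij[of "UNIV :: 2 set" "UNIV :: 'n set"] by auto
    then show ?thesis by (rule lborel_distr_involution_reindex[OF L])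
  next
    case False
    then obtain r :: "3 \<Rightarrow> 'n" where "bij r"
      using finite_same_card_bij[of "UNIV :: 3 set" "UNIV :: 'n set"] card by auto
    then show ?thesis by (rule lborel_distr_involution_reindex[OF L])
  qed
  have "distr lborel borel (\<lambda>x. L x + a) = distr (distr lborel borel L) borel (\<lambda>x. a + x)"
    using Lm by (subst distr_distr) (auto simp: comp_def add.commute)
  also have "\<dots> = lborel" unfolding d by (rule lborel_distr_plus)
  finally show ?thesis .
qed

text \<open>With one point of \<open>V\<close> as origin the remaining differences are independent,
  so the values extend linearly; the adjoint turns the functional into an inner product.\<close>

lemma affine_interpolation:
  fixes V :: "'a::euclidean_space set" and c :: "'a \<Rightarrow> real"
  assumes "\<not> affine_dependent V"
  obtains m a where "\<And>w. w \<in> V \<Longrightarrow> m \<bullet> w + a = c w"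
proof (cases "V = {}")
  case False
  then obtain v where v: "v \<in> V" by blast
  then have V: "insert v (V - {v}) = V" by blast
  have "independent ((\<lambda>x. - v + x) ` (V - {v}))"
    using affine_dependent_iff_dependent[of v "V - {v}"] assms V by simp
  then obtain g where g: "linear g" "\<And>x. x \<in> (\<lambda>x. - v + x) ` (V - {v}) \<Longrightarrow> g x = c (x + v) - c v"
    using linear_independent_extend[of "(\<lambda>x. - v + x) ` (V - {v})" "\<lambda>x. c (x + v) - c v"] by blast
  have rep: "adjoint g 1 \<bullet> x = g x" for x
    using adjoint_works[OF g(1), of x 1] by (simp add: inner_commute)
  show ?thesis
  proof (rule that[of "adjoint g 1" "c v - g v"])
    fix w assume "w \<in> V"
    have "g (- v + w) = c w - c v"
    proof (cases "w = v")
      case True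
      then show ?thesis using linear_0[OF g(1)] by simp
    next
      case False
      then have "- v + w \<in> (\<lambda>x. - v + x) ` (V - {v})" using \<open>w \<in> V\<close> by blast
      then show ?thesis using g(2) by simp
    qed
    moreover have "g (- v + w) = g w - g v"
      using linear_diff[OF g(1), of w v] by simp
    ultimately show "adjoint g 1 \<bullet> w + (c v - g v) = c w" by (simp add: rep)
  qed
qed (use that in auto)

lemma affine_agree_hull:
  fixes V :: "'a::real_inner set"
  assumes "\<And>w. w \<in> V \<Longrightarrow> m \<bullet> w + a = m' \<bullet> w + a'" "x \<in> convex hull V"
  shows "m \<bullet> x + a = m' \<bullet> x + a'"
proof -
  have "V \<subseteq> {x. (m - m') \<bullet> x = a' - a}"
  proof
    fix w assume "w \<in> V"
    from assms(1)[OF this] show "w \<in> {x. (m - m') \<bullet> x = a' - a}"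
      by (simp add: inner_diff_left)
  qed
  then have "convex hull V \<subseteq> {x. (m - m') \<bullet> x = a' - a}"
    by (intro hull_minimal convex_hyperplane)
  then show ?thesis using assms(2) by (auto simp: inner_diff_left)
qed

text \<open>The affine reflection that exchanges two vertices of the face and fixes the others preserves both
  the prism over the face and Lebesgue measure.\<close>

lemma face_swap:
  fixes e :: "(real^'n) set"
  assumes card: "CARD('n) \<in> {2, 3}" and e: "flat_face e" "e = convex hull V" "\<not> affine_dependent V"
    and uv: "u \<in> V" "v \<in> V" "u \<noteq> v"
    and hull: "affine hull e = {x. unit_normal e \<bullet> x = c}" and n1: "norm (unit_normal e) = 1"
  obtains m a where "m \<bullet> u + a = 1" "m \<bullet> v + a = - 1" "\<And>w. w \<in> V - {u, v} \<Longrightarrow> m \<bullet> w + a = 0"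
    "\<And>g :: real^'n \<Rightarrow> real. continuous_on UNIV g \<Longrightarrow>
       (LINT z:prism e|lborel. g (plane_proj (unit_normal e) c z)) =
       (LINT z:prism e|lborel. g (plane_proj (unit_normal e) c z + (m \<bullet> plane_proj (unit_normal e) c z + a) *\<^sub>R (v - u)))"
proof -
  let ?n = "unit_normal e"
  have nn: "?n \<bullet> ?n = 1" using n1 by (simp add: dot_square_norm)
  obtain m0 a0 where m0: "\<And>w. w \<in> V \<Longrightarrow> m0 \<bullet> w + a0 = (if w = u then 1 else if w = v then -1 else 0)"
    using affine_interpolation[OF e(3), of "\<lambda>w. if w = u then 1 else if w = v then -1 else 0"] by blast
  \<comment> \<open>Removing the normal part of \<open>m0\<close>, with \<open>a\<close>
    compensating on the hyperplane, leaves the values on the face unchanged and makes the swap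
    commute with motion along the normal, so that it maps the prism to itself.\<close>
  define m where "m = m0 - (m0 \<bullet> ?n) *\<^sub>R ?n"
  define a where "a = a0 + (m0 \<bullet> ?n) * c"
  have Ve: "V \<subseteq> e" unfolding e(2) by (rule hull_subset)
  have nV: "?n \<bullet> w = c" if "w \<in> e" for w
    using hull_inc[OF that, of affine] hull by simp
  have ma: "m \<bullet> w + a = (if w = u then 1 else if w = v then -1 else 0)" if "w \<in> V" for w
  proof -
    have "m \<bullet> w + a = m0 \<bullet> w + a0"
      using nV[of w] Ve that by (auto simp: m_def a_def inner_diff_left)
    then show ?thesis using m0[OF that] by simp
  qed
  have mn: "m \<bullet> ?n = 0" by (simp add: m_def inner_diff_left nn)
  have nuv: "?n \<bullet> (v - u) = 0" using nV Ve uv by (auto simp: inner_diff_right)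
  \<comment> \<open>The value -2 is what makes \<open>L\<close> and \<open>S\<close>
    involutions.\<close>
  have muv: "m \<bullet> (v - u) = -2" using ma[OF uv(1)] ma[OF uv(2)] uv(3) by (simp add: inner_diff_right)
  define L where "L x = x + (m \<bullet> x) *\<^sub>R (v - u)" for x
  define S where "S x = x + (m \<bullet> x + a) *\<^sub>R (v - u)" for x
  have SL: "S x = L x + a *\<^sub>R (v - u)" for x by (simp add: S_def L_def algebra_simps)
  have linL: "linear L" unfolding L_def by (rule linearI) (simp_all add: algebra_simps)
  have mL: "m \<bullet> L x = - (m \<bullet> x)" for x
    unfolding L_def by (simp only: inner_add_right inner_scaleR_right muv; simp)
  have LL: "L (L x) = x" for x
  proof -
    have "L (L x) = L x + (m \<bullet> L x) *\<^sub>R (v - u)" by (rule L_def)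
    also have "\<dots> = x" unfolding mL scaleR_minus_left by (simp add: L_def)
    finally show ?thesis .
  qed
  have mS: "m \<bullet> S x + a = - (m \<bullet> x + a)" for x
    unfolding S_def by (simp only: inner_add_right inner_scaleR_right muv; simp)
  have SS: "S (S x) = x" for x
  proof -
    have "S (S x) = S x + (m \<bullet> S x + a) *\<^sub>R (v - u)" by (rule S_def)
    also have "\<dots> = x" unfolding mS scaleR_minus_left by (simp add: S_def)
    finally show ?thesis .
  qed
  have nS: "?n \<bullet> S x = ?n \<bullet> x" for x by (simp add: S_def inner_add_right nuv)
  have Sn: "S (x + t *\<^sub>R ?n) = S x + t *\<^sub>R ?n" for x t
    by (simp add: S_def inner_add_right mn)
  have SV: "S w \<in> V" if "w \<in> V" for w
    using ma[OF that] uv that by (auto simp: S_def)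
  have "convex {x. S x \<in> e}"
  proof (rule convexI)
    fix x y s t assume xy: "x \<in> {x. S x \<in> e}" "y \<in> {x. S x \<in> e}" and st: "0 \<le> s" "0 \<le> t" "s + t = (1::real)"
    have "s *\<^sub>R S x + t *\<^sub>R S y \<in> e" using xy st e(1) by (auto simp: flat_face_def intro: convexD)
    moreover have "S (s *\<^sub>R x + t *\<^sub>R y) = s *\<^sub>R S x + t *\<^sub>R S y"
    proof -
      have "a = (s + t) * a" using st(3) by simp
      then have eq: "m \<bullet> (s *\<^sub>R x + t *\<^sub>R y) + a = s * (m \<bullet> x + a) + t * (m \<bullet> y + a)"
        by (simp only: inner_add_right inner_scaleR_right) (simp add: algebra_simps)
      show ?thesis
        unfolding S_def eq by (simp only: scaleR_add_left[of "s * _"] scaleR_add_right scaleR_scaleR add_ac)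
    qed
    ultimately show "s *\<^sub>R x + t *\<^sub>R y \<in> {x. S x \<in> e}" by simp
  qed
  then have Se: "S x \<in> e" if "x \<in> e" for x
  proof -
    have "convex hull V \<subseteq> {x. S x \<in> e}"
      using SV Ve \<open>convex {x. S x \<in> e}\<close> by (intro hull_minimal) auto
    then show ?thesis using that e(2) by blast
  qed
  have prism1: "S z \<in> prism e" if z: "z \<in> prism e" for z
  proof -
    obtain x t where xt: "z = x + t *\<^sub>R ?n" "x \<in> e" "0 \<le> t" "t \<le> 1" using z by (auto simp: prism_def)
    have "S z = S x + t *\<^sub>R ?n" unfolding xt(1) by (rule Sn)
    then show ?thesis using Se[OF xt(2)] xt(3,4) unfolding prism_def by blast
  qed
  have prism: "S z \<in> prism e \<longleftrightarrow> z \<in> prism e" for z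
    using prism1[of z] prism1[of "S z"] SS by auto
  have pp: "plane_proj ?n c z = z + (c - ?n \<bullet> z) *\<^sub>R ?n" for z
    by (simp add: plane_proj_def algebra_simps)
  have projS: "plane_proj ?n c (S z) = S (plane_proj ?n c z)" for z
    by (simp only: pp nS Sn)
  have Sm: "S \<in> borel_measurable borel"
    unfolding S_def by (intro borel_measurable_continuous_onI continuous_intros)
  have "(\<lambda>x. L x + a *\<^sub>R (v - u)) = S" using SL by auto
  then have dist: "distr lborel borel S = lborel"
    using lborel_distr_involution[OF linL LL card, of "a *\<^sub>R (v - u)"] by simp
  show ?thesis
  proof (rule that[of m a])
    show "m \<bullet> u + a = 1" "m \<bullet> v + a = - 1" using ma[OF uv(1)] ma[OF uv(2)] uv(3) by auto
    show "m \<bullet> w + a = 0" if "w \<in> V - {u, v}" for w using ma[of w] that by auto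
    fix g :: "real^'n \<Rightarrow> real" assume g: "continuous_on UNIV g"
    have [measurable]: "prism e \<in> sets borel"
      using e(1) by (auto simp: flat_face_def intro: borel_compact compact_prism)
    have "continuous_on UNIV (\<lambda>z. g (plane_proj ?n c z))"
      using g continuous_plane_proj by (rule continuous_on_compose2) auto
    then have [measurable]: "(\<lambda>z. g (plane_proj ?n c z)) \<in> borel_measurable borel"
      by (rule borel_measurable_continuous_onI)
    have "(LINT z:prism e|lborel. g (plane_proj ?n c z)) =
        (LINT z|distr lborel borel S. indicator (prism e) z *\<^sub>R g (plane_proj ?n c z))"
      by (simp add: dist set_lebesgue_integral_def)
    also have "\<dots> = (LINT z|lborel. indicator (prism e) (S z) *\<^sub>R g (plane_proj ?n c (S z)))"
      using Sm by (intro integral_distr) (simp, measurable)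
    also have "\<dots> = (LINT z:prism e|lborel. g (S (plane_proj ?n c z)))"
      unfolding set_lebesgue_integral_def by (intro Bochner_Integration.integral_cong) (auto simp: indicator_def prism projS)
    finally show "(LINT z:prism e|lborel. g (plane_proj ?n c z)) =
       (LINT z:prism e|lborel. g (plane_proj ?n c z + (m \<bullet> plane_proj ?n c z + a) *\<^sub>R (v - u)))"
      by (simp add: S_def)
  qed
qed

text \<open>By the swap symmetry all barycentric coordinates of the face have the same integral, so
  an affine function integrates to the area times the mean of its vertex values.\<close>

lemma face_affine_integral:
  fixes e :: "(real^'n) set"
  assumes card: "CARD('n) \<in> {2, 3}" and e: "flat_face e" "e = convex hull V" "\<not> affine_dependent V"
    and f: "\<And>x. x \<in> e \<Longrightarrow> f x = m \<bullet> x + (a::real)"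
  shows "(LINT x|face_measure e. f x) = face_area e * (m \<bullet> barycenter e + a)"
proof -
  obtain c where n1: "norm (unit_normal e) = 1" and hull: "affine hull e = {x. unit_normal e \<bullet> x = c}"
    using flat_face_normal[OF e(1)] by blast
  let ?p = "plane_proj (unit_normal e) c"
  have fin: "finite V" using e(3) by (rule aff_independent_finite)
  have Vne: "V \<noteq> {}" using e(1,2) by (auto simp: flat_face_def)
  define J where "J m a = (LINT z:prism e|lborel. m \<bullet> ?p z + a)" for m :: "real^'n" and a :: real
  have cont: "continuous_on UNIV (\<lambda>x. m \<bullet> x + a)" for m :: "real^'n" and a :: real
    by (intro continuous_intros)
  have int: "set_integrable lborel (prism e) (\<lambda>z. m \<bullet> ?p z + a)" for m :: "real^'n" and a :: real
    by (rule face_measure_integral(3)[OF e(1) hull n1 cont refl])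
  have cong: "J m a = J m' a'" if "\<And>w. w \<in> V \<Longrightarrow> m \<bullet> w + a = m' \<bullet> w + a'" for m a m' a'
    unfolding J_def
  proof (rule set_lebesgue_integral_cong)
    show "prism e \<in> sets lborel"
      using e(1) by (auto simp: flat_face_def intro: borel_compact compact_prism)
    show "\<forall>z. z \<in> prism e \<longrightarrow> m \<bullet> ?p z + a = m' \<bullet> ?p z + a'"
    proof (intro allI impI)
      fix z assume "z \<in> prism e"
      then have "?p z \<in> convex hull V" using face_proj(2)[OF e(1) hull n1] e(2) by auto
      with that show "m \<bullet> ?p z + a = m' \<bullet> ?p z + a'" by (rule affine_agree_hull)
    qed
  qed
  have "\<exists>m a. \<forall>w\<in>V. m \<bullet> w + a = (if w = v then 1 else 0)" for v
    using affine_interpolation[OF e(3), of "\<lambda>w. if w = v then 1 else 0"] by metis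
  \<comment> \<open>The barycentric coordinates, as affine functions on the whole space.\<close>
  then obtain M A where MA: "\<And>v w. w \<in> V \<Longrightarrow> M v \<bullet> w + A v = (if w = v then 1 else (0::real))"
    by metis
  have swap: "J (M u) (A u) = J (M v) (A v)" if uv: "u \<in> V" "v \<in> V" "u \<noteq> v" for u v
  proof -
    obtain m a where ma: "m \<bullet> u + a = 1" "m \<bullet> v + a = - 1" "\<And>w. w \<in> V - {u, v} \<Longrightarrow> m \<bullet> w + a = 0"
      "\<And>g :: real^'n \<Rightarrow> real. continuous_on UNIV g \<Longrightarrow>
       (LINT z:prism e|lborel. g (?p z)) = (LINT z:prism e|lborel. g (?p z + (m \<bullet> ?p z + a) *\<^sub>R (v - u)))"
      using face_swap[OF card e uv hull n1] by blast
    have k: "M u \<bullet> (v - u) = -1"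
      using MA[OF uv(1), of u] MA[OF uv(2), of u] uv(3) by (simp add: inner_diff_right)
    have "J (M u) (A u) = (LINT z:prism e|lborel. M u \<bullet> (?p z + (m \<bullet> ?p z + a) *\<^sub>R (v - u)) + A u)"
      unfolding J_def by (rule ma(4)[OF cont])
    also have "\<dots> = J (M u - m) (A u - a)"
      unfolding J_def by (simp only: inner_add_right inner_scaleR_right k) (simp add: inner_diff_left algebra_simps)
    also have "\<dots> = J (M v) (A v)"
    proof (rule cong)
      fix w assume w: "w \<in> V"
      have "(M u - m) \<bullet> w + (A u - a) = (M u \<bullet> w + A u) - (m \<bullet> w + a)"
        by (simp add: inner_diff_left)
      also have "\<dots> = M v \<bullet> w + A v"
        using MA[OF w, of u] MA[OF w, of v] ma(1,2) ma(3)[of w] w uv(3) by (cases "w = u"; cases "w = v") auto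
      finally show "(M u - m) \<bullet> w + (A u - a) = M v \<bullet> w + A v" .
    qed
    finally show ?thesis .
  qed
  obtain v0 where v0: "v0 \<in> V" using Vne by blast
  define j where "j = J (M v0) (A v0)"
  have j: "J (M w) (A w) = j" if "w \<in> V" for w
    using swap[OF that v0] unfolding j_def by (cases "w = v0") auto
  have formula: "J m a = j * (\<Sum>w\<in>V. m \<bullet> w + a)" for m a
  proof -
    have "J m a = J (\<Sum>w\<in>V. (m \<bullet> w + a) *\<^sub>R M w) (\<Sum>w\<in>V. (m \<bullet> w + a) * A w)"
    proof (rule cong)
      fix y assume y: "y \<in> V"
      have "(\<Sum>w\<in>V. (m \<bullet> w + a) *\<^sub>R M w) \<bullet> y + (\<Sum>w\<in>V. (m \<bullet> w + a) * A w) =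
          (\<Sum>w\<in>V. (m \<bullet> w + a) * (M w \<bullet> y + A w))"
        by (simp add: inner_sum_left sum.distrib[symmetric] algebra_simps)
      also have "\<dots> = (\<Sum>w\<in>V. if w = y then m \<bullet> w + a else 0)"
        using MA[OF y] by (intro sum.cong) auto
      also have "\<dots> = m \<bullet> y + a" using fin y by simp
      finally show "m \<bullet> y + a = (\<Sum>w\<in>V. (m \<bullet> w + a) *\<^sub>R M w) \<bullet> y + (\<Sum>w\<in>V. (m \<bullet> w + a) * A w)" by simp
    qed
    also have "\<dots> = (LINT z:prism e|lborel. \<Sum>w\<in>V. (m \<bullet> w + a) * (M w \<bullet> ?p z + A w))"
      unfolding J_def by (simp add: inner_sum_left sum.distrib[symmetric] algebra_simps)
    also have "\<dots> = (\<Sum>w\<in>V. (m \<bullet> w + a) * J (M w) (A w))"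
      unfolding J_def using int fin by (subst set_integral_sum(2)) auto
    also have "\<dots> = (\<Sum>w\<in>V. (m \<bullet> w + a) * j)" using j by (intro sum.cong) auto
    finally show ?thesis by (simp add: sum_distrib_left mult.commute)
  qed
  have "J 0 1 = measure lborel (prism e)" by (simp add: J_def set_lebesgue_integral_def)
  \<comment> \<open>The constant 1 identifies the common integral as the area divided by the number
    of vertices.\<close>
  then have jc: "j * card V = face_area e" using formula[of 0 1] face_area_eq[OF e(1)] by simp
  have ext: "{v. v extreme_point_of e} = V"
    using extreme_point_of_convex_hull_affine_independent[OF e(3)] e(2) by auto
  have cV: "real (card V) \<noteq> 0" using fin Vne by simp
  have "(LINT x|face_measure e. f x) = J m a"
    unfolding J_def by (rule face_measure_integral(1)[OF e(1) hull n1 cont f])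
  also have "\<dots> = j * card V * (m \<bullet> barycenter e + a)"
    using cV by (simp add: formula barycenter_def ext sum.distrib inner_sum_right field_simps)
  finally show ?thesis by (simp add: jc)
qed

subsection \<open>The Crouzeix--Raviart lifting\<close>

lemma polys_1_iff: "p \<in> polys 1 \<longleftrightarrow> (\<exists>(m::real^'n) a. p = (\<lambda>x. m \<bullet> x + a))"
proof -
  define \<delta> :: "'n \<Rightarrow> 'n \<Rightarrow> nat" where "\<delta> i j = (if j = i then 1 else 0)" for i j
  have sum\<delta>: "(\<Sum>j\<in>UNIV. \<delta> i j) = 1" for i by (simp add: \<delta>_def)
  have idx: "{\<alpha> :: 'n \<Rightarrow> nat. (\<Sum>i\<in>UNIV. \<alpha> i) \<le> 1} = insert (\<lambda>_. 0) (range \<delta>)"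
  proof (intro equalityI subsetI)
    fix \<alpha> :: "'n \<Rightarrow> nat" assume a: "\<alpha> \<in> {\<alpha>. (\<Sum>i\<in>UNIV. \<alpha> i) \<le> 1}"
    show "\<alpha> \<in> insert (\<lambda>_. 0) (range \<delta>)"
    proof (cases "\<alpha> = (\<lambda>_. 0)")
      case False
      then obtain i where i: "\<alpha> i \<noteq> 0" by auto
      have s: "(\<Sum>j\<in>UNIV. \<alpha> j) = \<alpha> i + (\<Sum>j\<in>UNIV - {i}. \<alpha> j)" by (rule sum.remove) auto
      have "(\<Sum>j\<in>UNIV. \<alpha> j) \<le> 1" using a by simp
      then have i1: "\<alpha> i = 1" and "(\<Sum>j\<in>UNIV - {i}. \<alpha> j) = 0" using s i by linarith+
      then have "\<alpha> j = 0" if "j \<noteq> i" for j using that by simp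
      then have "\<alpha> = \<delta> i" using i1 by (auto simp: \<delta>_def)
      then show ?thesis by blast
    qed simp
  qed (auto simp: sum\<delta>)
  have inj: "inj \<delta>" by (rule injI) (metis \<delta>_def one_neq_zero)
  have notin: "(\<lambda>_. 0) \<notin> range \<delta>" by (auto simp: \<delta>_def fun_eq_iff) (metis zero_neq_one)
  have prod: "(\<Prod>j\<in>UNIV. (x $ j) ^ \<delta> i j) = x $ i" for i and x :: "real^'n"
  proof -
    have "(\<Prod>j\<in>UNIV. (x $ j) ^ \<delta> i j) = (\<Prod>j\<in>UNIV. if j = i then x $ j else 1)"
      by (intro prod.cong) (auto simp: \<delta>_def)
    then show ?thesis by simp
  qed
  have formula: "(\<Sum>\<alpha> | (\<Sum>i\<in>UNIV. \<alpha> i) \<le> 1. c \<alpha> * (\<Prod>i\<in>UNIV. (x $ i) ^ \<alpha> i)) =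
      c (\<lambda>_. 0) + (\<Sum>i\<in>UNIV. c (\<delta> i) * x $ i)" for c and x :: "real^'n"
    unfolding idx using notin by (simp add: sum.reindex[OF inj] prod comp_def)
  show ?thesis
  proof
    assume "p \<in> polys 1"
    then obtain c where "p = (\<lambda>x. \<Sum>\<alpha> | (\<Sum>i\<in>UNIV. \<alpha> i) \<le> 1. c \<alpha> * (\<Prod>i\<in>UNIV. (x $ i) ^ \<alpha> i))"
      unfolding polys_def by blast
    then have "p = (\<lambda>x. c (\<lambda>_. 0) + (\<Sum>i\<in>UNIV. c (\<delta> i) * x $ i))"
      by (simp only: formula)
    then have "p = (\<lambda>x. (\<chi> i. c (\<delta> i)) \<bullet> x + c (\<lambda>_. 0))"
      by (simp add: inner_vec_def add.commute)
    then show "\<exists>(m::real^'n) a. p = (\<lambda>x. m \<bullet> x + a)" by blast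
  next
    assume "\<exists>(m::real^'n) a. p = (\<lambda>x. m \<bullet> x + a)"
    then obtain m a where p: "p = (\<lambda>x::real^'n. m \<bullet> x + a)" by blast
    define c where "c \<alpha> = (if \<alpha> = (\<lambda>_. 0) then a else m $ (inv \<delta> \<alpha>))" for \<alpha>
    have "\<delta> i \<noteq> (\<lambda>_. 0)" for i using notin by (metis rangeI)
    then have "c (\<delta> i) = m $ i" for i using inj by (simp add: c_def)
    then have "p = (\<lambda>x. \<Sum>\<alpha> | (\<Sum>i\<in>UNIV. \<alpha> i) \<le> 1. c \<alpha> * (\<Prod>i\<in>UNIV. (x $ i) ^ \<alpha> i))"
      unfolding formula p by (auto simp: c_def inner_vec_def add.commute)
    then show "p \<in> polys 1" unfolding polys_def by blast
  qed
qed

lemma facet_vertices: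
  fixes K :: "'a::euclidean_space set"
  assumes "int DIM('a) simplex K" "e facet_of K"
  obtains V u where "\<not> affine_dependent V" "K = convex hull V" "card V = DIM('a) + 1" "finite V"
    "u \<in> V" "e = convex hull (V - {u})" "\<not> affine_dependent (V - {u})" "{v. v extreme_point_of e} = V - {u}"
proof -
  obtain V where V: "\<not> affine_dependent V" "int (card V) = int DIM('a) + 1" "K = convex hull V"
    using assms(1) unfolding simplex_def by blast
  then obtain u where u: "u \<in> V" "e = convex hull (V - {u})"
    using assms(2) facet_of_convex_hull_affine_independent[OF V(1)] by blast
  have ind: "\<not> affine_dependent (V - {u})"
    using V(1) by (meson Diff_subset affine_independent_subset)
  have "{v. v extreme_point_of e} = V - {u}"
    using extreme_point_of_convex_hull_affine_independent[OF ind] u(2) by auto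
  moreover have "finite V" using V(1) by (rule aff_independent_finite)
  ultimately show ?thesis using that[of V u] V u ind by auto
qed

text \<open>With \<open>c v = (\<Sum>w. \<mu> w) - d * \<mu> v\<close>, the mean of the vertex values \<open>c w\<close> over \<open>w \<noteq> v\<close> is \<open>\<mu> v\<close>.\<close>

lemma affine_facet_values:
  fixes K :: "(real^'n) set"
  assumes "int CARD('n) simplex K"
  shows "\<exists>m a. \<forall>e. e facet_of K \<longrightarrow> m \<bullet> barycenter e + a = (\<mu> e :: real)"
proof -
  obtain V where V: "\<not> affine_dependent V" "int (card V) = int CARD('n) + 1" "K = convex hull V"
    using assms unfolding simplex_def by blast
  have fin: "finite V" using V(1) by (rule aff_independent_finite)
  define \<nu> where "\<nu> v = \<mu> (convex hull (V - {v}))" for v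
  define S where "S = (\<Sum>w\<in>V. \<nu> w)"
  obtain m a where ma: "\<And>w. w \<in> V \<Longrightarrow> m \<bullet> w + a = S - CARD('n) * \<nu> w"
    using affine_interpolation[OF V(1), of "\<lambda>w. S - CARD('n) * \<nu> w"] by blast
  have cV: "real (card V) = real CARD('n) + 1" using V(2) by linarith
  have total: "(\<Sum>w\<in>V. m \<bullet> w + a) = S"
  proof -
    have "(\<Sum>w\<in>V. m \<bullet> w + a) = (\<Sum>w\<in>V. S - CARD('n) * \<nu> w)" using ma by (intro sum.cong) auto
    also have "\<dots> = card V * S - CARD('n) * S" by (simp add: sum_subtractf S_def sum_distrib_left)
    also have "\<dots> = S" unfolding cV by (simp add: algebra_simps)
    finally show ?thesis .
  qed
  have "m \<bullet> barycenter e + a = \<mu> e" if e: "e facet_of K" for e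
  proof -
    obtain v where v: "v \<in> V" "e = convex hull (V - {v})"
      using e facet_of_convex_hull_affine_independent[OF V(1)] V(3) by blast
    have ind: "\<not> affine_dependent (V - {v})"
      using V(1) by (meson Diff_subset affine_independent_subset)
    have ext: "{w. w extreme_point_of e} = V - {v}"
      using extreme_point_of_convex_hull_affine_independent[OF ind] v(2) by auto
    have card: "real (card (V - {v})) = CARD('n)" using cV v(1) fin by simp
    have "(\<Sum>w\<in>V - {v}. m \<bullet> w + a) = CARD('n) * \<nu> v"
      using total sum.remove[OF fin v(1), of "\<lambda>w. m \<bullet> w + a"] ma[OF v(1)] by simp
    then have "CARD('n) * (m \<bullet> barycenter e + a) = CARD('n) * \<nu> v"
      using card by (simp add: barycenter_def ext inner_sum_right sum.distrib algebra_simps)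
    then show ?thesis by (simp add: \<nu>_def v(2))
  qed
  then show ?thesis by blast
qed

lemma outward_normal_eq:
  fixes K :: "(real^'n) set"
  assumes n: "norm n = 1" "\<And>x. x \<in> K \<Longrightarrow> n \<bullet> x \<le> c" and hull: "affine hull e = {x. n \<bullet> x = c}"
    and "e \<subseteq> K" "e \<noteq> {}" and a: "a \<in> K" "n \<bullet> a < c"
  shows "outward_normal K e = n"
  unfolding outward_normal_def
proof (rule the_equality)
  have ne: "n \<bullet> y = c" if "y \<in> e" for y using hull_inc[OF that, of affine] hull by simp
  show "norm n = 1 \<and> (\<forall>x\<in>K. \<forall>y\<in>e. n \<bullet> (x - y) \<le> 0)"
    using n ne by (simp add: inner_diff_right)
  fix m assume m: "norm m = 1 \<and> (\<forall>x\<in>K. \<forall>y\<in>e. m \<bullet> (x - y) \<le> 0)"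
  have "m \<bullet> (x - y) = 0" if "x \<in> e" "y \<in> e" for x y
  proof -
    have "m \<bullet> (x - y) \<le> 0" "m \<bullet> (y - x) \<le> 0" using m that assms(4) by blast+
    then show ?thesis by (simp add: inner_diff_right)
  qed
  then have "m = n \<or> m = - n" using unit_normal_unique[OF hull n(1)] m by blast
  \<comment> \<open>The point \<open>a\<close>, strictly on the inner side, decides the
    sign.\<close>
  moreover have "m \<noteq> - n"
  proof
    assume "m = - n"
    obtain y where y: "y \<in> e" using assms(5) by blast
    then have "m \<bullet> (a - y) \<le> 0" using m a(1) by blast
    then show False using \<open>m = - n\<close> ne[OF y] a(2) by (simp add: inner_diff_right)
  qed
  ultimately show "m = n" by blast
qed

text \<open>The values at the barycenters of the facets can be prescribed on each element
  separately. The jump condition is then automatic: an affine function integrates over a face to the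
  area times its barycenter value, which is \<open>\<mu> e\<close> from both sides.\<close>

lemma CR_lift_spec:
  fixes \<Omega> :: "(real^'n) set"
  assumes card: "CARD('n) \<in> {2, 3}" and mesh: "uniform_mesh T h \<theta>" and \<Omega>: "polyhedral_domain \<Omega>" and T: "\<Union>T = closure \<Omega>"
  shows "CR_lift \<Omega> T \<mu> \<in> CR_space \<Omega> T \<and>
    (\<forall>e\<in>faces T. \<forall>K\<in>T. e facet_of K \<longrightarrow> CR_lift \<Omega> T \<mu> K (barycenter e) = \<mu> e)"
proof -
  interpret uniform_mesh T h \<theta> by fact
  have simp': "int CARD('n) simplex K" if "K \<in> T" for K using full_dim[OF that] by simp
  have "\<forall>K\<in>T. \<exists>ma. \<forall>e. e facet_of K \<longrightarrow> fst ma \<bullet> barycenter e + snd ma = \<mu> e"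
    using affine_facet_values[OF simp'] by fastforce
  from bchoice[OF this] obtain ma where
    ma: "\<And>K e. K \<in> T \<Longrightarrow> e facet_of K \<Longrightarrow> fst (ma K) \<bullet> barycenter e + snd (ma K) = \<mu> e" by blast
  define f where "f K x = fst (ma K) \<bullet> x + snd (ma K)" for K x
  have "f \<in> U_space 1 T"
    unfolding U_space_def f_def using polys_1_iff by fastforce
  have int: "(LINT x|face_measure e. f K x) = face_area e * \<mu> e" if K: "K \<in> T" "e facet_of K" for K e
  proof -
    obtain V u where V: "e = convex hull (V - {u})" "\<not> affine_dependent (V - {u})"
      using facet_vertices[OF full_dim[OF K(1)] K(2)] by metis
    show ?thesis
      using face_affine_integral[OF card flat_faceI[OF mesh K] V, of "f K" "fst (ma K)" "snd (ma K)"] ma[OF K]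
      by (simp add: f_def)
  qed
  have "(LINT x|face_measure e. jump T f e x) = 0" if e: "e \<in> interior_faces \<Omega> T" for e
  proof -
    obtain K where K: "K \<in> T" "e facet_of K" and nb: "\<not> e \<subseteq> frontier \<Omega>"
      using e by (auto simp: interior_faces_def boundary_faces_def faces_def)
    have op: "open \<Omega>" using \<Omega> by (simp add: polyhedral_domain_def)
    have "e \<subseteq> closure \<Omega>" using facet_of_imp_subset[OF K(2)] K(1) T by blast
    then obtain y where y: "y \<in> e" "y \<in> \<Omega>"
      using nb op by (auto simp: frontier_def interior_open)
    \<comment> \<open>An open set that meets the convex set \<open>e\<close> meets its relative
      interior; this provides the point of \<open>\<Omega>\<close> at which
      \<open>interior_facet_neighbour\<close> applies.\<close>
    have "convex e" by (rule face_of_imp_convex[OF facet_of_imp_face_of[OF K(2)]])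
    then have "y \<in> closure (rel_interior e)"
      using y(1) closure_subset convex_closure_rel_interior by blast
    then obtain x where x: "x \<in> rel_interior e" "x \<in> \<Omega>"
      using op y(2) open_Int_closure_eq_empty[OF op, of "rel_interior e"] by blast
    have "x \<in> interior (\<Union>T)"
      unfolding T polyhedral_domain_interior_closure[OF \<Omega>] by (rule x(2))
    then obtain L where L: "L \<in> T" "L \<noteq> K" "e facet_of L"
      using interior_facet_neighbour[OF K x(1)] by blast
    have set: "{M \<in> T. e facet_of M} = {K, L}"
      using K L at_most_two_elements[OF K(1) L(1) _ L(2)[symmetric] K(2) L(3)] by auto
    obtain n c where n: "norm n = 1" "\<And>x. x \<in> K \<Longrightarrow> n \<bullet> x \<le> c" "affine hull e = {x. n \<bullet> x = c}"
      "\<And>x. x \<in> interior K \<Longrightarrow> n \<bullet> x < c"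
      using facet_normal[OF K] by blast
    have gt: "\<And>x. x \<in> interior L \<Longrightarrow> n \<bullet> x > c"
      using opposite_sides[OF K(1) L(1) L(2)[symmetric] K(2) L(3) n(1,3,4)] by blast
    obtain a b where ab: "a \<in> interior K" "b \<in> interior L"
      using interior_element_nonempty K(1) L(1) by blast
    have ne: "e \<noteq> {}" using K(2) by (simp add: facet_of_def)
    have nK: "outward_normal K e = n"
      using outward_normal_eq[OF n(1,2,3) facet_of_imp_subset[OF K(2)] ne] ab(1) n(4) interior_subset by blast
    have leL: "(- n) \<bullet> x \<le> - c" if "x \<in> L" for x
    proof -
      have "L \<subseteq> closure (interior L)"
        using convex_closure_interior[OF convex_element[OF L(1)] interior_element_nonempty[OF L(1)]] closure_subset by blast
      moreover have "closure (interior L) \<subseteq> {x. n \<bullet> x \<ge> c}"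
        using gt by (intro closure_minimal closed_halfspace_ge) (auto simp: less_imp_le)
      ultimately show ?thesis using that by auto
    qed
    have nL: "outward_normal L e = - n"
    proof (rule outward_normal_eq[OF _ leL _ facet_of_imp_subset[OF L(3)] ne, of b])
      show "b \<in> L" using ab(2) interior_subset by blast
      show "(- n) \<bullet> b < - c" using gt[OF ab(2)] by simp
    qed (use n(1,3) in auto)
    have jmp: "jump T f e x = (f K x - f L x) *\<^sub>R n" for x
      using L(2) by (simp add: jump_def set nK nL scaleR_diff_left)
    have intg: "integrable (face_measure e) (f M)" if "M \<in> {K, L}" for M
      unfolding f_def
      by (rule face_measure_integrable[OF flat_faceI[OF mesh K] _ refl]) (intro continuous_intros)
    have "(LINT x|face_measure e. jump T f e x) = (LINT x|face_measure e. f K x - f L x) *\<^sub>R n"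
      unfolding jmp using intg by (intro integral_scaleR_left) auto
    also have "(LINT x|face_measure e. f K x - f L x) = 0"
      using intg int[OF K] int[OF L(1,3)] by (subst Bochner_Integration.integral_diff) auto
    finally show ?thesis by simp
  qed
  then have "f \<in> CR_space \<Omega> T" using \<open>f \<in> U_space 1 T\<close> by (simp add: CR_space_def)
  moreover have "\<forall>e\<in>faces T. \<forall>K\<in>T. e facet_of K \<longrightarrow> f K (barycenter e) = \<mu> e"
    using ma by (simp add: f_def)
  ultimately show ?thesis
    unfolding CR_lift_def
    by (rule someI[of "\<lambda>f. f \<in> CR_space \<Omega> T \<and> (\<forall>e\<in>faces T. \<forall>K\<in>T. e facet_of K \<longrightarrow> f K (barycenter e) = \<mu> e)", OF conjI])
qed

subsection \<open>Faces of a mesh of the domain\<close>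

text \<open>Quasi-uniformity allows each diameter to be replaced by the largest one in the volume
  bound of shape regularity. \<open>max A 1\<close> is positive whatever the value of
  \<open>A\<close>.\<close>

lemma uniform_mesh_of:
  fixes \<Omega> :: "(real^'n) set"
  assumes mesh: "mesh_of \<Omega> T" and sr: "shape_regular \<kappa> T" and qu: "quasi_uniform A T" and \<kappa>: "\<kappa> > 0"
    and \<Omega>: "polyhedral_domain \<Omega>"
  shows "uniform_mesh T (mesh_size T) (\<kappa> / max A 1 ^ CARD('n)) \<and> mesh_size T \<le> diameter (closure \<Omega>) \<and> \<Union>T = closure \<Omega>"
proof -
  have T: "triangulation T" "\<And>K. K \<in> T \<Longrightarrow> int CARD('n) simplex K" "\<Union>T = closure \<Omega>"
    using mesh by (auto simp: mesh_of_def)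
  have fin: "finite T" using T(1) by (simp add: triangulation_def)
  have "T \<noteq> {}"
  proof
    assume "T = {}"
    then have "closure \<Omega> = {}" using T(3) by simp
    then show False using \<Omega> closure_subset[of \<Omega>] by (simp add: polyhedral_domain_def)
  qed
  have bnd: "bounded K" if "K \<in> T" for K
    using compact_simplex[OF T(2)[OF that]] compact_imp_bounded by blast
  have clb: "bounded (closure \<Omega>)" using \<Omega> by (simp add: polyhedral_domain_def bounded_closure)
  have pos: "diameter K > 0" if "K \<in> T" for K
  proof (rule ccontr)
    assume "\<not> diameter K > 0"
    then have d0: "diameter K = 0" using diameter_ge_0[OF bnd[OF that]] by simp
    \<comment> \<open>Division by zero yields 0, so an element of diameter 0 would contradict
      \<open>\<kappa> > 0\<close>.\<close>
    have "\<kappa> \<le> measure lborel K / diameter K ^ CARD('n)" using sr that by (simp add: shape_regular_def)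
    then show False using \<kappa> by (simp add: d0 zero_power)
  qed
  have le: "diameter K \<le> mesh_size T" if "K \<in> T" for K
    unfolding mesh_size_def using fin that by (intro Max_ge) auto
  have "mesh_size T \<in> diameter ` T" unfolding mesh_size_def using fin \<open>T \<noteq> {}\<close> by (intro Max_in) auto
  then obtain K0 where K0: "K0 \<in> T" "mesh_size T = diameter K0" by blast
  have "uniform_mesh T (mesh_size T) (\<kappa> / max A 1 ^ CARD('n))"
  proof
    show "triangulation T" by (rule T(1))
    show "int DIM(real^'n) simplex K" if "K \<in> T" for K using T(2)[OF that] by simp
    show "mesh_size T > 0" using pos[OF K0(1)] K0(2) by simp
    show "0 < \<kappa> / max A 1 ^ CARD('n)" using \<kappa> by simp
    show "dist x y \<le> mesh_size T" if "K \<in> T" "x \<in> K" "y \<in> K" for K x y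
      using diameter_bounded_bound[OF bnd[OF that(1)] that(2,3)] le[OF that(1)] by linarith
    show "\<kappa> / max A 1 ^ CARD('n) * mesh_size T ^ DIM(real^'n) \<le> measure lborel K" if "K \<in> T" for K
    proof -
      have "mesh_size T / diameter K \<le> A" using qu K0 that by (simp add: quasi_uniform_def)
      also have "A \<le> max A 1" by simp
      finally have "mesh_size T \<le> max A 1 * diameter K" using pos[OF that] by (simp add: field_simps)
      then have "mesh_size T ^ CARD('n) \<le> (max A 1 * diameter K) ^ CARD('n)"
        using pos[OF K0(1)] K0(2) by (intro power_mono) auto
      then have "mesh_size T ^ CARD('n) / max A 1 ^ CARD('n) \<le> diameter K ^ CARD('n)"
        by (simp add: power_mult_distrib field_simps)
      then have "\<kappa> * (mesh_size T ^ CARD('n) / max A 1 ^ CARD('n)) \<le> \<kappa> * diameter K ^ CARD('n)"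
        using \<kappa> by (intro mult_left_mono) auto
      also have "\<dots> \<le> measure lborel K"
      proof -
        have "\<kappa> \<le> measure lborel K / diameter K ^ CARD('n)" using sr that by (simp add: shape_regular_def)
        then show ?thesis using pos[OF that] by (simp add: pos_le_divide_eq)
      qed
      finally show ?thesis by simp
    qed
  qed
  moreover have "mesh_size T \<le> diameter (closure \<Omega>)"
    unfolding K0(2) using K0(1) T(3) clb by (intro diameter_subset) auto
  ultimately show ?thesis using T(3) by blast
qed

text \<open>A second element at \<open>e\<close> would put a relative interior point of
  \<open>e\<close> into the interior of the closure, which is \<open>\<Omega>\<close>, whereas
  \<open>e\<close> lies on the frontier.\<close>

lemma boundary_face_element:
  fixes \<Omega> :: "(real^'n) set"
  assumes mesh: "uniform_mesh T h \<theta>" and \<Omega>: "polyhedral_domain \<Omega>" and T: "\<Union>T = closure \<Omega>"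
    and e: "e \<in> boundary_faces \<Omega> T"
  shows "(THE K. K \<in> T \<and> e facet_of K) \<in> T \<and> e facet_of (THE K. K \<in> T \<and> e facet_of K)"
proof (rule theI')
  interpret uniform_mesh T h \<theta> by fact
  obtain K where K: "K \<in> T" "e facet_of K" and fr: "e \<subseteq> frontier \<Omega>"
    using e by (auto simp: boundary_faces_def faces_def)
  have "L = K" if L: "L \<in> T" "e facet_of L" for L
  proof (rule ccontr)
    assume "L \<noteq> K"
    obtain x where x: "x \<in> rel_interior e" using rel_interior_facet_nonempty[OF K] .
    have "x \<in> interior (L \<union> K)" using shared_facet_interior[OF L(1) K(1) \<open>L \<noteq> K\<close> L(2) K(2) x] .
    also have "\<dots> \<subseteq> interior (closure \<Omega>)" unfolding T[symmetric] using L K by (intro interior_mono) blast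
    also have "\<dots> = \<Omega>" by (rule polyhedral_domain_interior_closure[OF \<Omega>])
    finally have "x \<in> \<Omega>" .
    moreover have "x \<in> frontier \<Omega>" using x rel_interior_subset fr by blast
    ultimately show False using \<Omega> by (simp add: frontier_def polyhedral_domain_def interior_open)
  qed
  then show "\<exists>!K. K \<in> T \<and> e facet_of K" using K by blast
qed

text \<open>The prism over a face of diameter at most \<open>h\<close> lies in a tube of width
  \<open>h\<close> around a segment of length 1, whose volume is of order h to the power d -
  1.\<close>

lemma face_area_le:
  fixes e :: "(real^'n) set"
  assumes "flat_face e" "h > 0" "\<And>x y. x \<in> e \<Longrightarrow> y \<in> e \<Longrightarrow> dist x y \<le> h"
  shows "h * face_area e \<le> (1 + 3 * h) * unit_ball_vol (real CARD('n)) * 2 ^ CARD('n) * h ^ CARD('n)"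
proof -
  obtain c where n1: "norm (unit_normal e) = 1" using flat_face_normal[OF assms(1)] by blast
  obtain x where x: "x \<in> e" using assms(1) by (auto simp: flat_face_def)
  obtain I a where I: "finite (I::nat set)" "h * card I \<le> norm (unit_normal e) + 3 * h"
    and cov: "\<And>y s. \<lbrakk>0 \<le> s; s \<le> 1; dist y (x + s *\<^sub>R unit_normal e) \<le> h\<rbrakk> \<Longrightarrow> y \<in> (\<Union>i\<in>I. cball (a i) (2 * h))"
    using segment_nbhd_cover[OF assms(2), of "unit_normal e" x] by metis
  have sub: "prism e \<subseteq> (\<Union>i\<in>I. cball (a i) (2 * h))"
  proof
    fix z assume "z \<in> prism e"
    then obtain y t where y: "z = y + t *\<^sub>R unit_normal e" "y \<in> e" "0 \<le> t" "t \<le> 1" by (auto simp: prism_def)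
    then have "dist z (x + t *\<^sub>R unit_normal e) \<le> h" using assms(3)[OF y(2) x] by (simp add: dist_norm)
    then show "z \<in> (\<Union>i\<in>I. cball (a i) (2 * h))" using cov y by blast
  qed
  have comp: "compact (prism e)" using assms(1) by (auto simp: flat_face_def intro: compact_prism)
  have "face_area e = measure lborel (prism e)" by (rule face_area_eq[OF assms(1)])
  also have "\<dots> \<le> measure lborel (\<Union>i\<in>I. cball (a i) (2 * h))"
    using comp I(1) sub by (intro measure_mono_fmeasurable) (auto intro!: fmeasurable.finite_UN intro: fmeasurable_compact borel_compact)
  also have "\<dots> \<le> (\<Sum>i\<in>I. measure lborel (cball (a i) (2 * h)))"
    using I(1) by (intro measure_UNION_le) auto
  also have "\<dots> = card I * (unit_ball_vol (real CARD('n)) * (2 * h) ^ CARD('n))"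
    using assms(2) by (simp add: content_cball)
  finally have "h * face_area e \<le> (h * card I) * (unit_ball_vol (real CARD('n)) * (2 * h) ^ CARD('n))"
    using assms(2) by (simp add: mult_ac)
  also have "\<dots> \<le> (1 + 3 * h) * (unit_ball_vol (real CARD('n)) * (2 * h) ^ CARD('n))"
    using I(2) n1 assms(2) by (intro mult_right_mono) auto
  finally show ?thesis by (simp add: power_mult_distrib mult_ac)
qed

lemma facet_area_le:
  fixes K :: "(real^'n) set"
  assumes "uniform_mesh T h \<theta>" "K \<in> T" "e facet_of K" "h \<le> D"
  shows "h * face_area e \<le> (1 + 3 * D) * unit_ball_vol (real CARD('n)) * 2 ^ CARD('n) * h ^ CARD('n)"
proof -
  interpret uniform_mesh T h \<theta> by fact
  have "dist x y \<le> h" if "x \<in> e" "y \<in> e" for x y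
    using dist_le[OF assms(2)] facet_of_imp_subset[OF assms(3)] that by blast
  from face_area_le[OF flat_faceI[OF assms(1-3)] h_pos this]
  have "h * face_area e \<le> (1 + 3 * h) * unit_ball_vol (real CARD('n)) * 2 ^ CARD('n) * h ^ CARD('n)" by blast
  also have "\<dots> \<le> (1 + 3 * D) * unit_ball_vol (real CARD('n)) * 2 ^ CARD('n) * h ^ CARD('n)"
    using assms(4) h_pos by (intro mult_right_mono) auto
  finally show ?thesis .
qed

text \<open>Coplanar faces receive the same one of the two normals, so their prisms point to the
  same side and can be compared as sets.\<close>

lemma unit_normal_cong:
  assumes "affine hull e = affine hull e'"
  shows "unit_normal e = unit_normal e'"
proof -
  have sub: "\<forall>x\<in>f. \<forall>y\<in>f. n \<bullet> (x - y) = 0"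
    if perp: "\<forall>x\<in>e. \<forall>y\<in>e. n \<bullet> (x - y) = 0" and hull: "affine hull e = affine hull f" for n and e f :: "(real^'n) set"
  proof (cases "e = {}")
    case True
    then have "f = {}" using hull affine_hull_eq_empty by metis
    then show ?thesis by simp
  next
    case False
    then obtain z where z: "z \<in> e" by blast
    have "n \<bullet> x = n \<bullet> z" if "x \<in> e" for x
    proof -
      have "n \<bullet> (x - z) = 0" using perp that z by blast
      then show ?thesis by (simp add: inner_diff_right)
    qed
    then have "e \<subseteq> {x. n \<bullet> x = n \<bullet> z}" by blast
    then have "affine hull e \<subseteq> {x. n \<bullet> x = n \<bullet> z}" by (intro hull_minimal affine_hyperplane)
    then have "f \<subseteq> {x. n \<bullet> x = n \<bullet> z}" using hull hull_subset[of f affine] by blast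
    then have "n \<bullet> x = n \<bullet> z" if "x \<in> f" for x using that by blast
    then show ?thesis by (simp add: inner_diff_right)
  qed
  have "(norm n = 1 \<and> (\<forall>x\<in>e. \<forall>y\<in>e. n \<bullet> (x - y) = 0)) \<longleftrightarrow> (norm n = 1 \<and> (\<forall>x\<in>e'. \<forall>y\<in>e'. n \<bullet> (x - y) = 0))" for n
    using sub[of e n e'] sub[of e' n e] assms by blast
  then show ?thesis unfolding unit_normal_def by simp
qed

text \<open>The faces that are not coplanar with \<open>e0\<close> only cover a negligible part of it.\<close>

lemma face_area_cover:
  fixes e0 :: "(real^'n) set"
  assumes e0: "flat_face e0" and G: "finite G" "\<And>e. e \<in> G \<Longrightarrow> flat_face e" and cover: "e0 \<subseteq> \<Union>G"
  shows "face_area e0 \<le> (\<Sum>e\<in>G. face_area e)"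
proof -
  let ?n = "unit_normal e0"
  let ?G = "{e \<in> G. affine hull e = affine hull e0}"
  \<comment> \<open>A face spanning another hyperplane meets \<open>e0\<close> in dimension at most
    \<open>d - 2\<close>; otherwise the intersection would span both hyperplanes.\<close>
  have low: "aff_dim (e \<inter> e0) + 2 \<le> int DIM(real^'n)" if e: "e \<in> G" "affine hull e \<noteq> affine hull e0" for e
  proof (rule ccontr)
    assume no: "\<not> ?thesis"
    have "affine hull (e \<inter> e0) = affine hull f" if f: "flat_face f" "e \<inter> e0 \<subseteq> f" for f
    proof (rule affine_dim_equal)
      show "affine hull (e \<inter> e0) \<subseteq> affine hull f" using f(2) by (rule hull_mono)
      have le: "aff_dim (e \<inter> e0) \<le> aff_dim f" using f(2) by (rule aff_dim_subset)
      then show "aff_dim (affine hull (e \<inter> e0)) = aff_dim (affine hull f)"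
        using no f(1) by (simp add: flat_face_def)
      have "CARD('n) \<ge> 1" by (simp add: Suc_le_eq)
      then have "e \<inter> e0 \<noteq> {}" using no by (auto simp del: One_nat_def)
      then show "affine hull (e \<inter> e0) \<noteq> {}" by simp
    qed auto
    from this[OF G(2)[OF e(1)]] this[OF e0] show False using e(2) by simp
  qed
  define N where "N = (\<Union>e\<in>G - ?G. {x + t *\<^sub>R ?n | x t. x \<in> e \<inter> e0})"
  have "negligible N"
    unfolding N_def using G(1) low by (intro negligible_UN_finite negligible_line_sweep) auto
  have sub: "z \<in> (\<Union>e\<in>?G. prism e)" if z: "z \<in> prism e0" "z \<notin> N" for z
  proof -
    obtain x t where x: "z = x + t *\<^sub>R ?n" "x \<in> e0" "0 \<le> t" "t \<le> 1" using z(1) by (auto simp: prism_def)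
    obtain e where e: "e \<in> G" "x \<in> e" using cover x(2) by blast
    have "affine hull e = affine hull e0"
    proof (rule ccontr)
      assume "affine hull e \<noteq> affine hull e0"
      then have "e \<in> G - ?G" "z \<in> {x + t *\<^sub>R ?n | x t. x \<in> e \<inter> e0}" using e x by blast+
      then have "z \<in> N" unfolding N_def by blast
      then show False using z(2) by blast
    qed
    moreover from unit_normal_cong[OF this] have "z \<in> prism e"
      unfolding prism_def using x e(2) by auto
    ultimately show ?thesis using e(1) by blast
  qed
  have comp: "compact (prism e)" if "flat_face e" for e :: "(real^'n) set"
    using that by (auto simp: flat_face_def intro: compact_prism)
  have fm: "(\<Union>e\<in>?G. prism e) \<in> fmeasurable lborel"
    using G comp by (intro fmeasurable.finite_UN fmeasurable_compact) auto
  have "emeasure lborel (prism e0) \<le> emeasure lborel (\<Union>e\<in>?G. prism e)"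
  proof (rule emeasure_mono_AE)
    show "AE z in lborel. z \<in> prism e0 \<longrightarrow> z \<in> (\<Union>e\<in>?G. prism e)"
      using AE_lborel_not_in[OF \<open>negligible N\<close>] by (rule AE_mp) (use sub in \<open>intro AE_I2, blast\<close>)
    show "(\<Union>e\<in>?G. prism e) \<in> sets lborel" using fm by (rule fmeasurableD)
  qed
  then have "measure lborel (prism e0) \<le> measure lborel (\<Union>e\<in>?G. prism e)"
    unfolding measure_def using fm by (intro enn2real_mono) (auto simp: fmeasurable_def)
  also have "\<dots> \<le> (\<Sum>e\<in>?G. measure lborel (prism e))"
    using G comp by (intro measure_UNION_le) (auto intro: fmeasurableD fmeasurable_compact borel_compact)
  also have "\<dots> = (\<Sum>e\<in>?G. face_area e)" using G(2) by (intro sum.cong) (simp_all add: face_area_eq)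
  also have "\<dots> \<le> (\<Sum>e\<in>G. face_area e)" using G(1) by (intro sum_mono2) (auto intro: face_area_nonneg)
  finally show ?thesis using face_area_eq[OF e0] by simp
qed

text \<open>On a space of measure 0 the mean is 0 by division by zero, and the integral is 0 as
  well.\<close>

lemma measure_times_mean:
  fixes f :: "'a \<Rightarrow> real"
  assumes "integrable M (\<lambda>_. 1::real)"
  shows "measure M (space M) * (1 / measure M (space M) * (LINT x|M. f x)) = (LINT x|M. f x)"
proof (cases "measure M (space M) = 0")
  case True
  have "emeasure M (space M) \<noteq> \<infinity>"
    using assms by (simp add: integrable_iff_bounded less_top)
  then have "emeasure M (space M) = 0" using True by (simp add: measure_def enn2real_eq_0_iff)
  then have "AE x in M. f x = 0" by (intro AE_I'[of "space M"]) auto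
  then have "(LINT x|M. f x) = 0" by (rule integral_eq_zero_AE)
  then show ?thesis using True by simp
qed simp

text \<open>The integral of the square is the squared deviation from the mean plus the measure times
  the squared mean, and the mean is the best constant.\<close>

lemma integral_square_le_mean:
  fixes f :: "'a \<Rightarrow> real"
  assumes M: "integrable M (\<lambda>_. 1::real)" and f: "integrable M f" "integrable M (\<lambda>x. (f x)\<^sup>2)"
  shows "(LINT x|M. (f x)\<^sup>2) \<le> (LINT x|M. (f x - c)\<^sup>2) + measure M (space M) * (1 / measure M (space M) * (LINT x|M. f x))\<^sup>2"
proof -
  define A where "A = measure M (space M)"
  define \<mu> where "\<mu> = 1 / A * (LINT x|M. f x)"
  define F where "F = (LINT x|M. (f x)\<^sup>2)"
  define X where "X = (LINT x|M. (f x - c)\<^sup>2)"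
  have A: "(LINT x|M. f x) = A * \<mu>"
    unfolding \<mu>_def A_def using measure_times_mean[OF M] by simp
  have c: "integrable M (\<lambda>_. c\<^sup>2)" using integrable_mult_right[OF M, of "c\<^sup>2"] by simp
  have "X = (LINT x|M. (f x)\<^sup>2 - 2 * c * f x + c\<^sup>2)"
    unfolding X_def by (intro Bochner_Integration.integral_cong) (auto simp: power2_eq_square algebra_simps)
  also have "\<dots> = (LINT x|M. (f x)\<^sup>2) - 2 * c * (LINT x|M. f x) + A * c\<^sup>2"
    using f c by (simp add: Bochner_Integration.integral_add Bochner_Integration.integral_diff A_def)
  also have "\<dots> = F - 2 * c * (A * \<mu>) + A * c\<^sup>2" by (simp only: A F_def)
  finally have "X + A * \<mu>\<^sup>2 - F = A * (\<mu> - c)\<^sup>2"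
    by (simp add: power2_eq_square algebra_simps)
  moreover have "0 \<le> A * (\<mu> - c)\<^sup>2" by (simp add: A_def)
  ultimately have "F \<le> X + A * \<mu>\<^sup>2" by linarith
  then show ?thesis by (simp add: X_def F_def \<mu>_def A_def)
qed

text \<open>The face variable \<open>w\<close> is compared, through \<open>v\<close>, with the
  single value \<open>v x0\<close>; its mean stays as a separate term, to be controlled by the
  lifting.\<close>

lemma face_estimate:
  fixes e :: "(real^'n) set"
  assumes e: "flat_face e" "x0 \<in> e" and v: "continuous_on UNIV p" "\<And>x. x \<in> e \<Longrightarrow> v x = p x"
    and w: "continuous_on UNIV q" "\<And>x. x \<in> e \<Longrightarrow> w x = q x"
    and osc: "\<And>x. x \<in> e \<Longrightarrow> (v x - v x0)\<^sup>2 \<le> B"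
  shows "(LINT x|face_measure e. (w x)\<^sup>2) \<le>
      2 * (LINT x|face_measure e. (v x - w x)\<^sup>2) + 2 * B * face_area e
      + face_area e * (1 / face_area e * (LINT x|face_measure e. w x))\<^sup>2"
    and "(LINT x|face_measure e. (v x)\<^sup>2) \<le>
      2 * (LINT x|face_measure e. (v x - w x)\<^sup>2) + 2 * (LINT x|face_measure e. (w x)\<^sup>2)"
proof -
  note I = face_measure_integrable[OF e(1)]
  have A: "face_area e = measure (face_measure e) (space (face_measure e))"
    by (simp add: face_area_def space_face_measure)
  have one: "integrable (face_measure e) (\<lambda>_. 1::real)" by (rule I[of "\<lambda>_. 1"]) auto
  have iw: "integrable (face_measure e) w" using w by (rule I)
  have iw2: "integrable (face_measure e) (\<lambda>x. (w x)\<^sup>2)"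
    by (rule I[of "\<lambda>x. (q x)\<^sup>2"]) (use w in \<open>auto intro!: continuous_intros\<close>)
  have iv2: "integrable (face_measure e) (\<lambda>x. (v x)\<^sup>2)"
    by (rule I[of "\<lambda>x. (p x)\<^sup>2"]) (use v in \<open>auto intro!: continuous_intros\<close>)
  have ivw: "integrable (face_measure e) (\<lambda>x. (v x - w x)\<^sup>2)"
    by (rule I[of "\<lambda>x. (p x - q x)\<^sup>2"]) (use v w in \<open>auto intro!: continuous_intros\<close>)
  have iwc: "integrable (face_measure e) (\<lambda>x. (w x - v x0)\<^sup>2)"
    by (rule I[of "\<lambda>x. (q x - v x0)\<^sup>2"]) (use w in \<open>auto intro!: continuous_intros\<close>)
  have sq: "(a + b)\<^sup>2 \<le> 2 * a\<^sup>2 + 2 * b\<^sup>2" for a b :: real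
    using zero_le_power2[of "a - b"] by (simp add: power2_eq_square algebra_simps)
  have "(LINT x|face_measure e. (w x - v x0)\<^sup>2) \<le> (LINT x|face_measure e. 2 * (v x - w x)\<^sup>2 + 2 * B * 1)"
  proof (rule integral_mono[OF iwc])
    show "integrable (face_measure e) (\<lambda>x. 2 * (v x - w x)\<^sup>2 + 2 * B * 1)"
      using ivw one by (intro Bochner_Integration.integrable_add integrable_mult_right) auto
    fix x assume "x \<in> space (face_measure e)"
    then have "(v x - v x0)\<^sup>2 \<le> B" using osc by (simp add: space_face_measure)
    moreover have "(w x - v x0)\<^sup>2 \<le> 2 * (v x - w x)\<^sup>2 + 2 * (v x - v x0)\<^sup>2"
      using sq[of "w x - v x" "v x - v x0"] by (simp add: power2_commute)
    ultimately show "(w x - v x0)\<^sup>2 \<le> 2 * (v x - w x)\<^sup>2 + 2 * B * 1" by linarith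
  qed
  also have "\<dots> = 2 * (LINT x|face_measure e. (v x - w x)\<^sup>2) + 2 * B * face_area e"
    using ivw integrable_mult_right[OF one, of "2 * B"]
    by (subst Bochner_Integration.integral_add) (auto simp: A)
  finally show "(LINT x|face_measure e. (w x)\<^sup>2) \<le>
      2 * (LINT x|face_measure e. (v x - w x)\<^sup>2) + 2 * B * face_area e
      + face_area e * (1 / face_area e * (LINT x|face_measure e. w x))\<^sup>2"
    using integral_square_le_mean[OF one iw iw2, of "v x0"] unfolding A by linarith
  have "(LINT x|face_measure e. (v x)\<^sup>2) \<le> (LINT x|face_measure e. 2 * (v x - w x)\<^sup>2 + 2 * (w x)\<^sup>2)"
  proof (rule integral_mono[OF iv2])
    show "integrable (face_measure e) (\<lambda>x. 2 * (v x - w x)\<^sup>2 + 2 * (w x)\<^sup>2)"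
      using ivw iw2 by (intro Bochner_Integration.integrable_add integrable_mult_right) auto
    show "(v x)\<^sup>2 \<le> 2 * (v x - w x)\<^sup>2 + 2 * (w x)\<^sup>2" for x
      using sq[of "v x - w x" "w x"] by simp
  qed
  also have "\<dots> = 2 * (LINT x|face_measure e. (v x - w x)\<^sup>2) + 2 * (LINT x|face_measure e. (w x)\<^sup>2)"
    using ivw iw2 by (subst Bochner_Integration.integral_add) auto
  finally show "(LINT x|face_measure e. (v x)\<^sup>2) \<le>
      2 * (LINT x|face_measure e. (v x - w x)\<^sup>2) + 2 * (LINT x|face_measure e. (w x)\<^sup>2)" .
qed

lemma H1_seminorm_square:
  "(H1_seminorm T u)\<^sup>2 = (\<Sum>K\<in>T. LINT x:interior K|lborel. (norm (grad (u K) x))\<^sup>2)"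
  unfolding H1_seminorm_def set_lebesgue_integral_def
  by (intro real_sqrt_pow2 sum_nonneg Bochner_Integration.integral_nonneg) auto

lemma bdry_norm_square:
  "(bdry_norm \<Omega> T w)\<^sup>2 = (\<Sum>e\<in>boundary_faces \<Omega> T. LINT x|face_measure e. (w e x)\<^sup>2)"
  unfolding bdry_norm_def
  by (intro real_sqrt_pow2 sum_nonneg Bochner_Integration.integral_nonneg) auto

lemma barycenter_in_facet:
  fixes e :: "(real^'n) set"
  assumes "flat_face e" "e = convex hull V" "\<not> affine_dependent V"
  shows "barycenter e \<in> e"
proof -
  have ext: "{v. v extreme_point_of e} = V"
    using extreme_point_of_convex_hull_affine_independent[OF assms(3)] assms(2) by auto
  have fin: "finite V" using assms(3) by (rule aff_independent_finite)
  have "V \<noteq> {}" using assms(1,2) by (auto simp: flat_face_def)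
  then have "(\<Sum>v\<in>V. (1 / real (card V)) *\<^sub>R v) \<in> convex hull V"
    using fin by (intro convex_sum[OF fin convex_convex_hull]) (auto simp: hull_inc)
  then show ?thesis unfolding barycenter_def ext scaleR_sum_right by (simp add: assms(2))
qed

subsection \<open>The trace inequalities\<close>

text \<open>A simplex has at most \<open>d + 1\<close> facets, so each element is counted at most
  that often.\<close>

lemma (in uniform_mesh) sum_face_elements:
  fixes g :: "'a set \<Rightarrow> real"
  assumes "finite B" "\<And>e. e \<in> B \<Longrightarrow> k e \<in> T \<and> e facet_of k e" "\<And>K. K \<in> T \<Longrightarrow> g K \<ge> 0"
  shows "(\<Sum>e\<in>B. g (k e)) \<le> real (DIM('a) + 1) * (\<Sum>K\<in>T. g K)"
proof -
  have "k ` B \<subseteq> T" using assms(2) by blast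
  have "(\<Sum>e\<in>B. g (k e)) = (\<Sum>K\<in>T. \<Sum>e | e \<in> B \<and> k e = K. g (k e))"
    by (rule sum.group[OF assms(1) finite_mesh \<open>k ` B \<subseteq> T\<close>, symmetric])
  also have "\<dots> = (\<Sum>K\<in>T. real (card {e \<in> B. k e = K}) * g K)"
    by (intro sum.cong refl) simp
  also have "\<dots> \<le> (\<Sum>K\<in>T. real (DIM('a) + 1) * g K)"
  proof (intro sum_mono mult_right_mono)
    fix K assume K: "K \<in> T"
    have "card {e \<in> B. k e = K} \<le> card {F. F facet_of K}"
      using card_facets(1)[OF K] assms(2) by (intro card_mono) auto
    then have "card {e \<in> B. k e = K} \<le> DIM('a) + 1" using card_facets(2)[OF K] by linarith
    then show "real (card {e \<in> B. k e = K}) \<le> real (DIM('a) + 1)" by (simp only: of_nat_le_iff)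
  qed (use assms(3) in auto)
  finally show ?thesis by (simp only: sum_distrib_left)
qed

lemma barycenter_facet:
  fixes e :: "(real^'n) set"
  assumes "uniform_mesh T h \<theta>" "K \<in> T" "e facet_of K"
  shows "barycenter e \<in> e"
proof -
  interpret M: uniform_mesh T h \<theta> by fact
  obtain V u where "e = convex hull (V - {u})" "\<not> affine_dependent (V - {u})"
    using facet_vertices[OF M.full_dim[OF assms(2)] assms(3)] by metis
  then show ?thesis using barycenter_in_facet[OF flat_faceI[OF assms]] by blast
qed

lemma finite_boundary_faces:
  assumes "uniform_mesh T h \<theta>"
  shows "finite (boundary_faces \<Omega> T)"
proof -
  interpret uniform_mesh T h \<theta> by fact
  have "boundary_faces \<Omega> T \<subseteq> (\<Union>K\<in>T. {F. F facet_of K})" by (auto simp: boundary_faces_def faces_def)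
  then show ?thesis using finite_mesh card_facets(1) by (meson finite_UN_I finite_subset)
qed

lemma H1_seminorm_affine:
  assumes mesh: "uniform_mesh T h \<theta>" and w: "\<And>K x. K \<in> T \<Longrightarrow> x \<in> K \<Longrightarrow> w K x = m K \<bullet> x + a K"
  shows "(H1_seminorm T w)\<^sup>2 = (\<Sum>K\<in>T. (norm (m K))\<^sup>2 * measure lborel K)"
proof -
  interpret uniform_mesh T h \<theta> by fact
  have "(LINT x:interior K|lborel. (norm (grad (w K) x))\<^sup>2) = (norm (m K))\<^sup>2 * measure lborel K" if K: "K \<in> T" for K
  proof -
    have "GDERIV (\<lambda>x. m K \<bullet> x + a K) x :> m K" for x
      unfolding gderiv_def by (auto intro!: derivative_eq_intros simp: inner_commute)
    then have "grad (w K) x = m K" if "x \<in> interior K" for x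
      using grad_polys_interior[of "\<lambda>x. m K \<bullet> x + a K" x "m K" K "w K"] w[OF K] that by blast
    then have "(LINT x:interior K|lborel. (norm (grad (w K) x))\<^sup>2) = (LINT x:interior K|lborel. (norm (m K))\<^sup>2)"
      by (intro set_lebesgue_integral_cong) auto
    also have "\<dots> = measure lborel (interior K) * (norm (m K))\<^sup>2"
      by (simp add: set_lebesgue_integral_def)
    finally show ?thesis using measure_interior_element[OF K] by simp
  qed
  then show ?thesis by (simp add: H1_seminorm_square)
qed

lemma CR_trace:
  fixes \<Omega> :: "(real^'n) set" and \<theta> D :: real
  assumes card: "CARD('n) \<in> {2, 3}" and \<Omega>: "polyhedral_domain \<Omega>" and \<theta>: "\<theta> > 0"
  obtains C where "C > 0"
    "\<And>T h \<mu>. uniform_mesh T h \<theta> \<Longrightarrow> \<Union>T = closure \<Omega> \<Longrightarrow> h \<le> D \<Longrightarrow>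
      (\<Sum>e\<in>boundary_faces \<Omega> T. face_area e) \<le> C \<and>
      (\<exists>c. (\<Sum>e\<in>boundary_faces \<Omega> T. face_area e * (\<mu> e - c)\<^sup>2) \<le> C * (H1_seminorm T (CR_lift \<Omega> T \<mu>))\<^sup>2)"
proof -
  let ?d = "CARD('n)"
  obtain Ct where Ct: "Ct > 0" "\<And>T (h::real) f b k. mesh_function T h \<theta> f b \<Longrightarrow> \<Union>T = closure \<Omega> \<Longrightarrow> h \<le> D \<Longrightarrow>
       (\<And>e. e \<in> boundary_faces \<Omega> T \<Longrightarrow> k e \<in> T \<and> e facet_of k e) \<Longrightarrow>
       real (card (boundary_faces \<Omega> T)) * h ^ CARD('n) \<le> Ct * h \<and>
       (\<exists>c. h * (\<Sum>e\<in>boundary_faces \<Omega> T. (f (k e) - c)\<^sup>2) \<le> Ct * (\<Sum>K\<in>T. (b K)\<^sup>2))"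
    using discrete_trace[OF \<Omega> \<theta>, of D] by blast
  define a0 where "a0 = (1 + 3 * \<bar>D\<bar>) * unit_ball_vol (real ?d) * 2 ^ ?d"
  have a0: "a0 \<ge> 0" by (simp add: a0_def)
  define C1 where "C1 = a0 * (2 * \<bar>D\<bar> * (?d + 1) + 2 * Ct)"
  have C1: "C1 \<ge> 0" using a0 Ct(1) by (simp add: C1_def)
  define C where "C = a0 * Ct + C1 / \<theta> + 1"
  have C: "C > 0" "a0 * Ct \<le> C" "C1 / \<theta> \<le> C" using a0 Ct(1) C1 \<theta> by (auto simp: C_def add_nonneg_pos)
  show ?thesis
  proof (rule that[OF C(1)])
    fix T :: "(real^'n) set set" and h :: real and \<mu> :: "(real^'n) set \<Rightarrow> real"
    assume mesh: "uniform_mesh T h \<theta>" and T: "\<Union>T = closure \<Omega>" and hD: "h \<le> D"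
    interpret uniform_mesh T h \<theta> by fact
    let ?B = "boundary_faces \<Omega> T"
    define w where "w = CR_lift \<Omega> T \<mu>"
    have finB: "finite ?B" by (rule finite_boundary_faces[OF mesh])
    define k where "k e = (THE K. K \<in> T \<and> e facet_of K)" for e
    have k: "k e \<in> T" "e facet_of k e" if "e \<in> ?B" for e
      using boundary_face_element[OF mesh \<Omega> T that] by (auto simp: k_def)
    have spec: "w \<in> CR_space \<Omega> T" "\<And>e K. K \<in> T \<Longrightarrow> e facet_of K \<Longrightarrow> w K (barycenter e) = \<mu> e"
      using CR_lift_spec[OF card mesh \<Omega> T, of \<mu>] by (auto simp: w_def faces_def)
    have "\<forall>K\<in>T. \<exists>ma. \<forall>x\<in>K. w K x = fst ma \<bullet> x + snd ma"
    proof
      fix K assume "K \<in> T"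
      then obtain p where "p \<in> polys 1" "\<forall>x\<in>K. w K x = p x"
        using spec(1) unfolding CR_space_def U_space_def by blast
      then obtain m a where "\<forall>x\<in>K. w K x = m \<bullet> x + a" unfolding polys_1_iff by auto
      then show "\<exists>ma. \<forall>x\<in>K. w K x = fst ma \<bullet> x + snd ma" by (intro exI[of _ "(m, a)"]) simp
    qed
    from bchoice[OF this] obtain ma where ma: "\<And>K x. K \<in> T \<Longrightarrow> x \<in> K \<Longrightarrow> w K x = fst (ma K) \<bullet> x + snd (ma K)"
      by blast
    have "\<forall>K\<in>T. \<exists>p. p \<in> K" using interior_element_nonempty interior_subset by blast
    from bchoice[OF this] obtain p where p: "\<And>K. K \<in> T \<Longrightarrow> p K \<in> K" by blast
    \<comment> \<open>The sample point is arbitrary in \<open>K\<close>. With this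
      \<open>b K\<close>, the sample differs by at most \<open>b K\<close> from
      \<open>\<mu> e\<close> on every facet of \<open>K\<close>, and two elements with a common
      facet are compared through its \<open>\<mu> e\<close>.\<close>
    define f where "f K = w K (p K)" for K
    define b where "b K = h * norm (fst (ma K))" for K
    have f\<mu>: "\<bar>f K - \<mu> e\<bar> \<le> b K" if K: "K \<in> T" "e facet_of K" for K e
    proof -
      have be: "barycenter e \<in> K" using barycenter_facet[OF mesh K] facet_of_imp_subset[OF K(2)] by blast
      have "f K - \<mu> e = fst (ma K) \<bullet> (p K - barycenter e)"
        using ma[OF K(1) p[OF K(1)]] ma[OF K(1) be] spec(2)[OF K] by (simp add: f_def inner_diff_right)
      then have "\<bar>f K - \<mu> e\<bar> \<le> norm (fst (ma K)) * norm (p K - barycenter e)"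
        using Cauchy_Schwarz_ineq2 by simp
      also have "\<dots> \<le> norm (fst (ma K)) * h"
        using dist_le[OF K(1) p[OF K(1)] be] by (intro mult_left_mono) (auto simp: dist_norm)
      finally show ?thesis by (simp add: b_def mult.commute)
    qed
    have mf: "mesh_function T h \<theta> f b"
    proof unfold_locales
      fix K L assume KL: "K \<in> T" "L \<in> T" "facet_adjacent K L"
      then obtain e where "e facet_of K" "e facet_of L" by (auto simp: facet_adjacent_def)
      then show "\<bar>f K - f L\<bar> \<le> b K + b L" using f\<mu>[OF KL(1), of e] f\<mu>[OF KL(2), of e] by linarith
    qed (use h_pos in \<open>simp add: b_def\<close>)
    have "real (card ?B) * h ^ ?d \<le> Ct * h \<and> (\<exists>c. h * (\<Sum>e\<in>?B. (f (k e) - c)\<^sup>2) \<le> Ct * (\<Sum>K\<in>T. (b K)\<^sup>2))"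
      using k by (intro Ct(2)[OF mf T hD]) blast
    then obtain c where count: "real (card ?B) * h ^ ?d \<le> Ct * h"
      and c: "h * (\<Sum>e\<in>?B. (f (k e) - c)\<^sup>2) \<le> Ct * (\<Sum>K\<in>T. (b K)\<^sup>2)" by blast
    have area: "h * face_area e \<le> a0 * h ^ ?d" if e: "e \<in> ?B" for e
      unfolding a0_def using facet_area_le[OF mesh k[OF e], of "\<bar>D\<bar>"] hD by simp
    have "h * (\<Sum>e\<in>?B. face_area e) \<le> (\<Sum>e\<in>?B. a0 * h ^ ?d)"
      unfolding sum_distrib_left using area by (rule sum_mono)
    also have "\<dots> = a0 * (real (card ?B) * h ^ ?d)" by simp
    also have "\<dots> \<le> a0 * (Ct * h)" using count a0 by (rule mult_left_mono)
    finally have "h * (\<Sum>e\<in>?B. face_area e) \<le> h * (a0 * Ct)" by (simp add: mult_ac)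
    then have total: "(\<Sum>e\<in>?B. face_area e) \<le> C" using h_pos C(2) by simp
    define S where "S = (\<Sum>K\<in>T. (norm (fst (ma K)))\<^sup>2)"
    have S: "S \<ge> 0" by (simp add: S_def sum_nonneg)
    have bS: "(\<Sum>K\<in>T. (b K)\<^sup>2) = h\<^sup>2 * S" by (simp add: b_def S_def power_mult_distrib sum_distrib_left)
    have E: "\<theta> * h ^ ?d * S \<le> (H1_seminorm T w)\<^sup>2"
    proof -
      have "\<theta> * h ^ ?d * S = (\<Sum>K\<in>T. (norm (fst (ma K)))\<^sup>2 * (\<theta> * h ^ ?d))"
        by (simp add: S_def sum_distrib_left mult_ac)
      also have "\<dots> \<le> (\<Sum>K\<in>T. (norm (fst (ma K)))\<^sup>2 * measure lborel K)"
        using volume_ge by (intro sum_mono mult_left_mono) auto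
      also have "\<dots> = (H1_seminorm T w)\<^sup>2"
        using H1_seminorm_affine[OF mesh, of w "\<lambda>K. fst (ma K)" "\<lambda>K. snd (ma K)"] ma by simp
      finally show ?thesis .
    qed
    have sq: "(\<mu> e - c)\<^sup>2 \<le> 2 * (b (k e))\<^sup>2 + 2 * (f (k e) - c)\<^sup>2" if e: "e \<in> ?B" for e
    proof -
      have "\<bar>\<mu> e - f (k e)\<bar>\<^sup>2 \<le> (b (k e))\<^sup>2"
        using f\<mu>[OF k[OF e]] by (intro power_mono) auto
      moreover have "(\<mu> e - c)\<^sup>2 \<le> 2 * (\<mu> e - f (k e))\<^sup>2 + 2 * (f (k e) - c)\<^sup>2"
        using zero_le_power2[of "(\<mu> e - f (k e)) - (f (k e) - c)"] by (simp add: power2_eq_square algebra_simps)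
      ultimately show ?thesis by simp
    qed
    have bsum: "(\<Sum>e\<in>?B. (b (k e))\<^sup>2) \<le> (?d + 1) * (h\<^sup>2 * S)"
      using sum_face_elements[OF finB, of k "\<lambda>K. (b K)\<^sup>2"] k bS by simp
    \<comment> \<open>One factor \<open>h\<close> goes to the face areas and one to the discrete
      trace bound; both come back from the energy, which is \<open>h ^ 2\<close> times
      \<open>S\<close>.\<close>
    have "h\<^sup>2 * (\<Sum>e\<in>?B. face_area e * (\<mu> e - c)\<^sup>2) = h * (\<Sum>e\<in>?B. (h * face_area e) * (\<mu> e - c)\<^sup>2)"
      by (simp add: sum_distrib_left power2_eq_square mult_ac)
    also have "\<dots> \<le> h * (\<Sum>e\<in>?B. (a0 * h ^ ?d) * (2 * (b (k e))\<^sup>2 + 2 * (f (k e) - c)\<^sup>2))"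
    proof (rule mult_left_mono[OF sum_mono])
      fix e assume e: "e \<in> ?B"
      have "0 \<le> a0 * h ^ ?d" using a0 h_pos by simp
      then show "(h * face_area e) * (\<mu> e - c)\<^sup>2 \<le> (a0 * h ^ ?d) * (2 * (b (k e))\<^sup>2 + 2 * (f (k e) - c)\<^sup>2)"
        by (rule mult_mono[OF area[OF e] sq[OF e]]) simp
    qed (use h_pos in simp)
    also have "\<dots> = a0 * h ^ ?d * (2 * (h * (\<Sum>e\<in>?B. (b (k e))\<^sup>2)) + 2 * (h * (\<Sum>e\<in>?B. (f (k e) - c)\<^sup>2)))"
      by (simp add: sum_distrib_left[symmetric] sum.distrib algebra_simps)
    also have "\<dots> \<le> a0 * h ^ ?d * (2 * (\<bar>D\<bar> * ((?d + 1) * (h\<^sup>2 * S))) + 2 * (Ct * (h\<^sup>2 * S)))"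
    proof (intro mult_left_mono add_mono)
      show "h * (\<Sum>e\<in>?B. (b (k e))\<^sup>2) \<le> \<bar>D\<bar> * ((?d + 1) * (h\<^sup>2 * S))"
        using bsum hD h_pos by (intro mult_mono) (auto intro: sum_nonneg)
      show "h * (\<Sum>e\<in>?B. (f (k e) - c)\<^sup>2) \<le> Ct * (h\<^sup>2 * S)" using c bS by simp
    qed (use a0 h_pos in auto)
    also have "\<dots> = h\<^sup>2 * (C1 * (h ^ ?d * S))" by (simp add: C1_def algebra_simps)
    finally have "(\<Sum>e\<in>?B. face_area e * (\<mu> e - c)\<^sup>2) \<le> C1 * (h ^ ?d * S)" using h_pos by simp
    also have "\<dots> = C1 / \<theta> * (\<theta> * h ^ ?d * S)" using \<theta> by simp
    also have "\<dots> \<le> C1 / \<theta> * (H1_seminorm T w)\<^sup>2" using E C1 \<theta> by (intro mult_left_mono) auto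
    also have "\<dots> \<le> C * (H1_seminorm T w)\<^sup>2" using C(3) by (intro mult_right_mono) auto
    finally show "(\<Sum>e\<in>?B. face_area e) \<le> C \<and>
        (\<exists>c. (\<Sum>e\<in>?B. face_area e * (\<mu> e - c)\<^sup>2) \<le> C * (H1_seminorm T (CR_lift \<Omega> T \<mu>))\<^sup>2)"
      using total by (auto simp: w_def)
  qed
qed

text \<open>The unknown \<open>c\<close> is recovered from \<open>G\<close>: \<open>c\<close> times
  the total weight of \<open>G\<close> is the weighted sum of \<open>\<mu>\<close> minus the
  deviation \<open>Y\<close>, and \<open>Y\<close> is bounded by Cauchy-Schwarz with the weights
  \<open>A\<close>.\<close>

lemma weighted_sum_control:
  fixes A \<mu> :: "'a \<Rightarrow> real"
  assumes "finite B" "G \<subseteq> B" "\<And>e. e \<in> B \<Longrightarrow> A e \<ge> 0" and \<gamma>: "0 < \<gamma>" "\<gamma> \<le> (\<Sum>e\<in>G. A e)"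
    and S: "(\<Sum>e\<in>B. A e) \<le> S" and X: "(\<Sum>e\<in>B. A e * (\<mu> e - c)\<^sup>2) \<le> X"
  shows "(\<Sum>e\<in>B. A e * (\<mu> e)\<^sup>2) \<le> 2 * X + 2 * S * (2 * (\<Sum>e\<in>G. A e * \<mu> e)\<^sup>2 / \<gamma>\<^sup>2 + 2 * X / \<gamma>)"
proof -
  define g where "g = (\<Sum>e\<in>G. A e)"
  define I where "I = (\<Sum>e\<in>G. A e * \<mu> e)"
  define Y where "Y = (\<Sum>e\<in>G. A e * (\<mu> e - c))"
  have g: "\<gamma> \<le> g" "g > 0" using \<gamma> by (auto simp: g_def)
  have AG: "A e \<ge> 0" if "e \<in> G" for e using assms(2,3) that by blast
  have XG: "(\<Sum>e\<in>G. A e * (\<mu> e - c)\<^sup>2) \<le> X"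
  proof -
    have "(\<Sum>e\<in>G. A e * (\<mu> e - c)\<^sup>2) \<le> (\<Sum>e\<in>B. A e * (\<mu> e - c)\<^sup>2)"
      using assms(1-3) by (intro sum_mono2) auto
    then show ?thesis using X by linarith
  qed
  have "0 \<le> (\<Sum>e\<in>G. A e * (\<mu> e - c)\<^sup>2)" using AG by (intro sum_nonneg) auto
  then have X0: "X \<ge> 0" using XG by linarith
  have S0: "S \<ge> 0"
  proof -
    have "0 \<le> (\<Sum>e\<in>B. A e)" using assms(3) by (intro sum_nonneg) auto
    then show ?thesis using S by linarith
  qed
  have cg: "c * g = I - Y"
    by (simp add: g_def I_def Y_def sum_distrib_left sum_subtractf right_diff_distrib mult.commute)
  have "Y = (\<Sum>e\<in>G. sqrt (A e) * (sqrt (A e) * (\<mu> e - c)))"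
    unfolding Y_def using AG by (intro sum.cong) (auto simp: mult.assoc[symmetric])
  then have "Y\<^sup>2 \<le> (\<Sum>e\<in>G. (sqrt (A e))\<^sup>2) * (\<Sum>e\<in>G. (sqrt (A e) * (\<mu> e - c))\<^sup>2)"
    by (simp only: Cauchy_Schwarz_ineq_sum)
  also have "\<dots> = g * (\<Sum>e\<in>G. A e * (\<mu> e - c)\<^sup>2)"
    using AG by (simp add: g_def power_mult_distrib)
  also have "\<dots> \<le> g * X" using XG g by (intro mult_left_mono) auto
  finally have Y: "Y\<^sup>2 \<le> g * X" .
  have "c\<^sup>2 * g\<^sup>2 = (I - Y)\<^sup>2" using cg by (simp add: power_mult_distrib[symmetric])
  also have "\<dots> \<le> 2 * I\<^sup>2 + 2 * Y\<^sup>2"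
    using zero_le_power2[of "I + Y"] by (simp add: power2_eq_square algebra_simps)
  also have "\<dots> \<le> 2 * I\<^sup>2 + 2 * (g * X)" using Y by linarith
  finally have "c\<^sup>2 \<le> (2 * I\<^sup>2 + 2 * (g * X)) / g\<^sup>2" using g by (simp add: field_simps)
  also have "\<dots> = 2 * I\<^sup>2 / g\<^sup>2 + 2 * X / g" using g by (simp add: add_divide_distrib power2_eq_square)
  also have "\<dots> \<le> 2 * I\<^sup>2 / \<gamma>\<^sup>2 + 2 * X / \<gamma>"
    using g \<gamma>(1) X0 by (intro add_mono divide_left_mono power_mono mult_pos_pos) auto
  finally have c2: "c\<^sup>2 \<le> 2 * I\<^sup>2 / \<gamma>\<^sup>2 + 2 * X / \<gamma>" .
  have "(\<Sum>e\<in>B. A e * (\<mu> e)\<^sup>2) \<le> (\<Sum>e\<in>B. A e * (2 * (\<mu> e - c)\<^sup>2 + 2 * c\<^sup>2))"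
  proof (intro sum_mono mult_left_mono)
    show "(\<mu> e)\<^sup>2 \<le> 2 * (\<mu> e - c)\<^sup>2 + 2 * c\<^sup>2" for e
      using zero_le_power2[of "\<mu> e - 2 * c"] by (simp add: power2_eq_square algebra_simps)
  qed (use assms(3) in auto)
  also have "\<dots> = 2 * (\<Sum>e\<in>B. A e * (\<mu> e - c)\<^sup>2) + 2 * (\<Sum>e\<in>B. A e) * c\<^sup>2"
    by (simp add: distrib_left sum.distrib sum_distrib_left sum_distrib_right mult_ac)
  also have "\<dots> \<le> 2 * X + 2 * S * c\<^sup>2"
    using X S by (intro add_mono mult_left_mono mult_right_mono) auto
  also have "\<dots> \<le> 2 * X + 2 * S * (2 * I\<^sup>2 / \<gamma>\<^sup>2 + 2 * X / \<gamma>)"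
    using c2 S0 by (intro add_mono mult_left_mono) auto
  finally show ?thesis by (simp add: I_def)
qed

lemma boundary_face_flat:
  assumes "uniform_mesh T h \<theta>" "e \<in> boundary_faces \<Omega> T"
  shows "flat_face e"
  using assms flat_faceI by (fastforce simp: boundary_faces_def faces_def)

text \<open>\<open>\<Gamma>\<close> is fixed while its decomposition \<open>G\<close> varies with
  the mesh. A face of positive area from one admissible decomposition is covered by the faces of any
  other, so its area is a lower bound for all of them.\<close>

lemma face_area_sum_lower_bound:
  fixes \<Omega> \<Gamma> :: "(real^'n) set"
  obtains \<gamma> where "\<gamma> > 0"
    "\<And>T h G. uniform_mesh T h \<theta> \<Longrightarrow> G \<subseteq> boundary_faces \<Omega> T \<Longrightarrow> \<Gamma> = \<Union>G \<Longrightarrow> 0 < (\<Sum>e\<in>G. face_area e) \<Longrightarrow>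
      \<gamma> \<le> (\<Sum>e\<in>G. face_area e)"
proof (cases "\<exists>T h G. uniform_mesh T h \<theta> \<and> G \<subseteq> boundary_faces \<Omega> T \<and> \<Gamma> = \<Union>G \<and> 0 < (\<Sum>e\<in>G. face_area e)")
  case True
  then obtain T0 h0 G0 where 0: "uniform_mesh T0 h0 \<theta>" "G0 \<subseteq> boundary_faces \<Omega> T0" "\<Gamma> = \<Union>G0"
    "0 < (\<Sum>e\<in>G0. face_area e)" by blast
  then obtain e0 where e0: "e0 \<in> G0" "face_area e0 > 0"
    by (metis face_area_nonneg linorder_not_less order_antisym sum.neutral less_irrefl)
  show ?thesis
  proof (rule that[OF e0(2)])
    fix T h G assume T: "uniform_mesh T h \<theta>" "G \<subseteq> boundary_faces \<Omega> T" "\<Gamma> = \<Union>G"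
    show "face_area e0 \<le> (\<Sum>e\<in>G. face_area e)"
    proof (rule face_area_cover)
      show "flat_face e0" using boundary_face_flat[OF 0(1)] 0(2) e0(1) by blast
      show "finite G" using finite_boundary_faces[OF T(1)] T(2) finite_subset by blast
      show "flat_face e" if "e \<in> G" for e using boundary_face_flat[OF T(1)] T(2) that by blast
      show "e0 \<subseteq> \<Union>G" using e0(1) 0(3) T(3) by blast
    qed
  qed
next
  case False
  \<comment> \<open>No admissible decomposition exists, so the bound holds vacuously.\<close>
  then show ?thesis using that[of 1] by auto
qed

theorem theorem4p3:
  fixes \<Omega> \<Gamma> :: "(real^'n) set" and k :: nat and \<kappa> A :: real
  assumes "CARD('n) \<in> {2, 3}"
    and "polyhedral_domain \<Omega>"
    and "\<kappa> > 0"
  shows "\<exists>C>0. \<forall>T u uh G.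
    mesh_of \<Omega> T \<and> shape_regular \<kappa> T \<and> quasi_uniform A T \<and> (u, uh) \<in> X_space k T \<and>
    G \<subseteq> boundary_faces \<Omega> T \<and> \<Gamma> = \<Union>G \<and> 0 < (\<Sum>e\<in>G. face_area e) \<longrightarrow>
    (bdry_norm \<Omega> T (bdry_trace T u))\<^sup>2 \<le>
      C * (mesh_size T * (H1_seminorm T u)\<^sup>2
           + (bdry_norm \<Omega> T (\<lambda>e x. bdry_trace T u e x - uh e x))\<^sup>2
           + (1 + mesh_size T) * (H1_seminorm T (CR_lift \<Omega> T (face_avg uh)))\<^sup>2
           + (\<Sum>e\<in>G. LINT x|face_measure e. uh e x)\<^sup>2) \<and>
    (bdry_norm \<Omega> T uh)\<^sup>2 \<le>
      C * (mesh_size T * (H1_seminorm T u)\<^sup>2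
           + (bdry_norm \<Omega> T (\<lambda>e x. bdry_trace T u e x - uh e x))\<^sup>2
           + (1 + mesh_size T) * (H1_seminorm T (CR_lift \<Omega> T (face_avg uh)))\<^sup>2
           + (\<Sum>e\<in>G. LINT x|face_measure e. uh e x)\<^sup>2)"
proof -
  let ?d = "CARD('n)"
  define \<theta> where "\<theta> = \<kappa> / max A 1 ^ ?d"
  define D where "D = diameter (closure \<Omega>)"
  have \<theta>: "\<theta> > 0" using assms(3) by (simp add: \<theta>_def)
  obtain Cc where Cc: "Cc > 0"
    "\<And>T h \<mu>. uniform_mesh T h \<theta> \<Longrightarrow> \<Union>T = closure \<Omega> \<Longrightarrow> h \<le> D \<Longrightarrow>
      (\<Sum>e\<in>boundary_faces \<Omega> T. face_area e) \<le> Cc \<and>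
      (\<exists>c. (\<Sum>e\<in>boundary_faces \<Omega> T. face_area e * (\<mu> e - c)\<^sup>2) \<le> Cc * (H1_seminorm T (CR_lift \<Omega> T \<mu>))\<^sup>2)"
    using CR_trace[OF assms(1,2) \<theta>, of D] by blast
  obtain Co where Co: "Co > 0"
    "\<And>(K :: (real^'n) set) f p x y. compact K \<Longrightarrow> convex K \<Longrightarrow> interior K \<noteq> {} \<Longrightarrow> p \<in> polys k \<Longrightarrow>
      (\<And>z. z \<in> K \<Longrightarrow> f z = p z) \<Longrightarrow> x \<in> K \<Longrightarrow> y \<in> K \<Longrightarrow>
      measure lborel K * (f x - f y)\<^sup>2 \<le> Co * (dist x y)\<^sup>2 * (LINT z:interior K|lborel. (norm (grad f z))\<^sup>2)"
    using polynomial_oscillation[where k = k] by blast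
  obtain \<gamma> where \<gamma>: "\<gamma> > 0"
    "\<And>T h G. uniform_mesh T h \<theta> \<Longrightarrow> G \<subseteq> boundary_faces \<Omega> T \<Longrightarrow> \<Gamma> = \<Union>G \<Longrightarrow> 0 < (\<Sum>e\<in>G. face_area e) \<Longrightarrow>
      \<gamma> \<le> (\<Sum>e\<in>G. face_area e)"
    using face_area_sum_lower_bound[of \<theta> \<Omega> \<Gamma>] by blast
  define a0 where "a0 = (1 + 3 * D) * unit_ball_vol (real ?d) * 2 ^ ?d"
  define C1 where "C1 = 2 * (Co * a0 / \<theta>) * (?d + 1)"
  \<comment> \<open>The two coefficients that \<open>weighted_sum_control\<close> yields for
    \<open>X = Cc * E\<close> and \<open>S = Cc\<close>, merged into one.\<close>
  define C2 where "C2 = 2 * Cc + 4 * Cc / \<gamma>\<^sup>2 + 4 * Cc * Cc / \<gamma>"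
  \<comment> \<open>Passing from \<open>uh\<close> to \<open>u\<close> adds one \<open>Dv\<close> to
    the two already present and doubles everything, hence 6 and the factors 2.\<close>
  define C where "C = 6 + 2 * \<bar>C1\<bar> + 2 * C2"
  have C2: "C2 \<ge> 0" using Cc(1) \<gamma>(1) by (simp add: C2_def)
  have "C > 0" using C2 by (simp add: C_def)
  moreover have "(bdry_norm \<Omega> T (bdry_trace T u))\<^sup>2 \<le>
      C * (mesh_size T * (H1_seminorm T u)\<^sup>2
           + (bdry_norm \<Omega> T (\<lambda>e x. bdry_trace T u e x - uh e x))\<^sup>2
           + (1 + mesh_size T) * (H1_seminorm T (CR_lift \<Omega> T (face_avg uh)))\<^sup>2
           + (\<Sum>e\<in>G. LINT x|face_measure e. uh e x)\<^sup>2) \<and>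
    (bdry_norm \<Omega> T uh)\<^sup>2 \<le>
      C * (mesh_size T * (H1_seminorm T u)\<^sup>2
           + (bdry_norm \<Omega> T (\<lambda>e x. bdry_trace T u e x - uh e x))\<^sup>2
           + (1 + mesh_size T) * (H1_seminorm T (CR_lift \<Omega> T (face_avg uh)))\<^sup>2
           + (\<Sum>e\<in>G. LINT x|face_measure e. uh e x)\<^sup>2)"
    if H: "mesh_of \<Omega> T" "shape_regular \<kappa> T" "quasi_uniform A T" "(u, uh) \<in> X_space k T"
      "G \<subseteq> boundary_faces \<Omega> T" "\<Gamma> = \<Union>G" "0 < (\<Sum>e\<in>G. face_area e)" for T u uh G
  proof -
    define h where "h = mesh_size T"
    have mesh: "uniform_mesh T h \<theta>" and hD: "h \<le> D" and T: "\<Union>T = closure \<Omega>"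
      using uniform_mesh_of[OF H(1-3) assms(3,2)] by (simp_all add: h_def \<theta>_def D_def)
    interpret uniform_mesh T h \<theta> by fact
    let ?B = "boundary_faces \<Omega> T"
    define \<mu> where "\<mu> = face_avg uh"
    define J where "J K = (LINT x:interior K|lborel. (norm (grad (u K) x))\<^sup>2)" for K
    define E where "E = (H1_seminorm T (CR_lift \<Omega> T \<mu>))\<^sup>2"
    define I where "I = (\<Sum>e\<in>G. LINT x|face_measure e. uh e x)"
    define v where "v = bdry_trace T u"
    define Dv where "Dv = (\<Sum>e\<in>?B. LINT x|face_measure e. (v e x - uh e x)\<^sup>2)"
    define el where "el e = (THE K. K \<in> T \<and> e facet_of K)" for e
    have el: "el e \<in> T" "e facet_of el e" if "e \<in> ?B" for e
      using boundary_face_element[OF mesh assms(2) T that] by (auto simp: el_def)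
    have finB: "finite ?B" by (rule finite_boundary_faces[OF mesh])
    have D0: "D > 0" using hD h_pos by simp
    have a0: "a0 \<ge> 0" using D0 by (simp add: a0_def)
    have J0: "J K \<ge> 0" for K
      unfolding J_def set_lebesgue_integral_def by (intro Bochner_Integration.integral_nonneg) auto
    have E0: "E \<ge> 0" by (simp add: E_def)
    have flat: "flat_face e" if "e \<in> ?B" for e using boundary_face_flat[OF mesh that] .
    have Umem: "\<exists>p\<in>polys k. \<forall>x\<in>K. u K x = p x" if "K \<in> T" for K
      using H(4) that by (auto simp: X_space_def U_space_def)
    have Fmem: "\<exists>q\<in>polys k. \<forall>x\<in>e. uh e x = q x" if "e \<in> ?B" for e
      using H(4) that by (auto simp: X_space_def F_space_def boundary_faces_def)
    have area: "h * face_area e \<le> a0 * h ^ ?d" if e: "e \<in> ?B" for e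
      unfolding a0_def by (rule facet_area_le[OF mesh el[OF e] hD])
    have each: "(LINT x|face_measure e. (uh e x)\<^sup>2) \<le>
        2 * (LINT x|face_measure e. (v e x - uh e x)\<^sup>2) + 2 * (Co * a0 / \<theta>) * h * J (el e) + face_area e * (\<mu> e)\<^sup>2"
      "(LINT x|face_measure e. (v e x)\<^sup>2) \<le>
        2 * (LINT x|face_measure e. (v e x - uh e x)\<^sup>2) + 2 * (LINT x|face_measure e. (uh e x)\<^sup>2)"
      if e: "e \<in> ?B" for e
    proof -
      let ?K = "el e"
      have K: "?K \<in> T" "e facet_of ?K" using el[OF e] .
      have sub: "e \<subseteq> ?K" using K(2) by (rule facet_of_imp_subset)
      obtain p where p: "p \<in> polys k" "\<And>x. x \<in> ?K \<Longrightarrow> u ?K x = p x" using Umem[OF K(1)] by blast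
      obtain q where q: "q \<in> polys k" "\<And>x. x \<in> e \<Longrightarrow> uh e x = q x" using Fmem[OF e] by blast
      obtain x0 where x0: "x0 \<in> e" using flat[OF e] by (auto simp: flat_face_def)
      have ve: "v e = u ?K" by (simp add: v_def bdry_trace_def el_def)
      have mpos: "measure lborel ?K > 0"
        using measure_compact_pos[OF compact_element[OF K(1)] interior_element_nonempty[OF K(1)]] .
      define Bd where "Bd = Co * h\<^sup>2 * J ?K / measure lborel ?K"
      have osc: "(v e x - v e x0)\<^sup>2 \<le> Bd" if "x \<in> e" for x
      proof -
        have x: "x \<in> ?K" "x0 \<in> ?K" using that x0 sub by auto
        have "measure lborel ?K * (u ?K x - u ?K x0)\<^sup>2 \<le> Co * (dist x x0)\<^sup>2 * J ?K"
          unfolding J_def using x p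
          by (intro Co(2)[of ?K p "u ?K"] compact_element convex_element interior_element_nonempty K(1)) auto
        also have "\<dots> \<le> Co * h\<^sup>2 * J ?K"
          using dist_le[OF K(1) x] Co(1) J0 by (intro mult_right_mono mult_left_mono power_mono) auto
        finally show ?thesis using mpos by (simp add: Bd_def ve field_simps)
      qed
      \<comment> \<open>\<open>h ^ 2\<close> from the distance, area of order h to the power d - 1,
        volume of order h to the power d: a single factor \<open>h\<close> remains, the one in front
        of the seminorm of \<open>u\<close>.\<close>
      have "Bd * face_area e \<le> (Co * a0 / \<theta>) * h * J ?K"
      proof -
        have "Co * h * J ?K * (h * face_area e) \<le> Co * h * J ?K * (a0 * h ^ ?d)"
          using area[OF e] Co(1) h_pos J0 by (intro mult_left_mono) auto
        also have "\<dots> = (Co * a0 / \<theta>) * h * J ?K * (\<theta> * h ^ ?d)" using \<theta> by simp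
        also have "\<dots> \<le> (Co * a0 / \<theta>) * h * J ?K * measure lborel ?K"
          using volume_ge[OF K(1)] Co(1) a0 \<theta> h_pos J0 by (intro mult_left_mono) auto
        finally have "Co * h\<^sup>2 * J ?K * face_area e \<le> (Co * a0 / \<theta>) * h * J ?K * measure lborel ?K"
          by (simp add: power2_eq_square mult_ac)
        then have "Co * h\<^sup>2 * J ?K * face_area e / measure lborel ?K \<le> (Co * a0 / \<theta>) * h * J ?K"
          using mpos by (simp only: pos_divide_le_eq)
        then show ?thesis by (simp add: Bd_def)
      qed
      moreover have "(LINT x|face_measure e. (uh e x)\<^sup>2) \<le>
          2 * (LINT x|face_measure e. (v e x - uh e x)\<^sup>2) + 2 * Bd * face_area e
          + face_area e * (1 / face_area e * (LINT x|face_measure e. uh e x))\<^sup>2"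
        using polys_continuous[OF p(1)] polys_continuous[OF q(1)] p(2) q(2) sub x0 osc
        by (intro face_estimate(1)[OF flat[OF e], of x0 p _ q]) (auto simp: ve)
      moreover have "1 / face_area e * (LINT x|face_measure e. uh e x) = \<mu> e"
        by (simp add: \<mu>_def face_avg_def)
      ultimately show "(LINT x|face_measure e. (uh e x)\<^sup>2) \<le>
        2 * (LINT x|face_measure e. (v e x - uh e x)\<^sup>2) + 2 * (Co * a0 / \<theta>) * h * J (el e) + face_area e * (\<mu> e)\<^sup>2"
        by simp
      show "(LINT x|face_measure e. (v e x)\<^sup>2) \<le>
        2 * (LINT x|face_measure e. (v e x - uh e x)\<^sup>2) + 2 * (LINT x|face_measure e. (uh e x)\<^sup>2)"
        using polys_continuous[OF p(1)] polys_continuous[OF q(1)] p(2) q(2) sub x0 osc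
        by (intro face_estimate(2)[OF flat[OF e], of x0 p _ q _ Bd]) (auto simp: ve)
    qed
    have JS: "(\<Sum>e\<in>?B. J (el e)) \<le> (?d + 1) * (H1_seminorm T u)\<^sup>2"
      using sum_face_elements[OF finB, of el J] el J0 by (simp add: H1_seminorm_square J_def)
    obtain c where S: "(\<Sum>e\<in>?B. face_area e) \<le> Cc" and c: "(\<Sum>e\<in>?B. face_area e * (\<mu> e - c)\<^sup>2) \<le> Cc * E"
      using Cc(2)[OF mesh T hD, of \<mu>] by (auto simp: E_def)
    have "(\<Sum>e\<in>G. face_area e * \<mu> e) = I"
    proof -
      have "face_area e * \<mu> e = (LINT x|face_measure e. uh e x)" if "e \<in> G" for e
      proof -
        have "flat_face e" using flat H(5) that by blast
        then have "integrable (face_measure e) (\<lambda>_. 1::real)"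
          by (rule face_measure_integrable[of _ "\<lambda>_. 1"]) auto
        from measure_times_mean[OF this, of "uh e"] show ?thesis
          by (simp add: \<mu>_def face_avg_def face_area_def space_face_measure)
      qed
      then show ?thesis by (simp add: I_def)
    qed
    then have "(\<Sum>e\<in>?B. face_area e * (\<mu> e)\<^sup>2) \<le>
        2 * (Cc * E) + 2 * Cc * (2 * I\<^sup>2 / \<gamma>\<^sup>2 + 2 * (Cc * E) / \<gamma>)"
      using weighted_sum_control[OF finB H(5) face_area_nonneg \<gamma>(1) \<gamma>(2)[OF mesh H(5-7)] S c] by simp
    also have "\<dots> = (2 * Cc + 4 * Cc * Cc / \<gamma>) * E + 4 * Cc / \<gamma>\<^sup>2 * I\<^sup>2"
      by (simp add: algebra_simps)
    also have "\<dots> \<le> C2 * E + C2 * I\<^sup>2"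
      using Cc(1) \<gamma>(1) E0 by (intro add_mono mult_right_mono) (auto simp: C2_def)
    finally have mean: "(\<Sum>e\<in>?B. face_area e * (\<mu> e)\<^sup>2) \<le> C2 * E + C2 * I\<^sup>2" .
    have Nh: "(bdry_norm \<Omega> T uh)\<^sup>2 \<le> 2 * Dv + C1 * (h * (H1_seminorm T u)\<^sup>2) + (C2 * E + C2 * I\<^sup>2)"
    proof -
      have "(bdry_norm \<Omega> T uh)\<^sup>2 \<le> (\<Sum>e\<in>?B. 2 * (LINT x|face_measure e. (v e x - uh e x)\<^sup>2)
          + 2 * (Co * a0 / \<theta>) * h * J (el e) + face_area e * (\<mu> e)\<^sup>2)"
        unfolding bdry_norm_square using each(1) by (rule sum_mono)
      also have "\<dots> = 2 * Dv + 2 * (Co * a0 / \<theta>) * h * (\<Sum>e\<in>?B. J (el e)) + (\<Sum>e\<in>?B. face_area e * (\<mu> e)\<^sup>2)"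
        by (simp add: sum.distrib Dv_def sum_distrib_left)
      also have "\<dots> \<le> 2 * Dv + 2 * (Co * a0 / \<theta>) * h * ((?d + 1) * (H1_seminorm T u)\<^sup>2) + (C2 * E + C2 * I\<^sup>2)"
        using JS mean Co(1) a0 \<theta> h_pos by (intro add_mono mult_left_mono) auto
      also have "2 * (Co * a0 / \<theta>) * h * ((?d + 1) * (H1_seminorm T u)\<^sup>2) = C1 * (h * (H1_seminorm T u)\<^sup>2)"
        by (simp only: C1_def mult_ac)
      finally show ?thesis .
    qed
    have Nu: "(bdry_norm \<Omega> T v)\<^sup>2 \<le> 2 * Dv + 2 * (bdry_norm \<Omega> T uh)\<^sup>2"
    proof -
      have "(bdry_norm \<Omega> T v)\<^sup>2 \<le> (\<Sum>e\<in>?B. 2 * (LINT x|face_measure e. (v e x - uh e x)\<^sup>2) + 2 * (LINT x|face_measure e. (uh e x)\<^sup>2))"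
        unfolding bdry_norm_square using each(2) by (rule sum_mono)
      then show ?thesis by (simp add: bdry_norm_square sum.distrib Dv_def sum_distrib_left)
    qed
    define H where "H = h * (H1_seminorm T u)\<^sup>2"
    have H0: "H \<ge> 0" using h_pos by (simp add: H_def)
    have Dv0: "Dv \<ge> 0"
      unfolding Dv_def by (intro sum_nonneg Bochner_Integration.integral_nonneg) auto
    have hE: "E \<le> (1 + h) * E" using E0 h_pos by (simp add: algebra_simps)
    have rhs: "2 * X \<le> C * (H + Dv + (1 + h) * E + I\<^sup>2)"
      if "X \<le> 3 * Dv + C1 * H + (C2 * E + C2 * I\<^sup>2)" for X
    proof -
      have "2 * X \<le> 6 * Dv + 2 * \<bar>C1\<bar> * H + 2 * C2 * E + 2 * C2 * I\<^sup>2"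
        using that mult_right_mono[OF abs_ge_self[of C1] H0] by simp
      also have "\<dots> \<le> C * Dv + C * H + C * ((1 + h) * E) + C * I\<^sup>2"
      proof (intro add_mono)
        show "6 * Dv \<le> C * Dv" "2 * \<bar>C1\<bar> * H \<le> C * H" "2 * C2 * I\<^sup>2 \<le> C * I\<^sup>2"
          using Dv0 H0 C2 by (auto intro!: mult_right_mono simp: C_def)
        have "2 * C2 * E \<le> C * E" using E0 by (intro mult_right_mono) (auto simp: C_def)
        also have "\<dots> \<le> C * ((1 + h) * E)" using hE \<open>C > 0\<close> by simp
        finally show "2 * C2 * E \<le> C * ((1 + h) * E)" .
      qed
      finally show ?thesis by (simp add: algebra_simps)
    qed
    have "(bdry_norm \<Omega> T v)\<^sup>2 \<le> C * (H + Dv + (1 + h) * E + I\<^sup>2)"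
      using rhs[of "Dv + (bdry_norm \<Omega> T uh)\<^sup>2"] Nh Nu by (simp add: H_def)
    moreover have "(bdry_norm \<Omega> T uh)\<^sup>2 \<le> C * (H + Dv + (1 + h) * E + I\<^sup>2)"
      using rhs[of "(bdry_norm \<Omega> T uh)\<^sup>2"] Nh Dv0 zero_le_power2[of "bdry_norm \<Omega> T uh"] unfolding H_def by linarith
    ultimately show ?thesis
      by (simp add: H_def h_def Dv_def v_def E_def I_def \<mu>_def bdry_norm_square)
  qed
  ultimately show ?thesis by blast
qed

end
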